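(* Let $S$ be a Cohen-Macaulay ring and let $I$ be a proper unmixed ideal of $S$ that is generically a complete intersection, with $\operatorname{ht}(I)=c$. Then for any positive integer $m$ one has $$I^{(m)}=I^m:\mathbf F_c(I)^{\infty}.$$
   Context: All rings are Noetherian, commutative, with identity. An ideal $I$ is unmixed of height $c$ if $\operatorname{ht}(p)=c$ for every $p\in\operatorname{Ass}_S(S/I)$. $I$ is generically a complete intersection if for every $p\in\operatorname{Ass}_S(S/I)$ the localization $I_p$ can be generated by an $S_p$-regular sequence. The $m$-th symbolic power of $I$ is $I^{(m)}=\bigcap_{p\in\operatorname{Ass}_S(S/I)}(I^mS_p\cap S)$, where $I^mS_p\cap S$ denotes the preimage in $S$ of $I^mS_p$ under $S\to S_p$. For a finitely generated $S$-module $M$ with free presentation $S^q\xrightarrow{\varphi}S^{\mu}\to M\to 0$, the $j$-th Fitting ideal is $\mathbf F_j(M)=I_{\mu-j}(\varphi)$, the ideal generated by the $(\mu-j)$-minors of $\varphi$ (with $\mathbf F_j(M)=S$ if $j\ge\mu$); it is independent of the presentation. $\mathbf F_c(I)$ is the $c$-th Fitting ideal of $I$ viewed as an $S$-module. For ideals $L,H$, $L:H^{\infty}=\bigcup_{t\ge1}(L:H^t)$. *)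

theory Defs
  imports "HOL-Algebra.Algebra" "HOL-Combinatorics.Permutations" "HOL-Library.Extended_Nat"
begin

section \<open>Localization\<close>

text \<open>The classical construction for a multiplicatively closed set \<open>W\<close>: the fraction \<open>a/s\<close> is the
  equivalence class of the pair \<open>(a, s)\<close>, where \<open>a/s = b/t\<close> iff some \<open>u \<in> W\<close> kills \<open>a t - b s\<close>.
  No assumption that \<open>R\<close> is a domain is made.\<close>

definition loc_rel :: "('a, 'r) ring_scheme \<Rightarrow> 'a set \<Rightarrow> (('a \<times> 'a) \<times> ('a \<times> 'a)) set" where
  "loc_rel R W = {((a, s), (b, t)). a \<in> carrier R \<and> s \<in> W \<and> b \<in> carrier R \<and> t \<in> W \<and>
     (\<exists>u\<in>W. u \<otimes>\<^bsub>R\<^esub> (a \<otimes>\<^bsub>R\<^esub> t \<ominus>\<^bsub>R\<^esub> b \<otimes>\<^bsub>R\<^esub> s) = \<zero>\<^bsub>R\<^esub>)}"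

definition loc_frac :: "('a, 'r) ring_scheme \<Rightarrow> 'a set \<Rightarrow> 'a \<Rightarrow> 'a \<Rightarrow> ('a \<times> 'a) set" where
  "loc_frac R W a s = loc_rel R W `` {(a, s)}"

definition localization :: "('a, 'r) ring_scheme \<Rightarrow> 'a set \<Rightarrow> ('a \<times> 'a) set ring" where
  "localization R W =
     \<lparr>carrier = (carrier R \<times> W) // loc_rel R W,
      monoid.mult = (\<lambda>P Q. \<Union>{loc_frac R W (a \<otimes>\<^bsub>R\<^esub> b) (s \<otimes>\<^bsub>R\<^esub> t) |
               a s b t. (a, s) \<in> P \<and> (b, t) \<in> Q}),
      monoid.one = loc_frac R W \<one>\<^bsub>R\<^esub> \<one>\<^bsub>R\<^esub>,
      ring.zero = loc_frac R W \<zero>\<^bsub>R\<^esub> \<one>\<^bsub>R\<^esub>,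
      ring.add = (\<lambda>P Q. \<Union>{loc_frac R W (a \<otimes>\<^bsub>R\<^esub> t \<oplus>\<^bsub>R\<^esub> b \<otimes>\<^bsub>R\<^esub> s) (s \<otimes>\<^bsub>R\<^esub> t) |
              a s b t. (a, s) \<in> P \<and> (b, t) \<in> Q})\<rparr>"

definition loc_at :: "('a, 'r) ring_scheme \<Rightarrow> 'a set \<Rightarrow> ('a \<times> 'a) set ring" where
  "loc_at R p = localization R (carrier R - p)"

definition loc_map :: "('a, 'r) ring_scheme \<Rightarrow> 'a set \<Rightarrow> 'a \<Rightarrow> ('a \<times> 'a) set" where
  "loc_map R p a = loc_frac R (carrier R - p) a \<one>\<^bsub>R\<^esub>"

text \<open>The ideal \<open>I R\<^sub>p\<close> of \<open>R\<^sub>p\<close> generated by the image of \<open>I\<close>.\<close>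

definition loc_ideal :: "('a, 'r) ring_scheme \<Rightarrow> 'a set \<Rightarrow> 'a set \<Rightarrow> ('a \<times> 'a) set set" where
  "loc_ideal R p I = Idl\<^bsub>loc_at R p\<^esub> (loc_map R p ` I)"

section \<open>Dimension, height, depth\<close>

definition prime_chain :: "('a, 'r) ring_scheme \<Rightarrow> nat \<Rightarrow> (nat \<Rightarrow> 'a set) \<Rightarrow> bool" where
  "prime_chain R n P \<longleftrightarrow> (\<forall>i\<le>n. primeideal (P i) R) \<and> (\<forall>i<n. P i \<subset> P (Suc i))"

definition krull_dim :: "('a, 'r) ring_scheme \<Rightarrow> enat" where
  "krull_dim R = Sup {enat n | n P. prime_chain R n P}"

definition prime_height :: "('a, 'r) ring_scheme \<Rightarrow> 'a set \<Rightarrow> enat" where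
  "prime_height R p = Sup {enat n | n P. prime_chain R n P \<and> P n = p}"

definition ideal_height :: "('a, 'r) ring_scheme \<Rightarrow> 'a set \<Rightarrow> enat" where
  "ideal_height R I = (INF p\<in>{p. primeideal p R \<and> I \<subseteq> p}. prime_height R p)"

text \<open>Each \<open>x\<^sub>i\<close> is a nonzerodivisor on \<open>R/(x\<^sub>1, \<dots>, x\<^bsub>i-1\<^esub>)\<close>, and \<open>R/(x\<^sub>1, \<dots>, x\<^sub>n) \<noteq> 0\<close>.\<close>

definition regular_sequence :: "('a, 'r) ring_scheme \<Rightarrow> 'a list \<Rightarrow> bool" where
  "regular_sequence R xs \<longleftrightarrow> set xs \<subseteq> carrier R \<and> Idl\<^bsub>R\<^esub> (set xs) \<noteq> carrier R \<and>
     (\<forall>i<length xs. \<forall>a\<in>carrier R.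
        xs ! i \<otimes>\<^bsub>R\<^esub> a \<in> Idl\<^bsub>R\<^esub> (set (take i xs)) \<longrightarrow> a \<in> Idl\<^bsub>R\<^esub> (set (take i xs)))"

definition depth :: "('a, 'r) ring_scheme \<Rightarrow> 'a set \<Rightarrow> enat" where
  "depth R J = Sup {enat (length xs) | xs. regular_sequence R xs \<and> set xs \<subseteq> J}"

text \<open>A Noetherian ring all of whose localizations at maximal ideals have depth equal to their
  Krull dimension; \<open>loc_ideal R M M\<close> is the maximal ideal of the local ring \<open>R\<^sub>M\<close>.\<close>

definition cohen_macaulay :: "('a, 'r) ring_scheme \<Rightarrow> bool" where
  "cohen_macaulay R \<longleftrightarrow> cring R \<and> noetherian_ring R \<and>
     (\<forall>M. maximalideal M R \<longrightarrow> depth (loc_at R M) (loc_ideal R M M) = krull_dim (loc_at R M))"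

section \<open>Associated primes and symbolic powers\<close>

text \<open>The modules \<open>R/I\<close> and \<open>I\<close> over \<open>R\<close>.  Module records extend ring records in the library;
  the fields \<open>mult\<close> and \<open>one\<close> play no role.\<close>

definition quot_module :: "('a, 'r) ring_scheme \<Rightarrow> 'a set \<Rightarrow> ('a, 'a set) module" where
  "quot_module R I =
     \<lparr>carrier = carrier (R Quot I),
      monoid.mult = monoid.mult (R Quot I), monoid.one = \<one>\<^bsub>R Quot I\<^esub>,
      ring.zero = \<zero>\<^bsub>R Quot I\<^esub>, ring.add = ring.add (R Quot I),
      smult = (\<lambda>a C. (I +>\<^bsub>R\<^esub> a) \<otimes>\<^bsub>R Quot I\<^esub> C)\<rparr>"

definition ideal_module :: "('a, 'r) ring_scheme \<Rightarrow> 'a set \<Rightarrow> ('a, 'a) module" where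
  "ideal_module R I =
     \<lparr>carrier = I, monoid.mult = monoid.mult R, monoid.one = \<one>\<^bsub>R\<^esub>,
      ring.zero = \<zero>\<^bsub>R\<^esub>, ring.add = ring.add R, smult = (\<lambda>a x. a \<otimes>\<^bsub>R\<^esub> x)\<rparr>"

definition associated_primes :: "('a, 'r) ring_scheme \<Rightarrow> ('a, 'b, 'm) module_scheme \<Rightarrow> 'a set set" where
  "associated_primes R M = {p. primeideal p R \<and>
     (\<exists>x\<in>carrier M. p = {a \<in> carrier R. a \<odot>\<^bsub>M\<^esub> x = \<zero>\<^bsub>M\<^esub>})}"

definition unmixed :: "('a, 'r) ring_scheme \<Rightarrow> 'a set \<Rightarrow> nat \<Rightarrow> bool" where
  "unmixed R I c \<longleftrightarrow> (\<forall>p\<in>associated_primes R (quot_module R I). prime_height R p = enat c)"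

definition generically_complete_intersection :: "('a, 'r) ring_scheme \<Rightarrow> 'a set \<Rightarrow> bool" where
  "generically_complete_intersection R I \<longleftrightarrow>
     (\<forall>p\<in>associated_primes R (quot_module R I).
        \<exists>xs. regular_sequence (loc_at R p) xs \<and> loc_ideal R p I = Idl\<^bsub>loc_at R p\<^esub> (set xs))"

definition ideal_power :: "('a, 'r) ring_scheme \<Rightarrow> 'a set \<Rightarrow> nat \<Rightarrow> 'a set" where
  "ideal_power R I m = I [^]\<^bsub>ideals_set R\<^esub> m"

definition symbolic_power :: "('a, 'r) ring_scheme \<Rightarrow> 'a set \<Rightarrow> nat \<Rightarrow> 'a set" where
  "symbolic_power R I m = (\<Inter>p\<in>associated_primes R (quot_module R I).
     {a \<in> carrier R. loc_map R p a \<in> loc_ideal R p (ideal_power R I m)})"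

section \<open>Fitting ideals\<close>

text \<open>Determinant of the \<open>k \<times> k\<close> matrix \<open>A\<close> (indices below \<open>k\<close>), by the Leibniz formula.\<close>

definition ring_det :: "('a, 'r) ring_scheme \<Rightarrow> nat \<Rightarrow> (nat \<Rightarrow> nat \<Rightarrow> 'a) \<Rightarrow> 'a" where
  "ring_det R k A = (\<Oplus>\<^bsub>R\<^esub>\<sigma>\<in>{\<sigma>. \<sigma> permutes {..<k}}.
     add_pow R (sign \<sigma>) (\<Otimes>\<^bsub>R\<^esub>i\<in>{..<k}. A i (\<sigma> i)))"

text \<open>The ideal generated by the \<open>k\<close>-minors of the \<open>\<mu> \<times> q\<close> matrix \<open>A\<close>; the maps \<open>r\<close> and \<open>s\<close> list
  the chosen rows and columns.\<close>

definition minors_ideal ::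
    "('a, 'r) ring_scheme \<Rightarrow> nat \<Rightarrow> nat \<Rightarrow> (nat \<Rightarrow> nat \<Rightarrow> 'a) \<Rightarrow> nat \<Rightarrow> 'a set" where
  "minors_ideal R \<mu> q A k = Idl\<^bsub>R\<^esub> {ring_det R k (\<lambda>i j. A (r i) (s j)) | r s.
     strict_mono_on {..<k} r \<and> r ` {..<k} \<subseteq> {..<\<mu>} \<and>
     strict_mono_on {..<k} s \<and> s ` {..<k} \<subseteq> {..<q}}"

text \<open>\<open>R\<^sup>q \<longrightarrow> R\<^sup>\<mu> \<longrightarrow> M \<longrightarrow> 0\<close> is exact, where the first map is the \<open>\<mu> \<times> q\<close> matrix \<open>A\<close> acting on columns
  and the second one sends the \<open>i\<close>-th basis vector to \<open>g i\<close>.\<close>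

definition free_presentation ::
    "('a, 'r) ring_scheme \<Rightarrow> ('a, 'b, 'm) module_scheme \<Rightarrow>
     nat \<Rightarrow> nat \<Rightarrow> (nat \<Rightarrow> nat \<Rightarrow> 'a) \<Rightarrow> (nat \<Rightarrow> 'b) \<Rightarrow> bool" where
  "free_presentation R M \<mu> q A g \<longleftrightarrow>
     (\<forall>i<\<mu>. \<forall>j<q. A i j \<in> carrier R) \<and> (\<forall>i<\<mu>. g i \<in> carrier M) \<and>
     (\<forall>x\<in>carrier M. \<exists>v\<in>{..<\<mu>} \<rightarrow> carrier R. x = (\<Oplus>\<^bsub>M\<^esub>i\<in>{..<\<mu>}. v i \<odot>\<^bsub>M\<^esub> g i)) \<and>
     (\<forall>v\<in>{..<\<mu>} \<rightarrow> carrier R. (\<Oplus>\<^bsub>M\<^esub>i\<in>{..<\<mu>}. v i \<odot>\<^bsub>M\<^esub> g i) = \<zero>\<^bsub>M\<^esub> \<longleftrightarrow>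
        (\<exists>w\<in>{..<q} \<rightarrow> carrier R. \<forall>i<\<mu>. v i = (\<Oplus>\<^bsub>R\<^esub>j\<in>{..<q}. A i j \<otimes>\<^bsub>R\<^esub> w j)))"

text \<open>Fitting ideals do not depend on the presentation, so an arbitrary one is chosen.  The value is
  meaningful only for finitely presented \<open>M\<close>; over a Noetherian ring these are the finitely generated
  modules.\<close>

definition fitting_ideal ::
    "('a, 'r) ring_scheme \<Rightarrow> ('a, 'b, 'm) module_scheme \<Rightarrow> nat \<Rightarrow> 'a set" where
  "fitting_ideal R M j =
     (let (\<mu>, q, A) = (SOME (\<mu>, q, A). \<exists>g. free_presentation R M \<mu> q A g)
      in if \<mu> \<le> j then carrier R else minors_ideal R \<mu> q A (\<mu> - j))"

section \<open>Colon ideals and saturation\<close>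

definition ideal_quotient :: "('a, 'r) ring_scheme \<Rightarrow> 'a set \<Rightarrow> 'a set \<Rightarrow> 'a set" where
  "ideal_quotient R L H = {a \<in> carrier R. \<forall>h\<in>H. a \<otimes>\<^bsub>R\<^esub> h \<in> L}"

definition saturation :: "('a, 'r) ring_scheme \<Rightarrow> 'a set \<Rightarrow> 'a set \<Rightarrow> 'a set" where
  "saturation R L H = (\<Union>t\<in>{1..}. ideal_quotient R L (ideal_power R H t))"

end

theory Submission
  imports Defs
begin

text \<open>
  Write \<open>contr p J\<close> for \<open>J S\<^sub>p \<inter> S\<close>.  Let \<open>p \<in> Ass(S/I)\<close>.  By Krull's height theorem and the
  unmixedness of \<open>I\<close>, the regular sequence generating \<open>I\<^sub>p\<close> has length exactly \<open>c\<close>.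
  In particular \<open>I\<^sub>p\<close> has \<open>c\<close> generators, so \<open>F\<^sub>c(I)\<close> is not contained in \<open>p\<close>, and an element
  multiplied into the \<open>m\<close>-th power of \<open>I\<close> by a power of \<open>F\<^sub>c(I)\<close> lies in the symbolic power.

  Conversely, by Cramer's rule every minor \<open>d\<close> generating \<open>F\<^sub>c(I)\<close> satisfies
  \<open>d I \<subseteq> (f\<^sub>1, \<dots>, f\<^sub>c)\<close> for suitable \<open>f\<^sub>i \<in> I\<close>.  If \<open>d \<notin> p \<in> Ass(S/I)\<close>, then the \<open>f\<^sub>i\<close> are
  \<open>c\<close> generators of an ideal of \<open>S\<^sub>p\<close> that is generated by a regular sequence of length \<open>c\<close>,
  so they form a regular, hence quasi-regular, sequence in \<open>S\<^sub>p\<close>.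
  Let \<open>a\<close> lie in the \<open>m\<close>-th symbolic power and suppose \<open>d\<^sup>N a \<in> I\<^sup>k\<close> with \<open>k < m\<close>.
  Then \<open>d\<^sup>k d\<^sup>N a\<close> is a form of degree \<open>k\<close> in the \<open>f\<^sub>i\<close>; quasi-regularity puts its coefficients
  into \<open>I S\<^sub>p\<close> for all such \<open>p\<close>, and therefore a power of \<open>d\<close> multiplies them into \<open>I\<close>.
  So \<open>k\<close> can be increased by one at the cost of a larger \<open>N\<close>.
\<close>

section \<open>Ideals, contraction from a localization, and Nakayama's lemma\<close>

text \<open>All local arguments take place in \<open>S\<close>: an ideal of \<open>S_p\<close> is
  represented by its contraction, and a statement at \<open>p\<close> becomes one up to a factor
  outside \<open>p\<close>. Localizations have another element type and would need their own
  Noetherian property and prime correspondence; with contractions they appear only where the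
  definitions of symbolic powers and regular sequences are translated.

  The converse inclusion needs uniformity. A regular sequence generating \<open>I_p\<close> depends
  on \<open>p\<close>, whereas one expression of an element as a form has to serve many associated
  primes at once. A minor \<open>d\<close> supplies a single list \<open>fs\<close> for every
  associated prime not containing \<open>d\<close>, and a power of \<open>d\<close> takes care of
  those containing it. The powers are combined into a power of the Fitting ideal only at the end.

  Regularity of the \<open>f\<close>'s comes from Steinitz exchange: Nakayama's lemma replaces
  linear algebra over the residue field, and permutability of regular sequences in a local ring
  keeps the exchange going.\<close>

locale noetherian_cring = noetherian_ring + cring

context ring
begin

lemma Idl_ideal: "ideal J R \<Longrightarrow> Idl J = J"
  by (meson equalityI genideal_minimal genideal_self ideal.Icarr subsetI subset_refl)

lemma ideal_add_mem: "ideal J R \<Longrightarrow> a \<in> J \<Longrightarrow> b \<in> J \<Longrightarrow> a \<oplus> b \<in> J"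
  by (simp add: additive_subgroup.a_closed ideal.axioms(1))

lemma ideal_minus_mem: "ideal J R \<Longrightarrow> a \<in> J \<Longrightarrow> b \<in> J \<Longrightarrow> a \<ominus> b \<in> J"
  unfolding a_minus_def
  by (meson additive_subgroup.a_closed additive_subgroup.a_inv_closed ideal.axioms(1))

lemma ideal_uminus_mem: "ideal J R \<Longrightarrow> a \<in> J \<Longrightarrow> \<ominus> a \<in> J"
  by (meson additive_subgroup.a_inv_closed ideal.axioms(1))

lemma ideal_zero_mem: "ideal J R \<Longrightarrow> \<zero> \<in> J"
  by (simp add: additive_subgroup.zero_closed ideal.axioms(1))

lemma ideal_carrier: "ideal J R \<Longrightarrow> J \<subseteq> carrier R"
  by (simp add: additive_subgroup.a_subset ideal.axioms(1))

lemma ideal_finsum_mem: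
  assumes "ideal J R" "\<And>i. i \<in> A \<Longrightarrow> f i \<in> J"
  shows "(\<Oplus>i\<in>A. f i) \<in> J"
proof (cases "finite A")
  case True
  then show ?thesis
    using assms(2)
  proof (induction A rule: finite_induct)
    case empty
    then show ?case using ideal_zero_mem[OF assms(1)] by simp
  next
    case (insert a A)
    have "f \<in> A \<rightarrow> carrier R" "f a \<in> carrier R"
      using insert.prems ideal_carrier[OF assms(1)] by auto
    then show ?case
      using insert ideal_add_mem[OF assms(1)] by simp
  qed
next
  case False
  then show ?thesis using ideal_zero_mem[OF assms(1)] by (simp add: finsum_infinite)
qed

end

context cring
begin

text \<open>The ideal is the sum of \<open>Idl B\<close> and \<open>PIdl x\<close>. Inductions over
  finite generating sets peel off one generator by this equivalence.\<close>

lemma mem_Idl_insert: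
  assumes "B \<subseteq> carrier R" "x \<in> carrier R"
  shows "z \<in> Idl (insert x B) \<longleftrightarrow> (\<exists>w\<in>Idl B. \<exists>r\<in>carrier R. z = w \<oplus> r \<otimes> x)"
proof -
  have "Idl (insert x B) = Idl B <+> PIdl x"
  proof -
    have i: "ideal (Idl B) R" "ideal (PIdl x) R" "ideal (Idl (insert x B)) R"
      using assms by (auto intro: genideal_ideal cgenideal_ideal)
    have "Idl (insert x B) = Idl (Idl B \<union> PIdl x)"
    proof
      show "Idl (insert x B) \<subseteq> Idl (Idl B \<union> PIdl x)"
        using assms genideal_self[of B] cgenideal_self[of x] ideal_carrier[OF i(1)] ideal_carrier[OF i(2)]
        by (intro subset_Idl_subset) auto
      have "Idl B \<subseteq> Idl (insert x B)"
        using assms by (intro subset_Idl_subset) auto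
      moreover have "PIdl x \<subseteq> Idl (insert x B)"
        using assms i(3) genideal_self[of "insert x B"] by (intro cgenideal_minimal) auto
      ultimately show "Idl (Idl B \<union> PIdl x) \<subseteq> Idl (insert x B)"
        using i(3) by (intro genideal_minimal) auto
    qed
    then show ?thesis using union_genideal i by simp
  qed
  then show ?thesis
    by (auto simp: set_add_def' cgenideal_def)
qed

lemma Idl_empty: "Idl {} = {\<zero>}"
  using genideal_minimal[OF zeroideal, of "{}"] ideal_zero_mem[OF genideal_ideal, of "{}"] by auto

lemma ideal_lmult: "ideal J R \<Longrightarrow> r \<in> carrier R \<Longrightarrow> a \<in> J \<Longrightarrow> r \<otimes> a \<in> J"
  by (simp add: ideal.I_l_closed)

lemma ideal_if_closed:
  assumes "J \<subseteq> carrier R" "\<zero> \<in> J" "\<And>a b. a \<in> J \<Longrightarrow> b \<in> J \<Longrightarrow> a \<oplus> b \<in> J"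
    and mult: "\<And>r a. r \<in> carrier R \<Longrightarrow> a \<in> J \<Longrightarrow> r \<otimes> a \<in> J"
  shows "ideal J R"
proof (rule idealI[OF ring_axioms])
  show "x \<otimes> a \<in> J" if "a \<in> J" "x \<in> carrier R" for a x using mult that by blast
  show "a \<otimes> x \<in> J" if "a \<in> J" "x \<in> carrier R" for a x
    using mult[OF that(2,1)] m_comm[of a x] that assms(1) by auto
  show "subgroup J (add_monoid R)"
  proof (rule add.subgroupI)
    fix a assume a: "a \<in> J"
    then have "(\<ominus> \<one>) \<otimes> a \<in> J" by (intro mult) auto
    moreover have "(\<ominus> \<one>) \<otimes> a = \<ominus> a" using a assms(1) by (auto simp: l_minus)
    ultimately show "\<ominus> a \<in> J" by simp
  qed (use assms in auto)
qed

lemma colon_ideal: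
  assumes "ideal J R" "u \<in> carrier R"
  shows "ideal {r \<in> carrier R. r \<otimes> u \<in> J} R"
proof -
  have "{r \<in> carrier R. r \<otimes> u \<in> J} = {r \<in> carrier R. u \<otimes> r \<in> J}"
    using assms m_comm by auto
  then show ?thesis
    using ideal.helper_max_prime[OF assms(1) is_cring assms(2)] by simp
qed

section \<open>Powers of ideals\<close>

lemma ideal_power_0: "ideal_power R J 0 = carrier R"
  by (simp add: ideal_power_def ideals_set_def nat_pow_def)

lemma ideal_power_Suc': "ideal_power R J (Suc n) = ideal_power R J n \<cdot> J"
  by (simp add: ideal_power_def ideals_set_def nat_pow_def)

lemma ideal_power_ideal: "ideal J R \<Longrightarrow> ideal (ideal_power R J n) R"
  by (induction n) (auto simp: ideal_power_0 ideal_power_Suc' oneideal intro: ideal_prod_is_ideal)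

lemma ideal_power_Suc: "ideal J R \<Longrightarrow> ideal_power R J (Suc n) = J \<cdot> ideal_power R J n"
  by (simp add: ideal_power_Suc' ideal_power_ideal ideal_prod_commute)

lemma ideal_power_1: "ideal J R \<Longrightarrow> ideal_power R J (Suc 0) = J"
  by (simp add: ideal_power_Suc ideal_power_0 ideal_prod_one)

lemma ideal_prod_least:
  assumes "ideal L R" "\<And>i j. i \<in> I \<Longrightarrow> j \<in> J \<Longrightarrow> i \<otimes> j \<in> L"
  shows "I \<cdot> J \<subseteq> L"
proof
  fix z assume "z \<in> I \<cdot> J"
  then show "z \<in> L"
    by induction (use assms ideal_add_mem in auto)
qed

lemma ideal_prod_mono: "I \<subseteq> I' \<Longrightarrow> J \<subseteq> J' \<Longrightarrow> I \<cdot> J \<subseteq> I' \<cdot> J'"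
proof
  fix z assume "z \<in> I \<cdot> J" "I \<subseteq> I'" "J \<subseteq> J'"
  then show "z \<in> I' \<cdot> J'"
    by induction (auto intro: ideal_prod.intros)
qed

lemma ideal_power_mono: "I \<subseteq> J \<Longrightarrow> ideal_power R I n \<subseteq> ideal_power R J n"
  by (induction n) (auto simp: ideal_power_0 ideal_power_Suc' dest: ideal_prod_mono)

lemma ideal_power_antimono:
  assumes "ideal J R" "i \<le> n"
  shows "ideal_power R J n \<subseteq> ideal_power R J i"
proof (rule lift_Suc_antimono_le[OF _ assms(2)])
  fix n show "ideal_power R J (Suc n) \<subseteq> ideal_power R J n"
    unfolding ideal_power_Suc'
    using ideal_prod_inter[OF ideal_power_ideal[OF assms(1)] assms(1)] by auto
qed

lemma ideal_power_mult_mem: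
  assumes "ideal J R" "a \<in> J" "b \<in> ideal_power R J n"
  shows "a \<otimes> b \<in> ideal_power R J (Suc n)"
  unfolding ideal_power_Suc[OF assms(1)] using assms by (intro ideal_prod.prod)

lemma pow_mem_ideal_power:
  assumes "ideal J R" "a \<in> J"
  shows "a [^] (n::nat) \<in> ideal_power R J n"
proof -
  have "a \<in> carrier R" using assms ideal_carrier by auto
  then show ?thesis
    by (induction n) (auto simp: ideal_power_0 ideal_power_Suc' assms intro: ideal_prod.prod)
qed

text \<open>Each of the \<open>k\<close> factors of a product in \<open>ideal_power R J k\<close>
  absorbs one factor \<open>d\<close>. This later carries powers of \<open>I\<close> into powers of
  the ideal generated by the \<open>f\<close>'s.\<close>

lemma prod_pow_mem_ideal_power:
  assumes "ideal J R" "a \<in> ideal_power R J k" "d \<in> carrier R" "\<And>x. x \<in> J \<Longrightarrow> d \<otimes> x \<in> F" "ideal F R"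
  shows "d [^] k \<otimes> a \<in> ideal_power R F k"
  using assms(2)
proof (induction k arbitrary: a)
  case 0
  then show ?case using assms by (simp add: ideal_power_0)
next
  case (Suc k)
  have "ideal (ideal_power R F (Suc k)) R" using assms ideal_power_ideal by auto
  \<comment> \<open>The elements carried into \<open>ideal_power R F (Suc k)\<close> by
    \<open>d [^] Suc k\<close> form an ideal, so only products \<open>i \<otimes> j\<close> have to
    be tested.\<close>
  then have c: "ideal {r \<in> carrier R. r \<otimes> (d [^] Suc k) \<in> ideal_power R F (Suc k)} R"
    using assms by (intro colon_ideal) auto
  have "J \<cdot> ideal_power R J k \<subseteq> {r \<in> carrier R. r \<otimes> (d [^] Suc k) \<in> ideal_power R F (Suc k)}"
  proof (rule ideal_prod_least[OF c])
    fix i j assume ij: "i \<in> J" "j \<in> ideal_power R J k"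
    have cc: "i \<in> carrier R" "j \<in> carrier R"
      using ij ideal_carrier[OF assms(1)] ideal_carrier[OF ideal_power_ideal[OF assms(1)]] by auto
    have "(d \<otimes> i) \<otimes> (d [^] k \<otimes> j) \<in> ideal_power R F (Suc k)"
      using assms ij Suc.IH by (intro ideal_power_mult_mem) auto
    moreover have "(d \<otimes> i) \<otimes> (d [^] k \<otimes> j) = i \<otimes> j \<otimes> (d [^] Suc k)"
      using cc assms(3) by (simp add: m_ac)
    ultimately show "i \<otimes> j \<in> {r \<in> carrier R. r \<otimes> (d [^] Suc k) \<in> ideal_power R F (Suc k)}"
      using cc by auto
  qed
  then show ?case
    using Suc.prems assms by (auto simp: ideal_power_Suc m_comm)
qed

text \<open>A monomial of degree \<open>k + 1\<close> either contains \<open>x\<close> or is a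
  monomial in \<open>B\<close>. This splitting drives the later inductions on the number of
  generators: the existence of forms, quasi-regularity, and the bound on powers of finitely
  generated ideals.\<close>

lemma ideal_power_insert_Suc:
  assumes "B \<subseteq> carrier R" "x \<in> carrier R"
    and "z \<in> ideal_power R (Idl (insert x B)) (Suc k)"
  shows "\<exists>g\<in>ideal_power R (Idl (insert x B)) k. \<exists>f\<in>ideal_power R (Idl B) (Suc k). z = x \<otimes> g \<oplus> f"
  using assms(3)
proof (induction k arbitrary: z)
  case 0
  have "ideal (Idl (insert x B)) R" "ideal (Idl B) R"
    using assms by (auto intro: genideal_ideal)
  then show ?case
    using 0 assms mem_Idl_insert[OF assms(1,2)] ideal_carrier[of "Idl B"]
    by (force simp: ideal_power_1 ideal_power_0 m_comm a_comm)
next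
  case (Suc k)
  define I where "I = Idl (insert x B)"
  define K where "K = Idl B"
  have iI: "ideal I R" and iK: "ideal K R" and iP: "\<And>k. ideal (ideal_power R I k) R" 
      "\<And>k. ideal (ideal_power R K k) R"
    using assms by (auto simp: I_def K_def intro: genideal_ideal ideal_power_ideal)
  have KI: "K \<subseteq> I" unfolding K_def I_def using assms by (intro subset_Idl_subset) auto
  note cP = ideal_carrier[OF iP(1)] ideal_carrier[OF iP(2)] ideal_carrier[OF iK]
  have "z \<in> I \<cdot> ideal_power R I (Suc k)"
    using Suc.prems iI by (simp add: I_def ideal_power_Suc)
  then have "\<exists>g\<in>ideal_power R I (Suc k). \<exists>f\<in>ideal_power R K (Suc (Suc k)). z = x \<otimes> g \<oplus> f"
  proof induction
    case (prod i j)
    obtain w r where i: "w \<in> K" "r \<in> carrier R" "i = w \<oplus> r \<otimes> x"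
      using prod(1) mem_Idl_insert[OF assms(1,2)] unfolding I_def K_def by blast
    obtain g f where j: "g \<in> ideal_power R I k" "f \<in> ideal_power R K (Suc k)" "j = x \<otimes> g \<oplus> f"
      using Suc.IH prod(2) unfolding I_def K_def by blast
    have c: "w \<in> carrier R" "g \<in> carrier R" "f \<in> carrier R" "j \<in> carrier R"
      using i j prod cP by auto
    \<comment> \<open>Only the summand \<open>w \<otimes> j\<close> needs the decomposition of
      \<open>j\<close>; in \<open>r \<otimes> x \<otimes> j\<close> the factor \<open>x\<close> is
      already present and \<open>j\<close> has degree \<open>k + 1\<close>.\<close>
    have "i \<otimes> j = (w \<oplus> r \<otimes> x) \<otimes> j" using i by simp
    also have "\<dots> = w \<otimes> (x \<otimes> g \<oplus> f) \<oplus> r \<otimes> x \<otimes> j"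
      using i c assms j(3) by (simp add: l_distr)
    also have "\<dots> = x \<otimes> (r \<otimes> j \<oplus> w \<otimes> g) \<oplus> w \<otimes> f"
      using i(2) c assms(2) by algebra
    finally have "i \<otimes> j = x \<otimes> (r \<otimes> j \<oplus> w \<otimes> g) \<oplus> w \<otimes> f" .
    moreover have "r \<otimes> j \<oplus> w \<otimes> g \<in> ideal_power R I (Suc k)"
      using ideal_add_mem[OF iP(1) ideal_lmult[OF iP(1) i(2) prod(2)] ideal_power_mult_mem[OF iI _ j(1)]] i(1) KI
      by blast
    moreover have "w \<otimes> f \<in> ideal_power R K (Suc (Suc k))"
      using i j ideal_power_mult_mem[OF iK] by auto
    ultimately show ?case by blast
  next
    case (sum s1 s2)
    then obtain g1 f1 g2 f2 where s: "g1\<in>ideal_power R I (Suc k)" "g2\<in>ideal_power R I (Suc k)"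
      "f1\<in>ideal_power R K (Suc (Suc k))" "f2\<in>ideal_power R K (Suc (Suc k))"
      "s1 = x \<otimes> g1 \<oplus> f1" "s2 = x \<otimes> g2 \<oplus> f2" by blast
    have "g1 \<in> carrier R" "g2 \<in> carrier R" "f1 \<in> carrier R" "f2 \<in> carrier R"
      using s cP by blast+
    then have "s1 \<oplus> s2 = x \<otimes> (g1 \<oplus> g2) \<oplus> (f1 \<oplus> f2)"
      unfolding s(5,6) using assms(2) by algebra
    then show ?case
      using ideal_add_mem[OF iP(1) s(1,2)] ideal_add_mem[OF iP(2) s(3,4)] by blast
  qed
  then show ?case unfolding I_def K_def .
qed

section \<open>Contraction from the localization at a prime\<close>

definition contr :: "'a set \<Rightarrow> 'a set \<Rightarrow> 'a set" where
  "contr p J = {a \<in> carrier R. \<exists>s\<in>carrier R - p. s \<otimes> a \<in> J}"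

lemma contrI: "a \<in> carrier R \<Longrightarrow> s \<in> carrier R \<Longrightarrow> s \<notin> p \<Longrightarrow> s \<otimes> a \<in> J \<Longrightarrow> a \<in> contr p J"
  by (auto simp: contr_def)

lemma contrE:
  assumes "a \<in> contr p J"
  obtains s where "a \<in> carrier R" "s \<in> carrier R" "s \<notin> p" "s \<otimes> a \<in> J"
  using assms by (auto simp: contr_def)

lemma contr_mono: "J \<subseteq> K \<Longrightarrow> contr p J \<subseteq> contr p K"
  by (auto simp: contr_def)

lemma contr_antimono: "q \<subseteq> p \<Longrightarrow> contr p J \<subseteq> contr q J"
  by (auto simp: contr_def)

lemma contr_carrier: "contr p J \<subseteq> carrier R"
  by (auto simp: contr_def)

lemma primeideal_one: "primeideal p R \<Longrightarrow> \<one> \<notin> p"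
  by (metis ideal.one_imp_carrier primeideal.I_notcarr primeideal.axioms(1))

lemma primeideal_mult: "primeideal p R \<Longrightarrow> a \<in> carrier R \<Longrightarrow> b \<in> carrier R \<Longrightarrow> a \<notin> p \<Longrightarrow> b \<notin> p \<Longrightarrow> a \<otimes> b \<notin> p"
  by (meson primeideal.I_prime)

lemma primeideal_pow: "primeideal p R \<Longrightarrow> a \<in> carrier R \<Longrightarrow> a \<notin> p \<Longrightarrow> a [^] (n::nat) \<notin> p"
  by (induction n) (auto simp: primeideal_one primeideal_mult)

lemma primeideal_ideal: "primeideal p R \<Longrightarrow> ideal p R"
  by (simp add: primeideal.axioms(1))

lemma subset_contr: "primeideal p R \<Longrightarrow> J \<subseteq> carrier R \<Longrightarrow> J \<subseteq> contr p J"
  using primeideal_one by (force intro!: contrI[of _ \<one>])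

lemma contr_idem:
  assumes "primeideal p R" "ideal J R"
  shows "contr p (contr p J) \<subseteq> contr p J"
proof
  fix a assume "a \<in> contr p (contr p J)"
  then obtain s t where st: "a \<in> carrier R" "s \<in> carrier R - p" "t \<in> carrier R - p" "t \<otimes> (s \<otimes> a) \<in> J"
    by (auto simp: contr_def)
  then show "a \<in> contr p J"
    using assms primeideal_mult by (intro contrI[of _ "t \<otimes> s"]) (auto simp: m_assoc)
qed

lemma contr_subset_contr:
  assumes "primeideal p R" "ideal J R" "K \<subseteq> contr p J"
  shows "contr p K \<subseteq> contr p J"
  using contr_idem[OF assms(1,2)] contr_mono[OF assms(3)] by blast

lemma contr_ideal:
  assumes p: "primeideal p R" and J: "ideal J R"
  shows "ideal (contr p J) R"
proof (rule ideal_if_closed)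
  show "contr p J \<subseteq> carrier R" by (rule contr_carrier)
  show "\<zero> \<in> contr p J"
    using subset_contr[OF p ideal_carrier[OF J]] ideal_zero_mem[OF J] by blast
  show "x \<otimes> a \<in> contr p J" if "x \<in> carrier R" "a \<in> contr p J" for x a
  proof -
    obtain s where s: "a \<in> carrier R" "s \<in> carrier R" "s \<notin> p" "s \<otimes> a \<in> J"
      using \<open>a \<in> contr p J\<close> by (rule contrE)
    then show ?thesis
      using \<open>x \<in> carrier R\<close> J by (intro contrI[of _ s]) (auto simp: m_lcomm[of s x] ideal_lmult)
  qed
  show "a \<oplus> b \<in> contr p J" if ab: "a \<in> contr p J" "b \<in> contr p J" for a b
  proof -
    obtain s t where st: "a \<in> carrier R" "s \<in> carrier R" "s \<notin> p" "s \<otimes> a \<in> J"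
       "b \<in> carrier R" "t \<in> carrier R" "t \<notin> p" "t \<otimes> b \<in> J"
      using ab by (auto simp: contr_def)
    have "(s \<otimes> t) \<otimes> (a \<oplus> b) = t \<otimes> (s \<otimes> a) \<oplus> s \<otimes> (t \<otimes> b)"
      using st by algebra
    then show ?thesis
      using st J primeideal_mult[OF p, of s t]
      by (intro contrI[of _ "s \<otimes> t"]) (auto intro!: ideal_add_mem ideal_lmult)
  qed
qed

lemma contr_finite_common:
  assumes "primeideal p R" "ideal J R" "finite U" "U \<subseteq> contr p J"
  shows "\<exists>s\<in>carrier R - p. \<forall>u\<in>U. s \<otimes> u \<in> J"
  using assms(3,4)
proof (induction U rule: finite_induct)
  case empty
  then show ?case using primeideal_one[OF assms(1)] by blast
next
  case (insert u U)
  obtain s where s: "s\<in>carrier R - p" "\<forall>u\<in>U. s \<otimes> u \<in> J" using insert by auto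
  obtain t where t: "u \<in> carrier R" "t \<in> carrier R" "t \<notin> p" "t \<otimes> u \<in> J" 
    using insert.prems by (auto simp: contr_def)
  have "s \<otimes> t \<otimes> v \<in> J" if v: "v \<in> insert u U" for v
  proof -
    have vc: "v \<in> carrier R" using v insert.prems contr_carrier by blast
    show ?thesis
    proof (cases "v = u")
      case True
      have "s \<otimes> t \<otimes> v = s \<otimes> (t \<otimes> u)" using True s t by (simp add: m_assoc)
      then show ?thesis using s t assms by (auto intro: ideal_lmult)
    next
      case False
      have "s \<otimes> t \<otimes> v = t \<otimes> (s \<otimes> v)" using vc s t by (simp add: m_ac)
      then show ?thesis using s t v False assms by (auto intro: ideal_lmult)
    qed
  qed
  then show ?case
    using s t primeideal_mult[OF assms(1)] by (intro bexI[of _ "s \<otimes> t"]) auto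
qed

lemma contr_prime_subset: "primeideal p R \<Longrightarrow> primeideal q R \<Longrightarrow> q \<subseteq> p \<Longrightarrow> contr p q \<subseteq> q"
  unfolding contr_def using primeideal.I_prime by fastforce

text \<open>An element of \<open>J\<close> outside \<open>p\<close> is a unit of the localization
  and would force \<open>\<one>\<close> into the saturated ideal \<open>J\<close>. In local terms: a
  proper ideal lies in the maximal ideal.\<close>

lemma contr_saturated_subset:
  assumes "ideal J R" "contr p J \<subseteq> J" "J \<noteq> carrier R"
  shows "J \<subseteq> p"
proof
  fix x assume x: "x \<in> J"
  show "x \<in> p"
  proof (rule ccontr)
    assume "x \<notin> p"
    then have "\<one> \<in> contr p J"
      using x ideal_carrier[OF assms(1)] by (intro contrI[of _ x]) auto
    then show False
      using assms ideal.one_imp_carrier by blast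
  qed
qed

section \<open>Nakayama's lemma, expressed by contractions\<close>

lemma nakayama_step:
  assumes p: "primeideal p R" and A: "ideal A R" "A \<subseteq> p" and N: "ideal N R" and M: "M \<subseteq> carrier R" and g: "g \<in> M"
    and gen: "M \<subseteq> contr p (Idl (insert g N))" and sub: "M \<subseteq> contr p (Idl (N \<union> (A \<cdot> M)))"
    and Mi: "ideal M R"
  shows "M \<subseteq> contr p N"
proof -
  have gc: "g \<in> carrier R" using g M by auto
  note Nc = ideal_carrier[OF N] and Ac = ideal_carrier[OF A(1)]
  have IN: "Idl N = N" using N Idl_ideal by auto
  have AMi: "ideal (A \<cdot> M) R" using A Mi ideal_prod_is_ideal by auto
  \<comment> \<open>Since \<open>g\<close> generates \<open>M\<close> locally over \<open>N\<close>,
    every element of \<open>A \<cdot> M\<close> is congruent modulo \<open>N\<close>, up to a factor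
    outside \<open>p\<close>, to a multiple of \<open>g\<close> with coefficient in
    \<open>A\<close>.\<close>
  have key: "\<exists>t\<in>carrier R - p. \<exists>a\<in>A. t \<otimes> w \<ominus> a \<otimes> g \<in> N" if "w \<in> A \<cdot> M" for w
    using that
  proof induction
    case (prod i j)
    obtain t where t: "j \<in> carrier R" "t \<in> carrier R" "t \<notin> p" "t \<otimes> j \<in> Idl (insert g N)"
      using prod gen by (auto simp: contr_def)
    then obtain l r where l: "l \<in> N" "r \<in> carrier R" "t \<otimes> j = l \<oplus> r \<otimes> g"
      using mem_Idl_insert[OF Nc gc] IN by auto
    have ic: "i \<in> carrier R" "l \<in> carrier R" using prod Ac l Nc by auto
    have "t \<otimes> (i \<otimes> j) \<ominus> (i \<otimes> r) \<otimes> g = i \<otimes> (t \<otimes> j) \<ominus> (i \<otimes> r) \<otimes> g"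
      using ic t by (simp add: m_lcomm)
    also have "\<dots> = i \<otimes> l"
      unfolding l(3) using ic l(2) gc by algebra
    finally have "t \<otimes> (i \<otimes> j) \<ominus> (i \<otimes> r) \<otimes> g \<in> N"
      using N ic l by (auto intro: ideal_lmult)
    moreover have "i \<otimes> r \<in> A" using A prod l by (simp add: ideal.I_r_closed)
    ultimately show ?case using t by blast
  next
    case (sum s1 s2)
    then obtain t1 a1 t2 a2 where h: "t1\<in>carrier R - p" "t2\<in>carrier R - p" "a1 \<in> A" "a2 \<in> A"
      "t1 \<otimes> s1 \<ominus> a1 \<otimes> g \<in> N" "t2 \<otimes> s2 \<ominus> a2 \<otimes> g \<in> N" by blast
    have sc: "s1 \<in> carrier R" "s2 \<in> carrier R" "a1 \<in> carrier R" "a2 \<in> carrier R" "t1 \<in> carrier R" "t2 \<in> carrier R"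
      using sum AMi ideal_carrier h Ac by auto
    have "t1 \<otimes> t2 \<otimes> (s1 \<oplus> s2) \<ominus> (t2 \<otimes> a1 \<oplus> t1 \<otimes> a2) \<otimes> g
       = t2 \<otimes> (t1 \<otimes> s1 \<ominus> a1 \<otimes> g) \<oplus> t1 \<otimes> (t2 \<otimes> s2 \<ominus> a2 \<otimes> g)"
      using sc gc by algebra
    moreover have "t2 \<otimes> (t1 \<otimes> s1 \<ominus> a1 \<otimes> g) \<oplus> t1 \<otimes> (t2 \<otimes> s2 \<ominus> a2 \<otimes> g) \<in> N"
      using h N by (auto intro!: ideal_add_mem ideal_lmult)
    moreover have "t2 \<otimes> a1 \<oplus> t1 \<otimes> a2 \<in> A"
      using h A by (auto intro!: ideal_add_mem ideal_lmult)
    moreover have "t1 \<otimes> t2 \<in> carrier R - p"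
      using h primeideal_mult[OF p] by auto
    ultimately show ?case by metis
  qed
  have "g \<in> contr p (Idl (N \<union> (A \<cdot> M)))" using g sub by auto
  then obtain s where s: "s \<in> carrier R" "s \<notin> p" "s \<otimes> g \<in> Idl (N \<union> (A \<cdot> M))" by (auto simp: contr_def)
  then obtain l w where lw: "l \<in> N" "w \<in> A \<cdot> M" "s \<otimes> g = l \<oplus> w"
    using union_genideal[OF N AMi] by (auto simp: set_add_def')
  obtain t a where ta: "t\<in>carrier R - p" "a\<in>A" "t \<otimes> w \<ominus> a \<otimes> g \<in> N" using key lw by blast
  have c: "w \<in> carrier R" "l \<in> carrier R" "a \<in> carrier R" "t \<in> carrier R"
    using lw AMi Nc ta Ac ideal_carrier by auto
  \<comment> \<open>The determinant trick for a single generator: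
    \<open>t \<otimes> s \<ominus> a\<close> multiplies \<open>g\<close> into \<open>N\<close>, and
    it lies outside \<open>p\<close> because \<open>t \<otimes> s\<close> does while
    \<open>a\<close> lies in \<open>A \<subseteq> p\<close>.\<close>
  have "(t \<otimes> s \<ominus> a) \<otimes> g = t \<otimes> (s \<otimes> g) \<ominus> a \<otimes> g"
    using c gc s by algebra
  also have "\<dots> = t \<otimes> l \<oplus> (t \<otimes> w \<ominus> a \<otimes> g)"
    unfolding lw(3) using c gc by algebra
  finally have "(t \<otimes> s \<ominus> a) \<otimes> g \<in> N"
    using ta lw N by (auto intro!: ideal_add_mem ideal_lmult)
  moreover have "t \<otimes> s \<ominus> a \<notin> p"
  proof
    assume "t \<otimes> s \<ominus> a \<in> p"
    then have "(t \<otimes> s \<ominus> a) \<oplus> a \<in> p" 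
      using ta A primeideal_ideal[OF p] ideal_add_mem by blast
    moreover have "(t \<otimes> s \<ominus> a) \<oplus> a = t \<otimes> s" using c s by algebra
    ultimately show False using primeideal_mult[OF p, of t s] ta s by auto
  qed
  ultimately have gN: "g \<in> contr p N"
    using c s gc by (intro contrI[of _ "t \<otimes> s \<ominus> a"]) auto
  have "Idl (insert g N) \<subseteq> contr p N"
    using gN subset_contr[OF p Nc] contr_ideal[OF p N] by (intro genideal_minimal) auto
  then show ?thesis
    using gen contr_subset_contr[OF p N] by blast
qed

lemma nakayama_finite:
  assumes p: "primeideal p R" and A: "ideal A R" "A \<subseteq> p" and M: "ideal M R"
    and "finite G" "G \<subseteq> M" "ideal N R" "M \<subseteq> contr p (Idl (N \<union> G))" "M \<subseteq> contr p (Idl (N \<union> (A \<cdot> M)))"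
  shows "M \<subseteq> contr p N"
  using assms(5-)
proof (induction G arbitrary: N rule: finite_induct)
  case empty
  then show ?case by (simp add: Idl_ideal)
next
  case (insert g G)
  note Mc = ideal_carrier[OF M] and Nc = ideal_carrier[OF insert.prems(2)]
  have AMc: "A \<cdot> M \<subseteq> carrier R" using A M ideal_prod_in_carrier by auto
  define N' where "N' = Idl (N \<union> G)"
  have N': "ideal N' R" unfolding N'_def using insert.prems Mc Nc by (intro genideal_ideal) auto
  have NN': "N \<union> G \<subseteq> N'" unfolding N'_def using insert.prems Mc Nc by (intro genideal_self) auto
  have gc: "g \<in> carrier R" using insert.prems Mc by auto
  have "M \<subseteq> contr p N'"
  proof (rule nakayama_step[OF p A N' Mc _ _ _ M])
    show "g \<in> M" using insert.prems by auto
    have "Idl (N \<union> insert g G) \<subseteq> Idl (insert g N')"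
      using NN' gc ideal_carrier[OF N'] by (intro subset_Idl_subset) auto
    then show "M \<subseteq> contr p (Idl (insert g N'))"
      using insert.prems(3) contr_mono by blast
    have "Idl (N \<union> A \<cdot> M) \<subseteq> Idl (N' \<union> A \<cdot> M)"
      using NN' ideal_carrier[OF N'] AMc by (intro subset_Idl_subset) auto
    then show "M \<subseteq> contr p (Idl (N' \<union> A \<cdot> M))"
      using insert.prems(4) contr_mono by blast
  qed
  then show ?case
    using insert.IH[of N] insert.prems unfolding N'_def by auto
qed

end

context noetherian_cring
begin

lemma nakayama:
  assumes "primeideal p R" "ideal A R" "A \<subseteq> p" "ideal M R" "ideal N R"
    and "M \<subseteq> contr p (Idl (N \<union> (A \<cdot> M)))"
  shows "M \<subseteq> contr p N"
proof -
  obtain G where G: "G \<subseteq> carrier R" "finite G" "M = Idl G"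
    using finetely_gen[OF assms(4)] by blast
  have GM: "G \<subseteq> M" using G genideal_self by auto
  have "M \<subseteq> Idl (N \<union> G)"
    unfolding G(3) using G(1) ideal_carrier[OF assms(5)] by (intro subset_Idl_subset) auto
  moreover have "Idl (N \<union> G) \<subseteq> contr p (Idl (N \<union> G))"
    using G(1) ideal_carrier[OF assms(5)] assms(1) by (intro subset_contr ideal_carrier[OF genideal_ideal]) auto
  ultimately show ?thesis
    using nakayama_finite[OF assms(1-4) G(2) GM assms(5)] assms(6) by blast
qed

section \<open>Maximal members of families of ideals, and primes avoiding multiplicative
  sets\<close>

lemma exists_maximal_ideal:
  assumes "\<J> \<noteq> {}" "\<And>J. J \<in> \<J> \<Longrightarrow> ideal J R"
  shows "\<exists>M\<in>\<J>. \<forall>J\<in>\<J>. M \<subseteq> J \<longrightarrow> J = M"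
proof (rule subset_Zorn_nonempty[OF assms(1)])
  fix C assume C: "C \<noteq> {}" "subset.chain \<J> C"
  then have "subset.chain {I. ideal I R} C"
    using assms(2) unfolding pred_on.chain_def by auto
  \<comment> \<open>In a Noetherian ring a nonempty chain of ideals contains its own union, so
    Zorn's lemma applies to every nonempty family.\<close>
  then have "\<Union>C \<in> C" using ideal_chain_is_trivial C by auto
  then show "\<Union>C \<in> \<J>" using C unfolding pred_on.chain_def by auto
qed

text \<open>Krull's argument: an ideal that is maximal among those containing \<open>J\<close> and
  disjoint from \<open>W\<close> is prime. If it contained neither \<open>a\<close> nor
  \<open>b\<close>, adjoining either would meet \<open>W\<close>, and the product of the two
  elements found in \<open>W\<close> would lie in it as soon as \<open>a \<otimes> b\<close>
  does.\<close>

lemma exists_prime_avoiding: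
  assumes J: "ideal J R" and W: "W \<subseteq> carrier R" "\<one> \<in> W" "\<And>a b. a \<in> W \<Longrightarrow> b \<in> W \<Longrightarrow> a \<otimes> b \<in> W"
    and "J \<inter> W = {}"
  obtains Q where "primeideal Q R" "J \<subseteq> Q" "Q \<inter> W = {}"
proof -
  define \<J> where "\<J> = {Q. ideal Q R \<and> J \<subseteq> Q \<and> Q \<inter> W = {}}"
  have "\<exists>Q\<in>\<J>. \<forall>K\<in>\<J>. Q \<subseteq> K \<longrightarrow> K = Q"
    using assms by (intro exists_maximal_ideal) (auto simp: \<J>_def)
  then obtain Q where QS: "Q \<in> \<J>" and max: "\<forall>K\<in>\<J>. Q \<subseteq> K \<longrightarrow> K = Q" ..
  have Q: "ideal Q R" "J \<subseteq> Q" "Q \<inter> W = {}" using QS by (auto simp: \<J>_def)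
  note Qc = ideal_carrier[OF Q(1)]
  have IQ: "Idl Q = Q" using Q Idl_ideal by auto
  have meet: "\<exists>w\<in>Q. \<exists>r\<in>carrier R. w \<oplus> r \<otimes> a \<in> W" if a: "a \<in> carrier R" "a \<notin> Q" for a
  proof (rule ccontr)
    assume "\<not> ?thesis"
    then have "Idl (insert a Q) \<inter> W = {}"
      using mem_Idl_insert[OF Qc a(1)] IQ by auto
    moreover have sub: "insert a Q \<subseteq> Idl (insert a Q)" using a Qc by (intro genideal_self) auto
    ultimately have "Idl (insert a Q) \<in> \<J>"
      unfolding \<J>_def using a Qc Q by (auto intro!: genideal_ideal)
    then have "Idl (insert a Q) = Q" using max sub by blast
    then show False using sub a by auto
  qed
  have "primeideal Q R"
  proof (rule primeidealI[OF Q(1) is_cring])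
    show "carrier R \<noteq> Q" using W Q by auto
    fix a b assume ab: "a \<in> carrier R" "b \<in> carrier R" "a \<otimes> b \<in> Q"
    show "a \<in> Q \<or> b \<in> Q"
    proof (rule ccontr)
      assume "\<not> ?thesis"
      then obtain v r w t where h: "v \<in> Q" "r \<in> carrier R" "v \<oplus> r \<otimes> a \<in> W"
        "w \<in> Q" "t \<in> carrier R" "w \<oplus> t \<otimes> b \<in> W"
        using meet ab by meson
      have c: "v \<in> carrier R" "w \<in> carrier R" using h Qc by auto
      have "(v \<oplus> r \<otimes> a) \<otimes> (w \<oplus> t \<otimes> b) = (w \<oplus> t \<otimes> b) \<otimes> v \<oplus> (r \<otimes> a) \<otimes> w \<oplus> (r \<otimes> t) \<otimes> (a \<otimes> b)"
        using c h(2,5) ab by algebra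
      moreover have "\<dots> \<in> Q"
        using ideal_lmult[OF Q(1) _ h(1), of "w \<oplus> t \<otimes> b"] ideal_lmult[OF Q(1) _ h(4), of "r \<otimes> a"]
          ideal_lmult[OF Q(1) _ ab(3), of "r \<otimes> t"] h(2,5) ab c by (simp add: ideal_add_mem[OF Q(1)])
      ultimately show False using W(3)[OF h(3,6)] Q by auto
    qed
  qed
  then show thesis using that Q by blast
qed

text \<open>The multiplicative set consists of the products of an element outside \<open>p\<close>
  with a power of \<open>x\<close>. Avoiding the elements outside \<open>p\<close> pushes
  \<open>Q\<close> into \<open>p\<close>; avoiding \<open>x\<close> keeps it out of
  \<open>Q\<close>. Locally at \<open>p\<close>, this says that an element not nilpotent modulo
  \<open>J\<close> is missed by some prime over \<open>J\<close>.\<close>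

lemma exists_prime_avoiding_powers:
  assumes p: "primeideal p R" and J: "ideal J R" and x: "x \<in> carrier R"
    and avoid: "\<And>s n. s \<in> carrier R \<Longrightarrow> s \<notin> p \<Longrightarrow> s \<otimes> x [^] (n::nat) \<notin> J"
  obtains Q where "primeideal Q R" "J \<subseteq> Q" "Q \<subseteq> p" "x \<notin> Q"
proof -
  define W where "W = {s \<otimes> x [^] (n::nat) | s n. s \<in> carrier R - p}"
  have one: "\<one> \<in> carrier R - p" using primeideal_one[OF p] by auto
  have Wm: "s \<otimes> x [^] n \<in> W" if "s \<in> carrier R - p" for s and n :: nat
    unfolding W_def using that by auto
  have W1: "\<one> \<in> W" using Wm[OF one, of 0] by simp
  have Wmult: "a \<otimes> b \<in> W" if W: "a \<in> W" "b \<in> W" for a b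
  proof -
    obtain s k t n where ab: "a = s \<otimes> x [^] (k::nat)" "b = t \<otimes> x [^] (n::nat)"
        "s \<in> carrier R - p" "t \<in> carrier R - p"
      using W unfolding W_def by blast
    have "a \<otimes> b = (s \<otimes> t) \<otimes> x [^] (k + n)"
      using ab x by (simp add: m_ac nat_pow_mult[symmetric])
    moreover have "s \<otimes> t \<in> carrier R - p" using ab primeideal_mult[OF p] by auto
    ultimately show ?thesis using Wm by auto
  qed
  have "W \<subseteq> carrier R" unfolding W_def using x by auto
  moreover have "J \<inter> W = {}" unfolding W_def using avoid by auto
  ultimately obtain Q where Q: "primeideal Q R" "J \<subseteq> Q" "Q \<inter> W = {}"
    using exists_prime_avoiding[OF J _ W1 Wmult] by blast
  have "Q \<subseteq> p"
  proof
    fix z assume z: "z \<in> Q"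
    have zc: "z \<in> carrier R" using z ideal_carrier[OF primeideal_ideal[OF Q(1)]] by auto
    show "z \<in> p"
    proof (rule ccontr)
      assume "z \<notin> p"
      then have "z \<in> W" using Wm[of z 0] zc by simp
      then show False using Q z by auto
    qed
  qed
  moreover have "x \<in> W" using Wm[OF one, of 1] x by simp
  ultimately show thesis using that Q by auto
qed

end

section \<open>Krull's height theorem\<close>

context noetherian_cring
begin

text \<open>If \<open>p\<close> is minimal over \<open>J0\<close>, the localization at
  \<open>p\<close> modulo \<open>J0\<close> is Noetherian with one prime, hence Artinian. Saturated
  ideals stand for its ideals, and the descending chain condition is obtained by Noetherian
  induction on the ideal lying below the chain.\<close>

lemma saturated_chain_stable:
  assumes p: "primeideal p R"
    and J0: "J0 \<subseteq> carrier R"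
    and minimal: "\<And>Q. primeideal Q R \<Longrightarrow> J0 \<subseteq> Q \<Longrightarrow> Q \<subseteq> p \<Longrightarrow> Q = p"
    and C: "\<And>n. ideal (C n) R" "\<And>n. contr p (C n) \<subseteq> C n" "\<And>n. J0 \<subseteq> C n" "\<And>n. C (Suc n) \<subseteq> C n"
  shows "\<exists>N. \<forall>n\<ge>N. C n = C N"
proof (rule ccontr)
  assume unstable: "\<not> ?thesis"
  define chain where "chain J C \<longleftrightarrow>
    (\<forall>n. ideal (C n) R \<and> contr p (C n) \<subseteq> C n \<and> J \<subseteq> C n \<and> C (Suc n) \<subseteq> C n)"
    for J and C :: "nat \<Rightarrow> 'a set"
  define stable where "stable C \<longleftrightarrow> (\<exists>N. \<forall>n\<ge>N. C n = C N)" for C :: "nat \<Rightarrow> 'a set"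
  \<comment> \<open>The saturated ideals that lie below some non-stabilizing chain. A maximal member
    \<open>M\<close> fails the chain condition, while every strictly larger saturated ideal
    satisfies it.\<close>
  define \<J> where "\<J> = {J. ideal J R \<and> contr p J \<subseteq> J \<and> J0 \<subseteq> J \<and> (\<exists>C. chain J C \<and> \<not> stable C)}"
  have IJ0: "ideal (Idl J0) R" using J0 by (rule genideal_ideal)
  have "contr p (Idl J0) \<in> \<J>"
  proof -
    have "Idl J0 \<subseteq> C n" for n using C(1,3) by (intro genideal_minimal) auto
    then have "contr p (Idl J0) \<subseteq> C n" for n using C(2) contr_mono by blast
    then have "chain (contr p (Idl J0)) C" unfolding chain_def using C by blast
    moreover have "J0 \<subseteq> contr p (Idl J0)"
      using subset_contr[OF p ideal_carrier[OF IJ0]] genideal_self[OF J0] by blast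
    ultimately show ?thesis
      unfolding \<J>_def stable_def using unstable contr_ideal[OF p IJ0] contr_idem[OF p IJ0] by blast
  qed
  then have "\<exists>M\<in>\<J>. \<forall>K\<in>\<J>. M \<subseteq> K \<longrightarrow> K = M"
    by (intro exists_maximal_ideal) (auto simp: \<J>_def)
  then obtain M where MJ: "M \<in> \<J>" and max: "\<forall>K\<in>\<J>. M \<subseteq> K \<longrightarrow> K = M" ..
  then obtain D where M: "ideal M R" "contr p M \<subseteq> M" "J0 \<subseteq> M" and D: "chain M D" "\<not> stable D"
    unfolding \<J>_def by auto
  have Di: "ideal (D n) R" and Ds: "contr p (D n) \<subseteq> D n" and MD: "M \<subseteq> D n" and Dd: "D (Suc n) \<subseteq> D n" for n
    using D(1) unfolding chain_def by auto
  have D_anti: "D n \<subseteq> D k" if "k \<le> n" for k n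
    using lift_Suc_antimono_le[of D, OF Dd that] .
  have Mne: "M \<noteq> carrier R"
  proof
    assume "M = carrier R"
    then have "D n = carrier R" for n using MD[of n] ideal_carrier[OF Di[of n]] by auto
    then show False using D(2) unfolding stable_def by auto
  qed
  have Mp: "M \<subseteq> p" using contr_saturated_subset M Mne by auto
  \<comment> \<open>A prime \<open>M\<close> would equal \<open>p\<close>, and then the only
    saturated ideals above it would be \<open>p\<close> and the whole ring.\<close>
  have "\<not> primeideal M R"
  proof
    assume "primeideal M R"
    then have Mp': "M = p" using minimal M Mp by auto
    show False
    proof (cases "\<exists>k. D k \<noteq> carrier R")
      case True
      then obtain k where k: "D k \<noteq> carrier R" by auto
      have "D n = p" if "n \<ge> k" for n
      proof -
        have "D n \<noteq> carrier R" using D_anti[OF that] k ideal_carrier[OF Di[of k]] by auto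
        then have "D n \<subseteq> p" using contr_saturated_subset Di Ds by auto
        then show ?thesis using MD Mp' by auto
      qed
      then show False using D(2) unfolding stable_def by (metis order_refl)
    next
      case False
      then show False using D(2) unfolding stable_def by auto
    qed
  qed
  then obtain u v where uv: "u \<in> carrier R" "v \<in> carrier R" "v \<otimes> u \<in> M" "u \<notin> M" "v \<notin> M"
    using Mne ideal.primeidealCD[OF M(1) is_cring] m_comm by metis
  \<comment> \<open>The chain \<open>D\<close> is tested by its colon ideals with \<open>u\<close>
    and by its sums with \<open>u\<close>. The first lie above the colon of \<open>M\<close>, which
    contains \<open>v\<close>, the second above an ideal containing \<open>u\<close>; both floors
    are strictly larger than \<open>M\<close>, so \<open>E\<close> and \<open>F\<close>
    stabilize.\<close>
  define E where "E n = {r \<in> carrier R. r \<otimes> u \<in> D n}" for n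
  define F where "F n = contr p (Idl (insert u (D n)))" for n
  have Fi: "ideal (Idl (insert u (D n))) R" for n
    using uv ideal_carrier[OF Di] by (intro genideal_ideal) auto
  have stable_bigger: "stable C" if "ideal J R" "contr p J \<subseteq> J" "M \<subseteq> J" "J \<noteq> M" "chain J C" for J C
  proof (rule ccontr)
    assume "\<not> stable C"
    then have "J \<in> \<J>" using that M unfolding \<J>_def by auto
    then show False using max that by auto
  qed
  have colon_sat: "contr p {r \<in> carrier R. r \<otimes> u \<in> J} \<subseteq> {r \<in> carrier R. r \<otimes> u \<in> J}"
    if "contr p J \<subseteq> J" for J
  proof
    fix a assume "a \<in> contr p {r \<in> carrier R. r \<otimes> u \<in> J}"
    then obtain s where s: "a \<in> carrier R" "s \<in> carrier R" "s \<notin> p" "s \<otimes> a \<otimes> u \<in> J" by (auto simp: contr_def)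
    then have "a \<otimes> u \<in> contr p J" using uv by (intro contrI[of _ s]) (auto simp: m_assoc)
    then show "a \<in> {r \<in> carrier R. r \<otimes> u \<in> J}" using that s by auto
  qed
  have "stable E"
  proof (rule stable_bigger)
    show "ideal {r \<in> carrier R. r \<otimes> u \<in> M} R" using colon_ideal M uv by auto
    show "contr p {r \<in> carrier R. r \<otimes> u \<in> M} \<subseteq> {r \<in> carrier R. r \<otimes> u \<in> M}" using colon_sat M by auto
    show "M \<subseteq> {r \<in> carrier R. r \<otimes> u \<in> M}"
      using ideal_carrier[OF M(1)] uv ideal.I_r_closed[OF M(1)] by auto
    show "{r \<in> carrier R. r \<otimes> u \<in> M} \<noteq> M" using uv by auto
    show "chain {r \<in> carrier R. r \<otimes> u \<in> M} E"
      unfolding chain_def E_def using colon_ideal[OF Di uv(1)] colon_sat[OF Ds] MD Dd by blast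
  qed
  moreover have "stable F"
  proof (rule stable_bigger)
    have Mu: "insert u M \<subseteq> carrier R" using uv ideal_carrier[OF M(1)] by auto
    have i: "ideal (Idl (insert u M)) R" using Mu by (rule genideal_ideal)
    show "ideal (contr p (Idl (insert u M))) R" using contr_ideal p i by auto
    show "contr p (contr p (Idl (insert u M))) \<subseteq> contr p (Idl (insert u M))" using contr_idem p i by auto
    have sub: "insert u M \<subseteq> contr p (Idl (insert u M))"
      using subset_contr[OF p ideal_carrier[OF i]] genideal_self[OF Mu] by auto
    then show "M \<subseteq> contr p (Idl (insert u M))" by auto
    show "contr p (Idl (insert u M)) \<noteq> M" using sub uv by auto
    have "contr p (Idl (insert u M)) \<subseteq> F n" for n
      unfolding F_def using MD[of n] uv ideal_carrier[OF Di[of n]]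
      by (intro contr_mono subset_Idl_subset) auto
    moreover have "F (Suc n) \<subseteq> F n" for n
      unfolding F_def using Dd[of n] uv ideal_carrier[OF Di[of n]]
      by (intro contr_mono subset_Idl_subset) auto
    ultimately show "chain (contr p (Idl (insert u M))) F"
      unfolding chain_def using contr_ideal[OF p Fi] contr_idem[OF p Fi] by (auto simp: F_def)
  qed
  ultimately obtain N1 N2 where N: "\<forall>n\<ge>N1. E n = E N1" "\<forall>n\<ge>N2. F n = F N2"
    unfolding stable_def by auto
  define N where "N = max N1 N2"
  \<comment> \<open>Comparable ideals with equal colon and equal sum coincide: locally
    \<open>z\<close> is \<open>w \<oplus> r \<otimes> u\<close> with \<open>w \<in> D n\<close>;
    then \<open>r \<otimes> u\<close> lies in \<open>D N\<close>, and equality of the colon ideals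
    moves it into \<open>D n\<close>.\<close>
  have "D N \<subseteq> D n" if n: "n \<ge> N" for n
  proof
    fix z assume z: "z \<in> D N"
    have EF: "E n = E N" "F n = F N" using N n unfolding N_def by (metis max.bounded_iff order_refl)+
    have zc: "z \<in> carrier R" using z ideal_carrier[OF Di] by auto
    have "insert u (D N) \<subseteq> F N"
      unfolding F_def using subset_contr[OF p ideal_carrier[OF Fi]] genideal_self[of "insert u (D N)"] 
        uv ideal_carrier[OF Di] by blast
    then have "z \<in> contr p (Idl (insert u (D n)))" using EF z unfolding F_def by auto
    then obtain s where s: "s \<in> carrier R" "s \<notin> p" "s \<otimes> z \<in> Idl (insert u (D n))" by (auto simp: contr_def)
    then obtain w r where wr: "w \<in> D n" "r \<in> carrier R" "s \<otimes> z = w \<oplus> r \<otimes> u"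
      using mem_Idl_insert[OF ideal_carrier[OF Di] uv(1)] Idl_ideal[OF Di] by auto
    have wc: "w \<in> carrier R" using wr ideal_carrier[OF Di] by auto
    have wN: "w \<in> D N" using wr D_anti[OF n] by auto
    have "r \<otimes> u = s \<otimes> z \<ominus> w"
      unfolding wr(3) using wr(2) wc uv(1) by algebra
    also have "\<dots> \<in> D N" by (rule ideal_minus_mem[OF Di ideal_lmult[OF Di s(1) z] wN])
    finally have "r \<in> E n" using wr EF unfolding E_def by auto
    then have "r \<otimes> u \<in> D n" unfolding E_def by auto
    then have "s \<otimes> z \<in> D n" unfolding wr(3) by (rule ideal_add_mem[OF Di wr(1)])
    then have "z \<in> contr p (D n)" using zc s by (intro contrI)
    then show "z \<in> D n" using Ds by auto
  qed
  then have "stable D" unfolding stable_def using D_anti by (intro exI[of _ N]) blast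
  then show False using D(2) by simp
qed

text \<open>If no such relation held, a prime between \<open>J\<close> and \<open>p\<close> would
  avoid \<open>y\<close>, contrary to minimality. Locally: the maximal ideal is nilpotent element by
  element modulo \<open>J\<close>.\<close>

lemma minimal_prime_radical:
  assumes p: "primeideal p R" and J: "ideal J R" and y: "y \<in> p"
    and minimal: "\<And>Q. primeideal Q R \<Longrightarrow> J \<subseteq> Q \<Longrightarrow> Q \<subseteq> p \<Longrightarrow> Q = p"
  shows "\<exists>s\<in>carrier R - p. \<exists>n::nat. s \<otimes> y [^] n \<in> J"
proof (rule ccontr)
  assume neg: "\<not> ?thesis"
  have yc: "y \<in> carrier R" using y ideal_carrier[OF primeideal_ideal[OF p]] by auto
  obtain Q where Q: "primeideal Q R" "J \<subseteq> Q" "Q \<subseteq> p" "y \<notin> Q"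
    by (rule exists_prime_avoiding_powers[OF p J yc]) (use neg in auto)
  have "Q = p" by (rule minimal[OF Q(1-3)])
  then show False using Q(4) y by simp
qed

text \<open>Krull's principal ideal theorem for the ring modulo \<open>q'\<close>, kept in
  \<open>R\<close> by adding \<open>q'\<close> everywhere. \<open>T n\<close> is the
  \<open>n\<close>-th symbolic power of \<open>q\<close> modulo \<open>q'\<close>. The chain of the
  \<open>T n\<close> with \<open>x\<close> adjoined stabilizes at \<open>p\<close>; two applications
  of Nakayama's lemma, at \<open>p\<close> and then at \<open>q\<close>, force a power of
  \<open>q\<close> into \<open>q'\<close>.\<close>

lemma principal_ideal_theorem:
  assumes p: "primeideal p R" and q: "primeideal q R" and q': "primeideal q' R"
    and "q' \<subset> q" "q \<subset> p" and x: "x \<in> p"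
    and minimal: "\<And>Q. primeideal Q R \<Longrightarrow> q' \<subseteq> Q \<Longrightarrow> x \<in> Q \<Longrightarrow> Q \<subseteq> p \<Longrightarrow> Q = p"
  shows False
proof -
  note ip = primeideal_ideal[OF p] and iq = primeideal_ideal[OF q] and iq' = primeideal_ideal[OF q']
  note cp = ideal_carrier[OF ip] and cq = ideal_carrier[OF iq] and cq' = ideal_carrier[OF iq']
  have xc: "x \<in> carrier R" using x cp by auto
  have xq: "x \<notin> q" using minimal[OF q] assms(4,5) by auto
  define G where "G n = Idl (ideal_power R q n \<union> q')" for n
  define T where "T n = contr q (G n)" for n
  define C where "C n = contr p (Idl (insert x (T n)))" for n
  note iP = ideal_power_ideal[OF iq]
  have Gi: "ideal (G n) R" for n
    unfolding G_def using ideal_carrier[OF iP] cq' by (intro genideal_ideal) auto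
  have Gsub: "ideal_power R q n \<union> q' \<subseteq> G n" for n
    unfolding G_def using ideal_carrier[OF iP] cq' by (intro genideal_self) auto
  have Ti: "ideal (T n) R" for n unfolding T_def using contr_ideal[OF q Gi] .
  have GT: "G n \<subseteq> T n" for n unfolding T_def by (rule subset_contr[OF q ideal_carrier[OF Gi]])
  have xT: "insert x (T n) \<subseteq> carrier R" for n using xc ideal_carrier[OF Ti] by auto
  have Ii: "ideal (Idl (insert x (T n))) R" for n using xT by (rule genideal_ideal)
  have Td: "T (Suc n) \<subseteq> T n" for n
    unfolding T_def G_def using ideal_power_antimono[OF iq, of n "Suc n"] ideal_carrier[OF iP] cq'
    by (intro contr_mono subset_Idl_subset) auto
  have "\<exists>N. \<forall>n\<ge>N. C n = C N"
  proof (rule saturated_chain_stable[OF p, of "insert x q'"])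
    show "insert x q' \<subseteq> carrier R" using xc cq' by auto
    show "Q = p" if "primeideal Q R" "insert x q' \<subseteq> Q" "Q \<subseteq> p" for Q using minimal that by auto
    show "ideal (C n) R" for n unfolding C_def by (rule contr_ideal[OF p Ii])
    show "contr p (C n) \<subseteq> C n" for n unfolding C_def by (rule contr_idem[OF p Ii])
    have "insert x q' \<subseteq> Idl (insert x (T n))" for n
      using genideal_self[OF xT] Gsub GT by blast
    then show "insert x q' \<subseteq> C n" for n
      unfolding C_def using subset_contr[OF p ideal_carrier[OF Ii]] by blast
    show "C (Suc n) \<subseteq> C n" for n
      unfolding C_def using Td xT by (intro contr_mono subset_Idl_subset) auto
  qed
  then obtain N where "\<forall>n\<ge>N. C n = C N" ..
  then have CN: "C (Suc N) = C N" by (meson le_SucI order_refl)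
  have iPx: "ideal (PIdl x) R" using xc by (rule cgenideal_ideal)
  \<comment> \<open>Stability gives \<open>s \<otimes> z = w \<oplus> r \<otimes> x\<close> with
    \<open>w \<in> T (Suc N)\<close>. The point is that \<open>r\<close> itself falls into
    \<open>T N\<close>, so that \<open>T N\<close> equals \<open>T (Suc N)\<close> up to
    \<open>x\<close> times \<open>T N\<close>.\<close>
  have "T N \<subseteq> contr p (T (Suc N))"
  proof (rule nakayama[OF p iPx _ Ti Ti])
    show "PIdl x \<subseteq> p" using ip x by (rule cgenideal_minimal)
    show "T N \<subseteq> contr p (Idl (T (Suc N) \<union> (PIdl x) \<cdot> T N))"
    proof
      fix z assume z: "z \<in> T N"
      have zc: "z \<in> carrier R" using z ideal_carrier[OF Ti] by auto
      have "z \<in> C N" unfolding C_def 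
        using subset_contr[OF p ideal_carrier[OF Ii]] genideal_self[OF xT] z by blast
      then have "z \<in> C (Suc N)" using CN by simp
      then obtain s where s: "s \<in> carrier R" "s \<notin> p" "s \<otimes> z \<in> Idl (insert x (T (Suc N)))"
        unfolding C_def by (auto simp: contr_def)
      then obtain w r where wr: "w \<in> T (Suc N)" "r \<in> carrier R" "s \<otimes> z = w \<oplus> r \<otimes> x"
        using mem_Idl_insert[OF ideal_carrier[OF Ti] xc] Idl_ideal[OF Ti] by auto
      have wc: "w \<in> carrier R" using wr ideal_carrier[OF Ti] by auto
      have wN: "w \<in> T N" using wr Td by auto
      have "x \<otimes> r = s \<otimes> z \<ominus> w"
        unfolding wr(3) using wr(2) wc xc by algebra
      also have "\<dots> \<in> T N" by (rule ideal_minus_mem[OF Ti ideal_lmult[OF Ti s(1) z] wN])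
      finally have "x \<otimes> r \<in> T N" .
      \<comment> \<open>\<open>T N\<close> is saturated at \<open>q\<close> and \<open>x\<close>
        lies outside \<open>q\<close>, so \<open>x\<close> can be divided out.\<close>
      then have "r \<in> contr q (T N)" using wr(2) xc xq by (intro contrI)
      then have rT: "r \<in> T N" unfolding T_def using contr_idem[OF q Gi] by auto
      have "x \<otimes> r \<in> (PIdl x) \<cdot> T N" using cgenideal_self[OF xc] rT by (rule ideal_prod.prod)
      then have "r \<otimes> x \<in> T (Suc N) \<union> (PIdl x) \<cdot> T N" using m_comm[OF xc wr(2)] by simp
      moreover have c: "T (Suc N) \<union> (PIdl x) \<cdot> T N \<subseteq> carrier R"
        using ideal_carrier[OF Ti] ideal_prod_in_carrier[OF iPx Ti] by auto
      ultimately have "s \<otimes> z \<in> Idl (T (Suc N) \<union> (PIdl x) \<cdot> T N)"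
        unfolding wr(3) using wr(1) genideal_self[OF c]
        by (intro ideal_add_mem[OF genideal_ideal[OF c]]) auto
      then show "z \<in> contr p (Idl (T (Suc N) \<union> (PIdl x) \<cdot> T N))" using zc s by (intro contrI)
    qed
  qed
  also have "\<dots> \<subseteq> contr q (T (Suc N))" using assms(5) by (intro contr_antimono) auto
  also have "\<dots> \<subseteq> contr q (G (Suc N))" unfolding T_def by (rule contr_idem[OF q Gi])
  finally have TG: "T N \<subseteq> contr q (G (Suc N))" .
  \<comment> \<open>The inclusion just obtained says that the \<open>N\<close>-th power of
    \<open>q\<close> lies, locally at \<open>q\<close>, in \<open>q'\<close> plus \<open>q\<close>
    times itself; Nakayama's lemma at \<open>q\<close> removes the second summand.\<close>
  have "ideal_power R q N \<subseteq> contr q q'"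
  proof (rule nakayama[OF q iq _ iP iq'])
    have "G (Suc N) = Idl (q' \<union> q \<cdot> ideal_power R q N)"
      unfolding G_def ideal_power_Suc[OF iq] by (simp add: Un_commute)
    then show "ideal_power R q N \<subseteq> contr q (Idl (q' \<union> q \<cdot> ideal_power R q N))"
      using TG GT[of N] Gsub[of N] by (auto simp del: Un_iff)
  qed auto
  also have "\<dots> \<subseteq> q'" using contr_prime_subset q q' assms(4) by auto
  finally have qN: "ideal_power R q N \<subseteq> q'" .
  have "q \<subseteq> q'"
  proof
    fix y assume y: "y \<in> q"
    have "y [^] N \<in> q'" using pow_mem_ideal_power[OF iq y, of N] qN by auto
    then show "y \<in> q'" using primeideal_pow[OF q'] y cq by blast
  qed
  then show False using assms(4) by auto
qed

text \<open>Induction on the length of the chain, with one generator spent at each step: below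
  \<open>p\<close> a prime \<open>q\<close> is found that is minimal over at most
  \<open>card B - 1\<close> elements and still carries a chain of length \<open>k\<close>.\<close>

theorem krull_height_theorem:
  assumes "primeideal p R" "finite B" "B \<subseteq> p"
    and "\<And>Q. primeideal Q R \<Longrightarrow> B \<subseteq> Q \<Longrightarrow> Q \<subseteq> p \<Longrightarrow> Q = p"
    and "prime_chain R n P" "P n = p"
  shows "n \<le> card B"
  using assms
proof (induction n arbitrary: p B P)
  case 0
  then show ?case by simp
next
  case (Suc k)
  note p = Suc.prems(1) and minimal = Suc.prems(4)
  have cp: "p \<subseteq> carrier R" using ideal_carrier[OF primeideal_ideal[OF p]] .
  have Pk: "primeideal (P k) R" "P k \<subset> p"
    using Suc.prems(5,6) unfolding prime_chain_def by auto
  \<comment> \<open>A maximal choice of \<open>q\<close> leaves no prime strictly between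
    \<open>q\<close> and \<open>p\<close>, so \<open>p\<close> is minimal over \<open>q\<close>
    together with any \<open>x\<close> of \<open>p\<close> outside \<open>q\<close>.\<close>
  define \<Q> where "\<Q> = {Q. primeideal Q R \<and> P k \<subseteq> Q \<and> Q \<subset> p}"
  have "\<exists>q\<in>\<Q>. \<forall>K\<in>\<Q>. q \<subseteq> K \<longrightarrow> K = q"
    using Pk by (intro exists_maximal_ideal) (auto simp: \<Q>_def primeideal_ideal)
  then obtain q where "q \<in> \<Q>" and max: "\<forall>K\<in>\<Q>. q \<subseteq> K \<longrightarrow> K = q" ..
  then have q: "primeideal q R" "P k \<subseteq> q" "q \<subset> p" unfolding \<Q>_def by auto
  note iq = primeideal_ideal[OF q(1)]
  note cq = ideal_carrier[OF iq]
  have "\<not> B \<subseteq> q" using minimal[OF q(1)] q(3) by auto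
  then obtain x where x: "x \<in> B" "x \<notin> q" by auto
  have xp: "x \<in> p" using x Suc.prems by auto
  then have xc: "x \<in> carrier R" using cp by auto
  have xq: "insert x q \<subseteq> carrier R" using xc cq by auto
  have ixq: "ideal (Idl (insert x q)) R" using xq by (rule genideal_ideal)
  have min_xq: "Q = p" if Q: "primeideal Q R" "Idl (insert x q) \<subseteq> Q" "Q \<subseteq> p" for Q
  proof (rule ccontr)
    assume "Q \<noteq> p"
    moreover have "insert x q \<subseteq> Q" using genideal_self[OF xq] Q by auto
    ultimately have "Q \<in> \<Q>" using Q q unfolding \<Q>_def by auto
    then show False using max \<open>insert x q \<subseteq> Q\<close> x by auto
  qed
  \<comment> \<open>Modulo \<open>q\<close> and \<open>x\<close> every element of \<open>p\<close>
    is locally nilpotent. The parts \<open>y'\<close> of these relations that lie in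
    \<open>q\<close> become the new generators.\<close>
  have "\<exists>y'\<in>q. \<exists>s\<in>carrier R - p. \<exists>t::nat. \<exists>r\<in>carrier R. s \<otimes> y [^] t = y' \<oplus> r \<otimes> x" if y: "y \<in> B - {x}" for y
  proof -
    have "y \<in> p" using y Suc.prems by auto
    then obtain s and t :: nat where s: "s \<in> carrier R - p" "s \<otimes> y [^] t \<in> Idl (insert x q)"
      using minimal_prime_radical[OF p ixq _ min_xq] by blast
    then show ?thesis
      using mem_Idl_insert[OF cq xc] Idl_ideal[OF iq] by metis
  qed
  then have "\<exists>f. \<forall>y\<in>B - {x}. f y \<in> q \<and> (\<exists>s\<in>carrier R - p. \<exists>t::nat. \<exists>r\<in>carrier R. s \<otimes> y [^] t = f y \<oplus> r \<otimes> x)"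
    by (intro bchoice) blast
  then obtain f where f: "\<And>y. y \<in> B - {x} \<Longrightarrow> f y \<in> q"
    "\<And>y. y \<in> B - {x} \<Longrightarrow> \<exists>s\<in>carrier R - p. \<exists>t::nat. \<exists>r\<in>carrier R. s \<otimes> y [^] t = f y \<oplus> r \<otimes> x"
    by blast
  have "k \<le> card (f ` (B - {x}))"
  proof (rule Suc.IH[OF q(1)])
    show "finite (f ` (B - {x}))" using Suc.prems by auto
    show "f ` (B - {x}) \<subseteq> q" using f by auto
    \<comment> \<open>\<open>P k\<close> is only contained in \<open>q\<close>; raising the top of
      the chain to \<open>q\<close> keeps its length.\<close>
    show "prime_chain R k (P(k := q))"
      unfolding prime_chain_def
    proof (intro conjI allI impI)
      fix i assume "i \<le> k"
      then show "primeideal ((P(k := q)) i) R" using Suc.prems(5) q(1) unfolding prime_chain_def by auto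
    next
      fix i assume i: "i < k"
      then have "P i \<subset> P (Suc i)" using Suc.prems(5) unfolding prime_chain_def by auto
      then show "(P(k := q)) i \<subset> (P(k := q)) (Suc i)" using i q(2) by auto
    qed
    show "(P(k := q)) k = q" by simp
    fix Q assume Q: "primeideal Q R" "f ` (B - {x}) \<subseteq> Q" "Q \<subseteq> q"
    show "Q = q"
    proof (rule ccontr)
      assume "Q \<noteq> q"
      then have "Q \<subset> q" using Q by auto
      then show False
      proof (rule principal_ideal_theorem[OF p q(1) Q(1) _ q(3) xp])
        \<comment> \<open>\<open>K\<close> need not contain \<open>q\<close>, so minimality over
          \<open>q\<close> and \<open>x\<close> is of no use here. It contains \<open>x\<close> and
          every \<open>f y\<close>, hence a power of every \<open>y\<close> up to a factor outside
          \<open>p\<close>, hence all of \<open>B\<close>.\<close>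
        fix K assume K: "primeideal K R" "Q \<subseteq> K" "x \<in> K" "K \<subseteq> p"
        note iK = primeideal_ideal[OF K(1)]
        have "B \<subseteq> K"
        proof
          fix y assume y: "y \<in> B"
          show "y \<in> K"
          proof (cases "y = x")
            case False
            then obtain s and t :: nat and r where s: "s \<in> carrier R - p" "r \<in> carrier R" "s \<otimes> y [^] t = f y \<oplus> r \<otimes> x"
              using f(2)[of y] y by auto
            have yc: "y \<in> carrier R" using y Suc.prems(3) cp by auto
            have "f y \<in> K" using Q(2) K(2) y False by auto
            then have "s \<otimes> y [^] t \<in> K"
              unfolding s(3) by (rule ideal_add_mem[OF iK _ ideal_lmult[OF iK s(2) K(3)]])
            moreover have "s \<notin> K" using s K by auto
            ultimately show ?thesis
              using primeideal_mult[OF K(1), of s "y [^] t"] primeideal_pow[OF K(1) yc] s yc by blast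
          qed (use K in simp)
        qed
        then show "K = p" using minimal K by auto
      qed
    qed
  qed
  also have "\<dots> \<le> card (B - {x})" using Suc.prems by (intro card_image_le) auto
  also have "\<dots> < card B" using x Suc.prems by (intro card_Diff1_less) auto
  finally show ?case by simp
qed

end

section \<open>Regular sequences in a localization\<close>

context cring
begin

text \<open>The list is in reverse order: the head of the list is the last element of the sequence.\<close>

primrec local_regular :: "'a set \<Rightarrow> 'a list \<Rightarrow> bool" where
  "local_regular p [] \<longleftrightarrow> True"
| "local_regular p (x # xs) \<longleftrightarrow> local_regular p xs \<and>
     (\<forall>a\<in>carrier R. x \<otimes> a \<in> contr p (Idl (set xs)) \<longrightarrow> a \<in> contr p (Idl (set xs)))"

lemma contr_cancel:
  assumes "primeideal p R" "ideal J R" "s \<in> carrier R" "s \<notin> p" "a \<in> carrier R" "s \<otimes> a \<in> contr p J"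
  shows "a \<in> contr p J"
  using contr_idem[OF assms(1,2)] contrI[OF assms(5,3,4,6)] by auto

text \<open>\<open>form_value xs k U z\<close>: the set \<open>U\<close> consists of the coefficients of a form of degree \<open>k\<close> in the
  variables \<open>xs\<close> whose value is \<open>z\<close>.  A form in \<open>x # xs\<close> is \<open>x G + F\<close> where \<open>x\<close> does not occur in \<open>F\<close>.\<close>

inductive form_value :: "'a list \<Rightarrow> nat \<Rightarrow> 'a set \<Rightarrow> 'a \<Rightarrow> bool" where
  const: "u \<in> carrier R \<Longrightarrow> form_value xs 0 {u} u"
| nil: "form_value [] (Suc k) {} \<zero>"
| cons: "form_value (x # xs) k U g \<Longrightarrow> form_value xs (Suc k) V f \<Longrightarrow>
     form_value (x # xs) (Suc k) (U \<union> V) (x \<otimes> g \<oplus> f)"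

lemma form_value_carrier:
  "form_value xs k U z \<Longrightarrow> set xs \<subseteq> carrier R \<Longrightarrow> finite U \<and> U \<subseteq> carrier R \<and> z \<in> carrier R"
  by (induction rule: form_value.induct) auto

lemma form_value_exists:
  assumes "set xs \<subseteq> carrier R" "z \<in> ideal_power R (Idl (set xs)) k"
  shows "\<exists>U. form_value xs k U z"
  using assms
proof (induction xs arbitrary: k z)
  case Nil
  show ?case
  proof (cases k)
    case 0
    then show ?thesis using Nil form_value.const by (auto simp: ideal_power_0)
  next
    case (Suc n)
    have "z \<in> Idl {}"
      using Nil ideal_power_antimono[of "Idl {}" "Suc 0" k] Suc genideal_ideal[of "{}"]
      by (auto simp: ideal_power_1)
    then show ?thesis using Suc form_value.nil Idl_empty by auto
  qed
next
  case (Cons x xs)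
  have c: "set xs \<subseteq> carrier R" "x \<in> carrier R" using Cons.prems by auto
  show ?case
    using Cons.prems(2)
  proof (induction k arbitrary: z)
    case 0
    then show ?case using form_value.const by (auto simp: ideal_power_0)
  next
    case (Suc k)
    then obtain g f where gf: "g \<in> ideal_power R (Idl (insert x (set xs))) k"
      "f \<in> ideal_power R (Idl (set xs)) (Suc k)" "z = x \<otimes> g \<oplus> f"
      using ideal_power_insert_Suc[OF c, of z k] by auto
    obtain U V where "form_value (x # xs) k U g" "form_value xs (Suc k) V f"
      using Suc.IH[of g] Cons.IH[OF c(1) gf(2)] gf(1) by auto
    then show ?case using form_value.cons gf(3) by blast
  qed
qed

lemma form_value_mem:
  assumes "form_value xs k U z" "ideal J R" "set xs \<subseteq> J"
  shows "z \<in> ideal_power R J k"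
  using assms(1,3)
proof (induction rule: form_value.induct)
  case (nil k)
  then show ?case using ideal_zero_mem[OF ideal_power_ideal[OF assms(2)]] by auto
next
  case (cons x xs k U g V f)
  then show ?case
    by (auto intro!: ideal_add_mem[OF ideal_power_ideal[OF assms(2)]] ideal_power_mult_mem[OF assms(2)])
qed (simp add: ideal_power_0)

text \<open>Coefficients that fall into \<open>J\<close> raise the order of the value by one. This
  is what increases the exponent in the proof of the converse inclusion.\<close>

lemma form_value_coeff_mem:
  assumes "form_value xs k U z" "ideal J R" "set xs \<subseteq> J" "d \<in> carrier R" "\<And>u. u \<in> U \<Longrightarrow> d \<otimes> u \<in> J"
  shows "d \<otimes> z \<in> ideal_power R J (Suc k)"
  using assms(1,3,5)
proof (induction rule: form_value.induct)
  case (const u xs)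
  then show ?case using ideal_power_1 assms by auto
next
  case (nil k)
  then show ?case using assms ideal_zero_mem[OF ideal_power_ideal[OF assms(2)]] by auto
next
  case (cons x xs k U g V f)
  have c: "set (x # xs) \<subseteq> carrier R" using cons.prems ideal_carrier[OF assms(2)] by blast
  have gf: "g \<in> carrier R" "f \<in> carrier R" "x \<in> carrier R"
    using form_value_carrier[OF cons.hyps(1) c] form_value_carrier[OF cons.hyps(2)] c by auto
  have "d \<otimes> (x \<otimes> g \<oplus> f) = x \<otimes> (d \<otimes> g) \<oplus> d \<otimes> f" using gf assms(4) by algebra
  moreover have "x \<otimes> (d \<otimes> g) \<in> ideal_power R J (Suc (Suc k))"
    by (rule ideal_power_mult_mem[OF assms(2)]) (use cons in auto)
  moreover have "d \<otimes> f \<in> ideal_power R J (Suc (Suc k))" using cons by auto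
  ultimately show ?case using ideal_add_mem[OF ideal_power_ideal[OF assms(2)]] by metis
qed

text \<open>Forms of equal degree are combined coefficient by coefficient. A coefficient set does
  not record monomials, so the partner \<open>b\<close> of \<open>v\<close> stays unspecified; in
  the applications \<open>x \<otimes> b\<close> is absorbed, because \<open>x\<close> is zero or
  lies in the ideal under consideration.\<close>

lemma form_value_comb:
  assumes "form_value xs k V f" "form_value xs k B h" "set xs \<subseteq> carrier R" "t \<in> carrier R" "x \<in> carrier R"
  shows "\<exists>U. form_value xs k U (t \<otimes> f \<oplus> x \<otimes> h) \<and> (\<forall>v\<in>V. \<exists>b\<in>carrier R. t \<otimes> v \<oplus> x \<otimes> b \<in> U)"
  using assms(1-3)
proof (induction arbitrary: B h rule: form_value.induct)
  case (const u xs)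
  from const.prems have h: "h \<in> carrier R" by cases auto
  have "form_value xs 0 {t \<otimes> u \<oplus> x \<otimes> h} (t \<otimes> u \<oplus> x \<otimes> h)"
    using const.hyps h assms by (intro form_value.const) auto
  then show ?case using h by blast
next
  case (nil k)
  from nil.prems have "h = \<zero>" by cases auto
  then show ?case using form_value.nil assms by auto
next
  case (cons y ys k U g V f)
  from cons.prems(1) obtain B1 h1 B2 h2 where h: "form_value (y # ys) k B1 h1" "form_value ys (Suc k) B2 h2"
    "h = y \<otimes> h1 \<oplus> h2" by cases auto
  have c: "set (y # ys) \<subseteq> carrier R" "set ys \<subseteq> carrier R" "y \<in> carrier R" using cons.prems by auto
  have gf: "g \<in> carrier R" "f \<in> carrier R" "h1 \<in> carrier R" "h2 \<in> carrier R"
    using form_value_carrier[OF cons.hyps(1) c(1)] form_value_carrier[OF cons.hyps(2) c(2)]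
      form_value_carrier[OF h(1) c(1)] form_value_carrier[OF h(2) c(2)] by auto
  obtain U1 where U1: "form_value (y # ys) k U1 (t \<otimes> g \<oplus> x \<otimes> h1)" "\<forall>v\<in>U. \<exists>b\<in>carrier R. t \<otimes> v \<oplus> x \<otimes> b \<in> U1"
    using cons.IH(1)[OF h(1) c(1)] by blast
  obtain V1 where V1: "form_value ys (Suc k) V1 (t \<otimes> f \<oplus> x \<otimes> h2)" "\<forall>v\<in>V. \<exists>b\<in>carrier R. t \<otimes> v \<oplus> x \<otimes> b \<in> V1"
    using cons.IH(2)[OF h(2) c(2)] by blast
  have "t \<otimes> (y \<otimes> g \<oplus> f) \<oplus> x \<otimes> h = y \<otimes> (t \<otimes> g \<oplus> x \<otimes> h1) \<oplus> (t \<otimes> f \<oplus> x \<otimes> h2)"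
    unfolding h(3) using gf c(3) assms(4,5) by algebra
  then have "form_value (y # ys) (Suc k) (U1 \<union> V1) (t \<otimes> (y \<otimes> g \<oplus> f) \<oplus> x \<otimes> h)"
    using form_value.cons[OF U1(1) V1(1)] by simp
  then show ?case using U1(2) V1(2) by blast
qed

text \<open>Under quasi-regularity the associated graded ring is a polynomial ring over the residue
  ring, so a nonzerodivisor modulo the ideal stays one modulo its powers. Concretely,
  \<open>z\<close> climbs from the \<open>i\<close>-th to the next power: it is a form of degree
  \<open>i\<close>, the coefficients of \<open>x\<close> times this form lie in the ideal, and
  \<open>x\<close> can be cancelled from them.\<close>

lemma nonzerodivisor_mod_power:
  assumes p: "primeideal p R" and xs: "set xs \<subseteq> carrier R" and x: "x \<in> carrier R"
    and qr: "\<And>k U z. form_value xs k U z \<Longrightarrow> z \<in> contr p (ideal_power R (Idl (set xs)) (Suc k)) \<Longrightarrow>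
        U \<subseteq> contr p (Idl (set xs))"
    and nzd: "\<And>a. a \<in> carrier R \<Longrightarrow> x \<otimes> a \<in> contr p (Idl (set xs)) \<Longrightarrow> a \<in> contr p (Idl (set xs))"
    and z: "z \<in> carrier R" "x \<otimes> z \<in> contr p (ideal_power R (Idl (set xs)) j)"
  shows "z \<in> contr p (ideal_power R (Idl (set xs)) j)"
proof -
  define K where "K = Idl (set xs)"
  have K: "ideal K R" unfolding K_def using xs by (rule genideal_ideal)
  have xK: "set xs \<subseteq> K" unfolding K_def using xs by (rule genideal_self)
  note iP = ideal_power_ideal[OF K]
  have "z \<in> contr p (ideal_power R K i)" if "i \<le> j" for i
    using that
  proof (induction i)
    case 0
    then show ?case using z subset_contr[OF p] by (auto simp: ideal_power_0)
  next
    case (Suc i)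
    then obtain s where s: "s \<in> carrier R" "s \<notin> p" "s \<otimes> z \<in> ideal_power R K i" by (auto simp: contr_def)
    then obtain U where U: "form_value xs i U (s \<otimes> z)"
      using form_value_exists[OF xs] unfolding K_def by auto
    \<comment> \<open>With second factor \<open>\<zero>\<close> the combination merely multiplies
      every coefficient by \<open>x\<close>.\<close>
    obtain U' where U': "form_value xs i U' (x \<otimes> (s \<otimes> z) \<oplus> \<zero> \<otimes> (s \<otimes> z))" "\<forall>v\<in>U. \<exists>b\<in>carrier R. x \<otimes> v \<oplus> \<zero> \<otimes> b \<in> U'"
      using form_value_comb[OF U U xs x zero_closed] by blast
    have Uc: "finite U" "U \<subseteq> carrier R" using form_value_carrier[OF U xs] by auto
    have "x \<otimes> z \<in> contr p (ideal_power R K (Suc i))"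
      using z(2) contr_mono[OF ideal_power_antimono[OF K Suc.prems]] unfolding K_def by auto
    then have "s \<otimes> (x \<otimes> z) \<in> contr p (ideal_power R K (Suc i))"
      by (rule ideal_lmult[OF contr_ideal[OF p iP] s(1)])
    moreover have "x \<otimes> (s \<otimes> z) \<oplus> \<zero> \<otimes> (s \<otimes> z) = s \<otimes> (x \<otimes> z)"
      using s x z by (simp add: m_lcomm)
    ultimately have U'K: "U' \<subseteq> contr p K" using qr[OF U'(1)] unfolding K_def by simp
    have "U \<subseteq> contr p K"
    proof
      fix u assume u: "u \<in> U"
      then obtain b where "b \<in> carrier R" "x \<otimes> u \<oplus> \<zero> \<otimes> b \<in> U'" using U'(2) by auto
      moreover have "u \<in> carrier R" using u Uc by auto
      ultimately have "x \<otimes> u \<in> contr p K" using U'K x by auto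
      then show "u \<in> contr p K" using nzd u Uc unfolding K_def by auto
    qed
    then obtain d where d: "d \<in> carrier R - p" "\<forall>u\<in>U. d \<otimes> u \<in> K"
      using contr_finite_common[OF p K Uc(1)] by auto
    then have "d \<otimes> (s \<otimes> z) \<in> ideal_power R K (Suc i)"
      using form_value_coeff_mem[OF U K xK] by auto
    then have "s \<otimes> z \<in> contr p (ideal_power R K (Suc i))"
      using d s z by (intro contrI[of _ d]) auto
    then show ?case using contr_cancel[OF p iP s(1,2) z(1)] by auto
  qed
  then show ?thesis unfolding K_def by auto
qed

text \<open>Induction on the sequence and, inside, on the degree. The part of the form divisible by
  \<open>x\<close> is handled by the lower degree, the part free of \<open>x\<close> by the shorter
  sequence, once both are separated by cancelling \<open>x\<close> modulo powers of the smaller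
  ideal \<open>K\<close>.\<close>

theorem local_regular_quasi_regular:
  assumes p: "primeideal p R" 
  shows "local_regular p xs \<Longrightarrow> set xs \<subseteq> carrier R \<Longrightarrow> form_value xs k U z \<Longrightarrow>
    z \<in> contr p (ideal_power R (Idl (set xs)) (Suc k)) \<Longrightarrow> U \<subseteq> contr p (Idl (set xs))"
proof (induction xs arbitrary: k U z)
  case Nil
  have i: "ideal (Idl {}) R" by (rule genideal_ideal) simp
  from Nil(3) show ?case
  proof cases
    case (const)
    then show ?thesis using Nil(4) ideal_power_1[OF i] by simp
  qed auto
next
  case (Cons x xs)
  define K where "K = Idl (set xs)"
  define I where "I = Idl (set (x # xs))"
  have c: "set xs \<subseteq> carrier R" "x \<in> carrier R" using Cons.prems by auto
  have K: "ideal K R" unfolding K_def using c by (intro genideal_ideal)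
  have I: "ideal I R" unfolding I_def using Cons.prems(2) by (intro genideal_ideal)
  have xK: "set xs \<subseteq> K" unfolding K_def using c by (intro genideal_self)
  have xI: "set (x # xs) \<subseteq> I" unfolding I_def using Cons.prems(2) by (intro genideal_self)
  have KI: "K \<subseteq> I" unfolding K_def I_def using Cons.prems(2) by (intro subset_Idl_subset) auto
  note PK = ideal_power_ideal[OF K] and PI = ideal_power_ideal[OF I]
  note PKI = ideal_power_mono[OF KI]
  have reg: "local_regular p xs" using Cons.prems(1) by simp
  have nzd: "a \<in> contr p (ideal_power R K j)" if "a \<in> carrier R" "x \<otimes> a \<in> contr p (ideal_power R K j)" for a j
    using nonzerodivisor_mod_power[OF p c Cons.IH[OF reg c(1)]] Cons.prems(1) that unfolding K_def by auto
  show ?case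
    using Cons.prems(3,4)
  proof (induction k arbitrary: U z)
    case 0
    from 0(1) have U: "U = {z}" by cases auto
    have "ideal_power R I (Suc 0) = I" by (rule ideal_power_1[OF I])
    then show ?case using 0(2) U unfolding I_def by auto
  next
    case (Suc k)
    from Suc.prems(1) obtain U1 g V f where gf: "form_value (x # xs) k U1 g" "form_value xs (Suc k) V f"
      "z = x \<otimes> g \<oplus> f" "U = U1 \<union> V" by cases auto
    have U1: "finite U1" "U1 \<subseteq> carrier R" "g \<in> carrier R" 
      using form_value_carrier[OF gf(1)] c by auto
    have V: "finite V" "V \<subseteq> carrier R" "f \<in> carrier R" 
      using form_value_carrier[OF gf(2)] c by auto
    have fK: "f \<in> ideal_power R K (Suc k)" using form_value_mem[OF gf(2) K xK] .
    obtain s where s: "s \<in> carrier R" "s \<notin> p" "s \<otimes> z \<in> ideal_power R I (Suc (Suc k))"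
      using Suc.prems(2) unfolding I_def by (auto simp: contr_def)
    then obtain b d where bd: "b \<in> ideal_power R I (Suc k)" "d \<in> ideal_power R K (Suc (Suc k))" "s \<otimes> z = x \<otimes> b \<oplus> d"
      using ideal_power_insert_Suc[OF c, of "s \<otimes> z" "Suc k"] unfolding I_def K_def by auto
    have bdc: "b \<in> carrier R" "d \<in> carrier R"
      using bd ideal_carrier[OF PI] ideal_carrier[OF PK] by auto
    \<comment> \<open>The element \<open>z\<close> has two decompositions: as a form, and, after
      multiplication by \<open>s\<close>, as a member of a higher power of \<open>I\<close>.
      Comparing them, \<open>x \<otimes> h\<close> has order \<open>k + 1\<close> in
      \<open>K\<close>, hence so has \<open>h\<close>, and \<open>g\<close> is locally of order
      \<open>k + 1\<close> in \<open>I\<close>.\<close>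
    define h where "h = s \<otimes> g \<ominus> b"
    have hc: "h \<in> carrier R" unfolding h_def using s U1 bdc by simp
    have "x \<otimes> h = s \<otimes> z \<ominus> x \<otimes> b \<ominus> s \<otimes> f"
      unfolding h_def gf(3) using s(1) U1(3) V(3) bdc c(2) by algebra
    also have "\<dots> = d \<ominus> s \<otimes> f"
      unfolding bd(3) using s(1) V(3) bdc c(2) by algebra
    finally have xh: "x \<otimes> h = d \<ominus> s \<otimes> f" .
    have dK: "d \<in> ideal_power R K (Suc k)" using bd(2) ideal_power_antimono[OF K, of "Suc k" "Suc (Suc k)"] by auto
    have "x \<otimes> h \<in> ideal_power R K (Suc k)"
      unfolding xh by (intro ideal_minus_mem[OF PK] ideal_lmult[OF PK] dK fK s(1))
    then have hK: "h \<in> contr p (ideal_power R K (Suc k))"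
      using nzd[OF hc] subset_contr[OF p ideal_carrier[OF PK]] by blast
    have "h \<in> contr p (ideal_power R I (Suc k))" using hK contr_mono[OF PKI] by blast
    moreover have "b \<in> contr p (ideal_power R I (Suc k))"
      using bd(1) subset_contr[OF p ideal_carrier[OF PI]] by blast
    ultimately have "h \<oplus> b \<in> contr p (ideal_power R I (Suc k))"
      by (rule ideal_add_mem[OF contr_ideal[OF p PI]])
    moreover have "h \<oplus> b = s \<otimes> g" unfolding h_def using s(1) U1(3) bdc by algebra
    ultimately have "g \<in> contr p (ideal_power R I (Suc k))"
      using contr_cancel[OF p PI s(1,2) U1(3)] by simp
    then have U1I: "U1 \<subseteq> contr p I" using Suc.IH[OF gf(1)] unfolding I_def by simp
    obtain t where t: "t \<in> carrier R" "t \<notin> p" "t \<otimes> h \<in> ideal_power R K (Suc k)"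
      using hK by (auto simp: contr_def)
    obtain B where B: "form_value xs (Suc k) B (t \<otimes> h)"
      using form_value_exists[OF c(1)] t(3) unfolding K_def by blast
    have ts: "t \<otimes> s \<in> carrier R" "t \<otimes> s \<notin> p" using t s primeideal_mult[OF p] by auto
    \<comment> \<open>The form for \<open>f\<close> is corrected by \<open>x\<close> times a form
      for \<open>t \<otimes> h\<close>. The corrected value is \<open>t \<otimes> d\<close>, of
      order \<open>k + 2\<close> in \<open>K\<close>, so the induction hypothesis for
      \<open>xs\<close> puts its coefficients into \<open>K\<close> locally; the correction of each
      coefficient is a multiple of \<open>x\<close> and thus lies in \<open>I\<close>.\<close>
    obtain V' where V': "form_value xs (Suc k) V' ((t \<otimes> s) \<otimes> f \<oplus> x \<otimes> (t \<otimes> h))"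
        "\<forall>v\<in>V. \<exists>b\<in>carrier R. (t \<otimes> s) \<otimes> v \<oplus> x \<otimes> b \<in> V'"
      using form_value_comb[OF gf(2) B c(1) ts(1) c(2)] by blast
    have "(t \<otimes> s) \<otimes> f \<oplus> x \<otimes> (t \<otimes> h) = (t \<otimes> s) \<otimes> f \<oplus> t \<otimes> (x \<otimes> h)"
      using t hc c(2) by (simp add: m_lcomm)
    also have "\<dots> = t \<otimes> d"
      unfolding xh using t(1) s(1) V(3) bdc by algebra
    finally have e: "(t \<otimes> s) \<otimes> f \<oplus> x \<otimes> (t \<otimes> h) = t \<otimes> d" .
    have "t \<otimes> d \<in> contr p (ideal_power R K (Suc (Suc k)))"
      using ideal_lmult[OF PK t(1) bd(2)] subset_contr[OF p ideal_carrier[OF PK]] by blast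
    then have V'K: "V' \<subseteq> contr p K"
      using Cons.IH[OF reg c(1) V'(1)] unfolding e K_def by blast
    have "V \<subseteq> contr p I"
    proof
      fix v assume v: "v \<in> V"
      then obtain b where b: "b \<in> carrier R" "(t \<otimes> s) \<otimes> v \<oplus> x \<otimes> b \<in> V'" using V'(2) by auto
      have cI: "ideal (contr p I) R" by (rule contr_ideal[OF p I])
      have "x \<in> contr p I" using xI subset_contr[OF p ideal_carrier[OF I]] by auto
      then have "b \<otimes> x \<in> contr p I" using b by (intro ideal_lmult[OF cI])
      moreover have "(t \<otimes> s) \<otimes> v \<oplus> x \<otimes> b \<in> contr p I" using b V'K contr_mono[OF KI] by blast
      ultimately have "(t \<otimes> s) \<otimes> v \<oplus> x \<otimes> b \<ominus> b \<otimes> x \<in> contr p I" by (intro ideal_minus_mem[OF cI])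
      moreover have "(t \<otimes> s) \<otimes> v \<oplus> x \<otimes> b \<ominus> b \<otimes> x = (t \<otimes> s) \<otimes> v"
      proof -
        have "v \<in> carrier R" using v V by auto
        then show ?thesis using ts(1) b(1) c(2) by algebra
      qed
      ultimately show "v \<in> contr p I" using contr_cancel[OF p I ts] v V by auto
    qed
    then show ?case using U1I gf(4) unfolding I_def by auto
  qed
qed

end

section \<open>Length, permutation and exchange of regular sequences\<close>

context noetherian_cring
begin

text \<open>Since \<open>x\<close> is a nonzerodivisor modulo \<open>J\<close> locally at
  \<open>p\<close>, no product of an element outside \<open>q\<close> with a power of
  \<open>x\<close> lies in \<open>J\<close>. So some prime between \<open>J\<close> and
  \<open>q\<close> misses \<open>x\<close>, and placing \<open>q\<close> on top of a chain for that
  prime gains one step.\<close>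

lemma local_regular_prime_chain:
  assumes p: "primeideal p R"
  shows "local_regular p xs \<Longrightarrow> primeideal q R \<Longrightarrow> q \<subseteq> p \<Longrightarrow> set xs \<subseteq> q \<Longrightarrow>
    \<exists>P. prime_chain R (length xs) P \<and> P (length xs) = q"
proof (induction xs arbitrary: q)
  case Nil
  then show ?case by (intro exI[of _ "\<lambda>_. q"]) (auto simp: prime_chain_def)
next
  case (Cons x xs)
  note iq = primeideal_ideal[OF Cons.prems(2)]
  note cq = ideal_carrier[OF iq]
  have c: "set xs \<subseteq> carrier R" "x \<in> carrier R" using Cons.prems(4) cq by auto
  define J where "J = Idl (set xs)"
  have J: "ideal J R" unfolding J_def using c by (intro genideal_ideal)
  have Jq: "J \<subseteq> q" unfolding J_def using Cons.prems(4) by (intro genideal_minimal[OF iq]) auto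
  have nzd: "a \<in> contr p J" if "a \<in> carrier R" "x \<otimes> a \<in> contr p J" for a
    using Cons.prems(1) that unfolding J_def by auto
  have cancel: "s \<in> contr p J" if "s \<in> carrier R" "s \<otimes> x [^] n \<in> contr p J" for s and n :: nat
    using that
  proof (induction n)
    case (Suc n)
    have "s \<otimes> x [^] Suc n = x \<otimes> (s \<otimes> x [^] n)" using Suc.prems c by (simp add: m_ac)
    then show ?case using nzd[of "s \<otimes> x [^] n"] Suc c by auto
  qed simp
  have "s \<otimes> x [^] n \<notin> J" if s: "s \<in> carrier R" "s \<notin> q" for s and n :: nat
  proof
    assume "s \<otimes> x [^] n \<in> J"
    then have "s \<in> contr p J" using cancel[of s n] s(1) subset_contr[OF p ideal_carrier[OF J]] by auto
    then obtain t where "t \<in> carrier R" "t \<notin> p" "t \<otimes> s \<in> J" by (auto simp: contr_def)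
    then show False using Jq s primeideal_mult[OF Cons.prems(2), of t s] Cons.prems(3) by auto
  qed
  then obtain Q where Q: "primeideal Q R" "J \<subseteq> Q" and Qq: "Q \<subseteq> q" and "x \<notin> Q"
    using exists_prime_avoiding_powers[OF Cons.prems(2) J c(2)] by metis
  then have strict: "Q \<subset> q" using Qq Cons.prems(4) by auto
  have "set xs \<subseteq> Q" using Q(2) genideal_self[OF c(1)] unfolding J_def by auto
  then obtain P where P: "prime_chain R (length xs) P" "P (length xs) = Q"
    using Cons.IH[OF _ Q(1)] Cons.prems(1,3) Qq by auto
  have "prime_chain R (length (x # xs)) (P(Suc (length xs) := q))"
    using P Cons.prems(2) strict unfolding prime_chain_def by (auto simp: le_Suc_eq less_Suc_eq)
  moreover have "(P(Suc (length xs) := q)) (length (x # xs)) = q" by simp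
  ultimately show ?case by blast
qed

text \<open>The exchange of neighbours, valid in a local ring. One of the two new conditions,
  regularity of \<open>x\<close> modulo \<open>L\<close>, needs Nakayama's lemma; the other is a
  formal computation.\<close>

lemma local_regular_swap:
  assumes p: "primeideal p R" and sub: "set (x # y # xs) \<subseteq> p" and reg: "local_regular p (x # y # xs)"
  shows "local_regular p (y # x # xs)"
proof -
  note cp = ideal_carrier[OF primeideal_ideal[OF p]]
  have c: "set xs \<subseteq> carrier R" "x \<in> carrier R" "y \<in> carrier R" using sub cp by auto
  define L where "L = Idl (set xs)"
  define Lx where "Lx = Idl (insert x (set xs))"
  define Ly where "Ly = Idl (insert y (set xs))"
  have L: "ideal L R" and Lx: "ideal Lx R" and Ly: "ideal Ly R"
    unfolding L_def Lx_def Ly_def using c by (auto intro!: genideal_ideal)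
  have LLy: "L \<subseteq> Ly" and LLx: "L \<subseteq> Lx" unfolding L_def Ly_def Lx_def
    using c subset_Idl_subset[of "insert y (set xs)" "set xs"] subset_Idl_subset[of "insert x (set xs)" "set xs"] by auto
  have xLx: "x \<in> Lx" unfolding Lx_def using genideal_self[of "insert x (set xs)"] c by auto
  note cL = contr_ideal[OF p L] and cLx = contr_ideal[OF p Lx]
  have nx: "a \<in> contr p Ly" if "a \<in> carrier R" "x \<otimes> a \<in> contr p Ly" for a
    using reg that unfolding Ly_def by auto
  have ny: "a \<in> contr p L" if "a \<in> carrier R" "y \<otimes> a \<in> contr p L" for a
    using reg that unfolding L_def by auto
  have Lc: "l \<in> contr p L" if "l \<in> L" for l using that subset_contr[OF p ideal_carrier[OF L]] by auto
  \<comment> \<open>The annihilator of \<open>x\<close> modulo \<open>L\<close>. As \<open>x\<close>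
    is regular modulo \<open>L\<close> and \<open>y\<close>, and \<open>y\<close> is regular modulo
    \<open>L\<close>, an element of \<open>Z\<close> is locally in \<open>L\<close> plus
    \<open>y\<close> times \<open>Z\<close>; Nakayama's lemma reduces \<open>Z\<close> to
    \<open>L\<close>.\<close>
  define Z where "Z = {a \<in> carrier R. a \<otimes> x \<in> contr p L}"
  have Z: "ideal Z R" unfolding Z_def by (rule colon_ideal[OF cL c(2)])
  have Py: "ideal (PIdl y) R" using c by (intro cgenideal_ideal)
  have "Z \<subseteq> contr p L"
  proof (rule nakayama[OF p Py _ Z L])
    show "PIdl y \<subseteq> p" using sub by (intro cgenideal_minimal[OF primeideal_ideal[OF p]]) auto
    show "Z \<subseteq> contr p (Idl (L \<union> (PIdl y) \<cdot> Z))"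
    proof
      fix a assume "a \<in> Z"
      then have a: "a \<in> carrier R" "x \<otimes> a \<in> contr p L" unfolding Z_def using c by (auto simp: m_comm)
      then have "a \<in> contr p Ly" using nx contr_mono[OF LLy] by blast
      then obtain s where s: "s \<in> carrier R" "s \<notin> p" "s \<otimes> a \<in> Ly" by (auto simp: contr_def)
      then obtain l r where lr: "l \<in> L" "r \<in> carrier R" "s \<otimes> a = l \<oplus> r \<otimes> y"
        unfolding Ly_def L_def using mem_Idl_insert[OF c(1,3)] by blast
      have lc: "l \<in> carrier R" using lr ideal_carrier[OF L] by auto
      have "y \<otimes> (x \<otimes> r) = x \<otimes> (l \<oplus> r \<otimes> y) \<ominus> x \<otimes> l" using lc lr(2) c(2,3) by algebra
      also have "\<dots> = s \<otimes> (x \<otimes> a) \<ominus> x \<otimes> l" unfolding lr(3)[symmetric] using s a c by (simp add: m_lcomm)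
      also have "\<dots> \<in> contr p L"
        by (rule ideal_minus_mem[OF cL ideal_lmult[OF cL s(1) a(2)] Lc[OF ideal_lmult[OF L c(2) lr(1)]]])
      finally have "x \<otimes> r \<in> contr p L" using ny lr c by auto
      then have "r \<in> Z" unfolding Z_def using lr c by (auto simp: m_comm)
      then have "y \<otimes> r \<in> (PIdl y) \<cdot> Z" using cgenideal_self[OF c(3)] by (intro ideal_prod.prod)
      then have ry: "r \<otimes> y \<in> L \<union> (PIdl y) \<cdot> Z" using m_comm[OF c(3) lr(2)] by simp
      have cc: "L \<union> (PIdl y) \<cdot> Z \<subseteq> carrier R"
        using ideal_carrier[OF L] ideal_prod_in_carrier[OF Py Z] by auto
      have "s \<otimes> a \<in> Idl (L \<union> (PIdl y) \<cdot> Z)"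
        unfolding lr(3) using lr(1) ry genideal_self[OF cc]
        by (intro ideal_add_mem[OF genideal_ideal[OF cc]]) auto
      then show "a \<in> contr p (Idl (L \<union> (PIdl y) \<cdot> Z))" using a s by (intro contrI)
    qed
  qed
  then have x_L: "a \<in> contr p L" if "a \<in> carrier R" "x \<otimes> a \<in> contr p L" for a
    using that c unfolding Z_def by (auto simp: m_comm)
  \<comment> \<open>From \<open>y \<otimes> a = l \<oplus> r \<otimes> x\<close>, up to units,
    \<open>x \<otimes> r\<close> lies in \<open>Ly\<close>, so \<open>r\<close> is locally
    \<open>k \<oplus> b \<otimes> y\<close>. Then \<open>y\<close> multiplies
    \<open>a \<ominus> b \<otimes> x\<close> into \<open>L\<close>, up to units, and
    cancels.\<close>
  have y_Lx: "a \<in> contr p Lx" if a: "a \<in> carrier R" "y \<otimes> a \<in> contr p Lx" for a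
  proof -
    obtain s where s: "s \<in> carrier R" "s \<notin> p" "s \<otimes> (y \<otimes> a) \<in> Lx" using a by (auto simp: contr_def)
    then obtain l r where lr: "l \<in> L" "r \<in> carrier R" "s \<otimes> (y \<otimes> a) = l \<oplus> r \<otimes> x"
      unfolding Lx_def L_def using mem_Idl_insert[OF c(1,2)] by blast
    have lc: "l \<in> carrier R" using lr ideal_carrier[OF L] by auto
    have yLy: "y \<in> Ly" unfolding Ly_def using genideal_self[of "insert y (set xs)"] c by auto
    have "x \<otimes> r = (l \<oplus> r \<otimes> x) \<ominus> l" using lc lr(2) c(2) by algebra
    also have "\<dots> = (s \<otimes> a) \<otimes> y \<ominus> l" unfolding lr(3)[symmetric] using s a c by (simp add: m_ac)
    also have "\<dots> \<in> Ly" using s a yLy lr LLy by (intro ideal_minus_mem[OF Ly] ideal_lmult[OF Ly]) auto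
    finally have "r \<in> contr p Ly" using nx[OF lr(2)] subset_contr[OF p ideal_carrier[OF Ly]] by auto
    then obtain t where t: "t \<in> carrier R" "t \<notin> p" "t \<otimes> r \<in> Ly" by (auto simp: contr_def)
    then obtain k b where kb: "k \<in> L" "b \<in> carrier R" "t \<otimes> r = k \<oplus> b \<otimes> y"
      unfolding Ly_def L_def using mem_Idl_insert[OF c(1,3)] by blast
    have kc: "k \<in> carrier R" using kb ideal_carrier[OF L] by auto
    have ts: "t \<otimes> s \<in> carrier R" "t \<otimes> s \<notin> p" using s t primeideal_mult[OF p] by auto
    have "y \<otimes> ((t \<otimes> s) \<otimes> a \<ominus> b \<otimes> x) = t \<otimes> (s \<otimes> (y \<otimes> a)) \<ominus> y \<otimes> (b \<otimes> x)"
      using t(1) s(1) a(1) kb(2) c(2,3) by algebra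
    also have "\<dots> = t \<otimes> l \<oplus> (t \<otimes> r) \<otimes> x \<ominus> y \<otimes> (b \<otimes> x)"
      unfolding lr(3) using t(1) lc lr(2) kb(2) c(2,3) by algebra
    also have "\<dots> = t \<otimes> l \<oplus> x \<otimes> k"
      unfolding kb(3) using t(1) lc kc kb(2) c(2,3) by algebra
    also have "\<dots> \<in> L" using t lr kb c by (intro ideal_add_mem[OF L] ideal_lmult[OF L])
    finally have "(t \<otimes> s) \<otimes> a \<ominus> b \<otimes> x \<in> contr p L" using ny ts a kb c Lc by auto
    then have 1: "(t \<otimes> s) \<otimes> a \<ominus> b \<otimes> x \<in> contr p Lx" using contr_mono[OF LLx] by blast
    have 2: "b \<otimes> x \<in> contr p Lx"
      using ideal_lmult[OF Lx kb(2) xLx] subset_contr[OF p ideal_carrier[OF Lx]] by blast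
    have "(t \<otimes> s) \<otimes> a \<ominus> b \<otimes> x \<oplus> b \<otimes> x = (t \<otimes> s) \<otimes> a" using ts(1) a(1) kb(2) c(2) by algebra
    then have "(t \<otimes> s) \<otimes> a \<in> contr p Lx" using ideal_add_mem[OF cLx 1 2] by simp
    then show ?thesis using contr_cancel[OF p Lx ts a(1)] by simp
  qed
  show ?thesis
    using reg x_L y_Lx unfolding L_def Lx_def by auto
qed

lemma local_regular_move_front:
  assumes p: "primeideal p R"
  shows "set (as @ y # xs) \<subseteq> p \<Longrightarrow> local_regular p (as @ y # xs) \<Longrightarrow> local_regular p (y # as @ xs)"
proof (induction as)
  case (Cons a as)
  have e: "set (as @ y # xs) = set (y # as @ xs)" by auto
  have "local_regular p (y # as @ xs)" using Cons by simp
  then have "local_regular p (a # y # as @ xs)"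
    using Cons.prems e by simp
  then show ?case using local_regular_swap[OF p, of a y "as @ xs"] Cons.prems(1) by auto
qed simp

lemma local_regular_permute:
  assumes p: "primeideal p R"
  shows "mset zs = mset xs \<Longrightarrow> set zs \<subseteq> p \<Longrightarrow> local_regular p zs \<Longrightarrow> local_regular p xs"
proof (induction xs arbitrary: zs)
  case (Cons x xs)
  have "x \<in> set zs" using Cons.prems(1) by (metis list.set_intros(1) mset_eq_setD)
  then obtain as bs where z: "zs = as @ x # bs" using split_list by fastforce
  have m: "mset (as @ bs) = mset xs" using Cons.prems(1) z by simp
  have "local_regular p (x # as @ bs)" using local_regular_move_front[OF p] Cons.prems z by auto
  moreover have "local_regular p xs" using Cons.IH[OF m] calculation Cons.prems(2) z by auto
  moreover have "set (as @ bs) = set xs" using m mset_eq_setD by blast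
  ultimately show ?case by simp
qed simp

lemma exchange_step:
  assumes p: "primeideal p R" and I: "ideal I R" and B: "B \<subseteq> I" and y: "y \<in> I"
    and gen: "I \<subseteq> contr p (Idl (insert y B))" and ynot: "y \<notin> contr p (Idl B)"
    and G: "G \<subseteq> I" "I \<subseteq> contr p (Idl G)"
  obtains g s u where "g \<in> G" "s \<in> carrier R - p" "u \<in> carrier R - p" "s \<otimes> g \<ominus> u \<otimes> y \<in> Idl B"
proof (rule ccontr)
  assume neg: "\<not> thesis"
  note Ic = ideal_carrier[OF I]
  note ip = primeideal_ideal[OF p]
  have c: "B \<subseteq> carrier R" "y \<in> carrier R" "G \<subseteq> carrier R" using B y G Ic by auto
  have iB: "ideal (Idl B) R" using c by (intro genideal_ideal)
  have cc: "Idl B \<union> p \<cdot> I \<subseteq> carrier R"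
    using ideal_carrier[OF iB] ideal_prod_in_carrier[OF ip I] by auto
  note iM = genideal_ideal[OF cc]
  have "G \<subseteq> contr p (Idl (Idl B \<union> p \<cdot> I))"
  proof
    fix g assume g: "g \<in> G"
    have gc: "g \<in> carrier R" using g c by auto
    obtain s where s: "s \<in> carrier R" "s \<notin> p" "s \<otimes> g \<in> Idl (insert y B)"
      using g G gen by (auto simp: contr_def)
    then obtain w r where wr: "w \<in> Idl B" "r \<in> carrier R" "s \<otimes> g = w \<oplus> r \<otimes> y"
      using mem_Idl_insert[OF c(1,2)] by auto
    have wc: "w \<in> carrier R" using wr ideal_carrier[OF iB] by auto
    have "s \<otimes> g \<ominus> r \<otimes> y = w" unfolding wr(3) using wc wr(2) c(2) by algebra
    then have "r \<in> p" using neg that[OF g, of s r] s wr by auto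
    then have "r \<otimes> y \<in> p \<cdot> I" using y by (intro ideal_prod.prod)
    then have "s \<otimes> g \<in> Idl (Idl B \<union> p \<cdot> I)"
      unfolding wr(3) using wr(1) genideal_self[OF cc] by (intro ideal_add_mem[OF iM]) auto
    then show "g \<in> contr p (Idl (Idl B \<union> p \<cdot> I))" using gc s by (intro contrI)
  qed
  then have "Idl G \<subseteq> contr p (Idl (Idl B \<union> p \<cdot> I))"
    by (intro genideal_minimal contr_ideal[OF p iM])
  then have "I \<subseteq> contr p (Idl (Idl B \<union> p \<cdot> I))"
    using G(2) contr_subset_contr[OF p iM] by blast
  then have "I \<subseteq> contr p (Idl B)" using nakayama[OF p ip subset_refl I iB] by simp
  then show False using y ynot by auto
qed

lemma exchange_generates:
  assumes p: "primeideal p R" and c: "B \<subseteq> carrier R" "y \<in> carrier R" "g \<in> carrier R"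
    and gen: "I \<subseteq> contr p (Idl (insert y B))"
    and s: "s \<in> carrier R" and u: "u \<in> carrier R - p" and d: "s \<otimes> g \<ominus> u \<otimes> y \<in> Idl B"
  shows "I \<subseteq> contr p (Idl (insert g B))"
proof -
  have cg: "insert g B \<subseteq> carrier R" using c by auto
  note i = genideal_ideal[OF cg]
  have BB: "Idl B \<subseteq> Idl (insert g B)" using c by (intro subset_Idl_subset) auto
  have "u \<otimes> y = s \<otimes> g \<ominus> (s \<otimes> g \<ominus> u \<otimes> y)"
  proof -
    have "u \<in> carrier R" using u by auto
    then show ?thesis using s c by algebra
  qed
  also have "\<dots> \<in> Idl (insert g B)"
    using genideal_self[OF cg] by (intro ideal_minus_mem[OF i ideal_lmult[OF i s] subsetD[OF BB d]]) auto
  finally have "y \<in> contr p (Idl (insert g B))" using u c by (intro contrI[of _ u]) auto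
  moreover have "B \<subseteq> contr p (Idl (insert g B))"
    using subset_contr[OF p ideal_carrier[OF i]] genideal_self[OF cg] by auto
  ultimately have "Idl (insert y B) \<subseteq> contr p (Idl (insert g B))"
    by (intro genideal_minimal contr_ideal[OF p i]) auto
  then show ?thesis using gen contr_subset_contr[OF p i] by blast
qed

lemma exchange_generators:
  assumes p: "primeideal p R" and I: "ideal I R" and G: "G \<subseteq> I" "I \<subseteq> contr p (Idl G)"
    and "finite Y" "Y \<subseteq> I" "B \<subseteq> I" "I \<subseteq> contr p (Idl (Y \<union> B))"
  shows "\<exists>T\<subseteq>G. finite T \<and> card T \<le> card Y \<and> I \<subseteq> contr p (Idl (T \<union> B))"
  using assms(5-)
proof (induction Y arbitrary: B rule: finite_induct)
  case empty
  then show ?case by (intro exI[of _ "{}"]) auto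
next
  case (insert y Y)
  note Ic = ideal_carrier[OF I]
  have YB: "Y \<union> B \<subseteq> I" "y \<in> I" "Y \<union> B \<subseteq> carrier R" "y \<in> carrier R" using insert.prems Ic by auto
  note iYB = genideal_ideal[OF YB(3)]
  have gen: "I \<subseteq> contr p (Idl (insert y (Y \<union> B)))" using insert.prems by auto
  show ?case
  proof (cases "y \<in> contr p (Idl (Y \<union> B))")
    case True
    have "Y \<union> B \<subseteq> contr p (Idl (Y \<union> B))"
      using subset_contr[OF p ideal_carrier[OF iYB]] genideal_self[OF YB(3)] by auto
    then have "Idl (insert y (Y \<union> B)) \<subseteq> contr p (Idl (Y \<union> B))"
      using True by (intro genideal_minimal contr_ideal[OF p iYB]) auto
    then have "I \<subseteq> contr p (Idl (Y \<union> B))" using gen contr_subset_contr[OF p iYB] by blast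
    moreover have "Y \<subseteq> I" using YB by auto
    ultimately obtain T where T: "T \<subseteq> G" "finite T" "card T \<le> card Y" "I \<subseteq> contr p (Idl (T \<union> B))"
      using insert.IH[of B] insert.prems(2) by blast
    moreover have "card Y \<le> card (insert y Y)" using insert.hyps by (intro card_mono) auto
    ultimately show ?thesis by (intro exI[of _ T]) auto
  next
    case False
    obtain g s u where g: "g \<in> G" "s \<in> carrier R - p" "u \<in> carrier R - p" "s \<otimes> g \<ominus> u \<otimes> y \<in> Idl (Y \<union> B)"
      using exchange_step[OF p I YB(1,2) gen False G] .
    have "I \<subseteq> contr p (Idl (insert g (Y \<union> B)))"
      using g G Ic by (intro exchange_generates[OF p YB(3,4) _ gen _ g(3,4)]) auto
    then have "I \<subseteq> contr p (Idl (Y \<union> insert g B))" by simp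
    moreover have "insert g B \<subseteq> I" using g G insert.prems by auto
    moreover have "Y \<subseteq> I" using YB by auto
    ultimately obtain T where T: "T \<subseteq> G" "finite T" "card T \<le> card Y" "I \<subseteq> contr p (Idl (T \<union> insert g B))"
      using insert.IH[of "insert g B"] by blast
    show ?thesis
    proof (intro exI[of _ "insert g T"] conjI)
      show "insert g T \<subseteq> G" using T g by auto
      show "finite (insert g T)" using T by auto
      show "card (insert g T) \<le> card (insert y Y)"
        using T insert.hyps card_insert_le_m1[of "Suc (card Y)" T g] by simp
      show "I \<subseteq> contr p (Idl (insert g T \<union> B))" using T by simp
    qed
  qed
qed

text \<open>Up to factors outside \<open>p\<close>, the new element \<open>g\<close> agrees with
  \<open>y\<close> modulo the remaining elements, so it is regular modulo them as well.
  Permutability moves it behind \<open>ys\<close>, where \<open>zs\<close> stores the exchanged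
  elements, and brings the next candidate to the front.\<close>

lemma exchange_regular:
  assumes p: "primeideal p R" and I: "ideal I R" "I \<subseteq> p" and G: "G \<subseteq> I" "I \<subseteq> contr p (Idl G)"
  shows "local_regular p (ys @ zs) \<Longrightarrow> set (ys @ zs) \<subseteq> I \<Longrightarrow> I \<subseteq> contr p (Idl (set (ys @ zs))) \<Longrightarrow>
    set zs \<subseteq> G \<Longrightarrow> distinct zs \<Longrightarrow>
    \<exists>fs. length fs = length ys + length zs \<and> set fs \<subseteq> G \<and> distinct fs \<and> local_regular p fs"
proof (induction ys arbitrary: zs)
  case (Cons y ys)
  define B where "B = set (ys @ zs)"
  note Ic = ideal_carrier[OF I(1)]
  have c: "B \<subseteq> I" "y \<in> I" "B \<subseteq> carrier R" "y \<in> carrier R" using Cons.prems(2) Ic unfolding B_def by auto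
  note iB = genideal_ideal[OF c(3)]
  note cB = contr_ideal[OF p iB]
  have nzd: "a \<in> contr p (Idl B)" if "a \<in> carrier R" "y \<otimes> a \<in> contr p (Idl B)" for a
    using Cons.prems(1) that unfolding B_def by auto
  have gen: "I \<subseteq> contr p (Idl (insert y B))" using Cons.prems(3) unfolding B_def by simp
  \<comment> \<open>Otherwise regularity of \<open>y\<close> modulo \<open>B\<close> would put
    \<open>\<one>\<close> into the contraction of an ideal contained in \<open>p\<close>.\<close>
  have ynot: "y \<notin> contr p (Idl B)"
  proof
    assume "y \<in> contr p (Idl B)"
    then have "\<one> \<in> contr p (Idl B)" using nzd[of \<one>] c by simp
    then obtain s where s: "s \<in> carrier R" "s \<notin> p" "s \<in> Idl B" by (auto simp: contr_def)
    have "Idl B \<subseteq> p" using c I(2) by (intro genideal_minimal[OF primeideal_ideal[OF p]]) auto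
    then show False using s by auto
  qed
  obtain g s u where g: "g \<in> G" "s \<in> carrier R - p" "u \<in> carrier R - p" "s \<otimes> g \<ominus> u \<otimes> y \<in> Idl B"
    using exchange_step[OF p I(1) c(1,2) gen ynot G] .
  have gc: "g \<in> carrier R" and gI: "g \<in> I" using g G Ic by auto
  have su: "s \<in> carrier R" "u \<in> carrier R" using g by auto
  have dB: "s \<otimes> g \<ominus> u \<otimes> y \<in> contr p (Idl B)" using g subset_contr[OF p ideal_carrier[OF iB]] by auto
  have gen': "I \<subseteq> contr p (Idl (insert g B))"
    using g gc by (intro exchange_generates[OF p c(3,4) _ gen _ g(3,4)]) auto
  have lift: "u \<otimes> y \<otimes> a \<in> contr p (Idl B)" if a: "a \<in> carrier R" "g \<otimes> a \<in> contr p (Idl B)" for a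
  proof -
    have "u \<otimes> y \<otimes> a = s \<otimes> (g \<otimes> a) \<ominus> a \<otimes> (s \<otimes> g \<ominus> u \<otimes> y)"
      using su gc c(4) a(1) by algebra
    then show ?thesis using a dB su by (auto intro!: ideal_minus_mem[OF cB] ideal_lmult[OF cB])
  qed
  have "local_regular p (g # ys @ zs)"
  proof -
    have "a \<in> contr p (Idl B)" if a: "a \<in> carrier R" "g \<otimes> a \<in> contr p (Idl B)" for a
    proof -
      have "u \<otimes> (y \<otimes> a) \<in> contr p (Idl B)" using lift[OF a] su c a by (simp add: m_assoc)
      then have "y \<otimes> a \<in> contr p (Idl B)"
        using contr_cancel[OF p iB su(2)] g(3) c a by auto
      then show ?thesis using nzd a by auto
    qed
    then show ?thesis using Cons.prems(1) unfolding B_def by auto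
  qed
  moreover have "set (g # ys @ zs) \<subseteq> p" using gI c(1) I(2) unfolding B_def by auto
  moreover have "mset (g # ys @ zs) = mset (ys @ g # zs)" by simp
  ultimately have reg: "local_regular p (ys @ g # zs)"
    using local_regular_permute[OF p] by blast
  \<comment> \<open>A repeated element would lie in \<open>B\<close>, and so would \<open>y\<close>
    locally. Distinctness makes the final count of elements possible.\<close>
  have "g \<notin> set zs"
  proof
    assume "g \<in> set zs"
    then have "g \<in> B" unfolding B_def by auto
    then have "g \<in> contr p (Idl B)" 
      using genideal_self[OF c(3)] subset_contr[OF p ideal_carrier[OF iB]] by auto
    then have "u \<otimes> y \<in> contr p (Idl B)" using lift[of \<one>] gc c su by simp
    then show False using contr_cancel[OF p iB su(2) _ c(4)] g(3) ynot by auto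
  qed
  moreover have "insert g B = set (ys @ g # zs)" unfolding B_def by auto
  moreover have "insert g B \<subseteq> I" using gI c by auto
  ultimately have "\<exists>fs. length fs = length ys + length (g # zs) \<and> set fs \<subseteq> G \<and> distinct fs \<and> local_regular p fs"
    using Cons.prems(4,5) gen' g(1) by (intro Cons.IH[OF reg]) auto
  then show ?case by simp
qed auto

text \<open>Exchange extracts from \<open>set fs\<close> a regular sequence of distinct elements as
  long as \<open>ys\<close>. Since \<open>fs\<close> is not longer, it is this sequence up to
  order.\<close>

lemma local_regular_generators:
  assumes p: "primeideal p R" and I: "ideal I R" "I \<subseteq> p"
    and ys: "local_regular p ys" "set ys \<subseteq> I" "I \<subseteq> contr p (Idl (set ys))"
    and fs: "set fs \<subseteq> I" "I \<subseteq> contr p (Idl (set fs))" "distinct fs" "length fs \<le> length ys"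
  shows "local_regular p fs"
proof -
  obtain zs where z: "length zs = length ys" "set zs \<subseteq> set fs" "distinct zs" "local_regular p zs"
    using exchange_regular[OF p I fs(1,2), of ys "[]"] ys by auto
  have "card (set zs) = length ys" "card (set fs) = length fs"
    using z fs by (auto simp: distinct_card)
  then have "set zs = set fs" using z fs by (intro card_seteq) auto
  then have "mset zs = mset fs" using z fs set_eq_iff_mset_eq_distinct by blast
  then show ?thesis using local_regular_permute[OF p _ _ z(4)] z(2) fs(1) I(2) by auto
qed

end

section \<open>Associated primes and symbolic powers\<close>

context cring
begin

definition ass :: "'a set \<Rightarrow> 'a set set" where
  "ass I = {p. primeideal p R \<and> (\<exists>v\<in>carrier R. p = {a \<in> carrier R. a \<otimes> v \<in> I})}"

lemma associated_primes_quot: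
  assumes "ideal I R"
  shows "associated_primes R (quot_module R I) = ass I"
proof -
  interpret ideal I R by fact
  have z: "(I +> a) \<otimes>\<^bsub>R Quot I\<^esub> (I +> v) = I \<longleftrightarrow> a \<otimes> v \<in> I" if "a \<in> carrier R" "v \<in> carrier R" for a v
  proof -
    have "(I +> a) \<otimes>\<^bsub>R Quot I\<^esub> (I +> v) = I +> (a \<otimes> v)"
      using rcoset_mult_add that by (simp add: FactRing_def)
    then show ?thesis
      using rcos_const_imp_mem[of "a \<otimes> v"] a_rcos_zero[OF assms, of "a \<otimes> v"] m_closed[OF that] by auto
  qed
  have "(\<exists>x\<in>carrier (quot_module R I). p = {a \<in> carrier R. a \<odot>\<^bsub>quot_module R I\<^esub> x = \<zero>\<^bsub>quot_module R I\<^esub>})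
     \<longleftrightarrow> (\<exists>v\<in>carrier R. p = {a \<in> carrier R. a \<otimes> v \<in> I})" for p
  proof -
    have "carrier (quot_module R I) = (\<lambda>v. I +> v) ` carrier R"
      by (auto simp: quot_module_def FactRing_def A_RCOSETS_def' a_r_coset_def')
    moreover have "{a \<in> carrier R. a \<odot>\<^bsub>quot_module R I\<^esub> (I +> v) = \<zero>\<^bsub>quot_module R I\<^esub>} = {a \<in> carrier R. a \<otimes> v \<in> I}"
      if "v \<in> carrier R" for v
      using z[OF _ that] by (auto simp: quot_module_def FactRing_def)
    ultimately show ?thesis by auto
  qed
  then show ?thesis unfolding associated_primes_def ass_def by simp
qed

text \<open>A monomial of degree \<open>M + N\<close> contains \<open>x\<close> at least
  \<open>N\<close> times or has degree at least \<open>M\<close> in \<open>B\<close>.\<close>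

lemma ideal_power_add_subset:
  assumes "B \<subseteq> carrier R" "x \<in> carrier R" and J: "ideal J R" and x: "x [^] N \<in> J"
    and A: "ideal_power R (Idl B) M \<subseteq> J"
  shows "ideal_power R (Idl (insert x B)) (M + N) \<subseteq> J"
proof -
  have xB: "insert x B \<subseteq> carrier R" using assms by auto
  note iB = genideal_ideal[OF assms(1)] and ixB = genideal_ideal[OF xB]
  \<comment> \<open>Generalized for the induction: \<open>j\<close> counts the factors
    \<open>x\<close> already split off, \<open>n\<close> the degree still available above
    \<open>M\<close>. When \<open>n\<close> is used up, \<open>j \<ge> N\<close>.\<close>
  have "x [^] (j::nat) \<otimes> z \<in> J" if "z \<in> ideal_power R (Idl (insert x B)) (M + n)" "j + n \<ge> N" for n j z
    using that
  proof (induction n arbitrary: j z)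
    case 0
    then have "x [^] j = x [^] (j - N) \<otimes> x [^] N" using assms(2) by (simp add: nat_pow_mult)
    then have "x [^] j \<in> J" using ideal_lmult[OF J _ x] assms(2) by simp
    then show ?case using 0 ideal_carrier[OF ideal_power_ideal[OF ixB]] ideal.I_r_closed[OF J] by blast
  next
    case (Suc n)
    then obtain g f where gf: "g \<in> ideal_power R (Idl (insert x B)) (M + n)" "f \<in> ideal_power R (Idl B) (Suc (M + n))"
      "z = x \<otimes> g \<oplus> f"
      using ideal_power_insert_Suc[OF assms(1,2), of z "M + n"] by auto
    have fJ: "f \<in> J" using gf(2) A ideal_power_antimono[OF iB, of M "Suc (M + n)"] by auto
    have c: "g \<in> carrier R" "f \<in> carrier R"
      using gf(1,2) ideal_carrier[OF ideal_power_ideal[OF ixB]] ideal_carrier[OF ideal_power_ideal[OF iB]] by auto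
    have xc: "x [^] j \<in> carrier R" using assms by auto
    have "x [^] j \<otimes> z = x [^] j \<otimes> x \<otimes> g \<oplus> x [^] j \<otimes> f"
      unfolding gf(3) using c xc assms(2) by algebra
    also have "\<dots> = x [^] Suc j \<otimes> g \<oplus> x [^] j \<otimes> f" by simp
    also have "\<dots> \<in> J"
      using Suc.IH[of g "Suc j"] gf(1) Suc.prems(2) ideal_lmult[OF J xc fJ] by (intro ideal_add_mem[OF J]) auto
    finally show ?case .
  qed
  note * = this
  show ?thesis
  proof
    fix z assume z: "z \<in> ideal_power R (Idl (insert x B)) (M + N)"
    have "x [^] (0::nat) \<otimes> z \<in> J" by (rule *[OF z]) simp
    then show "z \<in> J" using z ideal_carrier[OF ideal_power_ideal[OF ixB, of "M + N"]] by auto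
  qed
qed

lemma ideal_power_subset_of_powers:
  assumes "finite A" "A \<subseteq> carrier R" and J: "ideal J R" and "\<And>x. x \<in> A \<Longrightarrow> \<exists>N::nat. x [^] N \<in> J"
  shows "\<exists>M. ideal_power R (Idl A) M \<subseteq> J"
  using assms(1,2,4)
proof (induction A rule: finite_induct)
  case empty
  \<comment> \<open>The exponent has to be positive, because the zeroth power of the zero ideal is
    the whole ring.\<close>
  have "ideal_power R (Idl {}) (Suc 0) \<subseteq> J"
    using ideal_power_1[OF genideal_ideal[of "{}"]] Idl_empty ideal_zero_mem[OF J] by simp
  then show ?case by blast
next
  case (insert x A)
  then obtain M where "ideal_power R (Idl A) M \<subseteq> J" by auto
  moreover obtain N :: nat where "x [^] N \<in> J" using insert.prems by auto
  ultimately show ?case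
    using ideal_power_add_subset[of A x J N M] insert.prems(1) J by auto
qed

section \<open>Saturation with respect to a single element\<close>

lemma power_colon_ideal:
  assumes I: "ideal I R" and d: "d \<in> carrier R"
  shows "ideal {x \<in> carrier R. \<exists>N::nat. d [^] N \<otimes> x \<in> I} R" (is "ideal ?K R")
proof (rule ideal_if_closed)
  show "?K \<subseteq> carrier R" by auto
  have "d [^] (0::nat) \<otimes> \<zero> \<in> I" using ideal_zero_mem[OF I] by simp
  then show "\<zero> \<in> ?K" by blast
  show "x \<otimes> a \<in> ?K" if a: "x \<in> carrier R" "a \<in> ?K" for x a
  proof -
    obtain N :: nat where N: "a \<in> carrier R" "d [^] N \<otimes> a \<in> I" using a by auto
    have "d [^] N \<otimes> (x \<otimes> a) = x \<otimes> (d [^] N \<otimes> a)" using N a d by (simp add: m_lcomm)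
    also have "\<dots> \<in> I" by (rule ideal_lmult[OF I a(1) N(2)])
    finally show ?thesis using N a by blast
  qed
  show "a \<oplus> b \<in> ?K" if ab: "a \<in> ?K" "b \<in> ?K" for a b
  proof -
    obtain N M :: nat where NM: "a \<in> carrier R" "d [^] N \<otimes> a \<in> I" "b \<in> carrier R" "d [^] M \<otimes> b \<in> I"
      using ab by auto
    have dc: "d [^] N \<in> carrier R" "d [^] M \<in> carrier R" using d by auto
    have "d [^] (N + M) \<otimes> (a \<oplus> b) = (d [^] N \<otimes> d [^] M) \<otimes> (a \<oplus> b)"
      using d by (simp add: nat_pow_mult)
    also have "\<dots> = d [^] M \<otimes> (d [^] N \<otimes> a) \<oplus> d [^] N \<otimes> (d [^] M \<otimes> b)"
      using dc NM(1,3) by algebra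
    also have "\<dots> \<in> I" by (rule ideal_add_mem[OF I ideal_lmult[OF I dc(2) NM(2)] ideal_lmult[OF I dc(1) NM(4)]])
    finally show ?thesis using NM by blast
  qed
qed

lemma pow_mult_mem_mono:
  assumes I: "ideal I R" and d: "d \<in> carrier R" "x \<in> carrier R" "d [^] N \<otimes> x \<in> I" "N \<le> (M::nat)"
  shows "d [^] M \<otimes> x \<in> I"
proof -
  have "d [^] M = d [^] (M - N) \<otimes> d [^] N" using d by (simp add: nat_pow_mult)
  then have "d [^] M \<otimes> x = d [^] (M - N) \<otimes> (d [^] N \<otimes> x)" using d by (simp add: m_assoc)
  then show ?thesis using ideal_lmult[OF I _ d(3), of "d [^] (M - N)"] d by simp
qed

lemma finite_common_power:
  assumes I: "ideal I R" and d: "d \<in> carrier R" and "finite U" "U \<subseteq> carrier R"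
    "\<And>u. u \<in> U \<Longrightarrow> \<exists>N::nat. d [^] N \<otimes> u \<in> I"
  shows "\<exists>N::nat. \<forall>u\<in>U. d [^] N \<otimes> u \<in> I"
  using assms(3-)
proof (induction U rule: finite_induct)
  case (insert u U)
  obtain N :: nat where N: "\<forall>u\<in>U. d [^] N \<otimes> u \<in> I" using insert by auto
  obtain M :: nat where M: "d [^] M \<otimes> u \<in> I" using insert.prems by auto
  note NM = N M
  have "d [^] (max N M) \<otimes> v \<in> I" if v: "v \<in> insert u U" for v
  proof (cases "v = u")
    case True
    then show ?thesis using pow_mult_mem_mono[OF I d _ NM(2)] insert.prems by auto
  next
    case False
    then show ?thesis using pow_mult_mem_mono[OF I d, of v N "max N M"] v NM(1) insert.prems by auto
  qed
  then show ?case by blast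
qed auto

end

section \<open>Associated primes and the passage from local to global\<close>

context noetherian_cring
begin

text \<open>A maximal colon ideal of an element outside \<open>J\<close> is prime: if
  \<open>b \<otimes> w\<close> is not in \<open>J\<close>, its colon ideal contains that of
  \<open>w\<close>, hence equals it by maximality, and any \<open>a\<close> with
  \<open>a \<otimes> b\<close> in the colon ideal of \<open>w\<close> lies there.\<close>

lemma ass_above_colon:
  assumes J: "ideal J R" and v: "v \<in> carrier R" "v \<notin> J"
  obtains p w where "primeideal p R" "w \<in> carrier R" "p = {a \<in> carrier R. a \<otimes> w \<in> J}"
    "{a \<in> carrier R. a \<otimes> v \<in> J} \<subseteq> p"
proof -
  define colon where "colon w = {a \<in> carrier R. a \<otimes> w \<in> J}" for w
  define \<J> where "\<J> = {colon w | w. w \<in> carrier R \<and> w \<notin> J \<and> colon v \<subseteq> colon w}"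
  have "\<exists>M\<in>\<J>. \<forall>K\<in>\<J>. M \<subseteq> K \<longrightarrow> K = M"
    using v colon_ideal[OF J] by (intro exists_maximal_ideal) (auto simp: \<J>_def colon_def)
  then obtain p where "p \<in> \<J>" and max: "\<forall>K\<in>\<J>. p \<subseteq> K \<longrightarrow> K = p" ..
  then obtain w where w: "w \<in> carrier R" "w \<notin> J" "colon v \<subseteq> colon w" "p = colon w"
    unfolding \<J>_def by auto
  have "primeideal p R"
  proof (rule primeidealI[OF _ is_cring])
    show "ideal p R" unfolding w(4) colon_def by (rule colon_ideal[OF J w(1)])
    have "\<one> \<notin> p" unfolding w(4) colon_def using w by auto
    then show "carrier R \<noteq> p" by auto
    fix a b assume ab: "a \<in> carrier R" "b \<in> carrier R" "a \<otimes> b \<in> p"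
    show "a \<in> p \<or> b \<in> p"
    proof (cases "b \<otimes> w \<in> J")
      case True
      then show ?thesis using w ab unfolding colon_def by auto
    next
      case False
      have "colon w \<subseteq> colon (b \<otimes> w)"
      proof
        fix x assume "x \<in> colon w"
        then have x: "x \<in> carrier R" "x \<otimes> w \<in> J" unfolding colon_def by auto
        have "x \<otimes> (b \<otimes> w) = b \<otimes> (x \<otimes> w)" using x ab w by (simp add: m_lcomm)
        then show "x \<in> colon (b \<otimes> w)" using x ideal_lmult[OF J ab(2) x(2)] unfolding colon_def by auto
      qed
      moreover from this have "colon (b \<otimes> w) \<in> \<J>" unfolding \<J>_def using False w(1,3) ab by auto
      ultimately have "colon (b \<otimes> w) = p" using max w(4) by auto
      moreover have "a \<in> colon (b \<otimes> w)" using ab w unfolding colon_def by (auto simp: m_assoc)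
      ultimately show ?thesis by auto
    qed
  qed
  then show thesis using that w unfolding colon_def by auto
qed

text \<open>The saturation \<open>K\<close> of \<open>I\<close> by powers of \<open>d\<close> has
  only such associated primes as are associated to \<open>I\<close> and avoid \<open>d\<close>. If
  \<open>u\<close> were not in \<open>K\<close>, one of them would contain every multiplier of
  \<open>u\<close> into \<open>K\<close>, against the local assumption there.\<close>

lemma power_mult_mem_if_local:
  assumes I: "ideal I R" and d: "d \<in> carrier R" and u: "u \<in> carrier R"
    and local: "\<And>p. p \<in> ass I \<Longrightarrow> d \<notin> p \<Longrightarrow> u \<in> contr p I"
  shows "\<exists>N::nat. d [^] N \<otimes> u \<in> I"
proof (rule ccontr)
  assume neg: "\<not> ?thesis"
  define K where "K = {x \<in> carrier R. \<exists>N::nat. d [^] N \<otimes> x \<in> I}"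
  have K: "ideal K R" unfolding K_def by (rule power_colon_ideal[OF I d])
  have uK: "u \<notin> K" using neg unfolding K_def by auto
  obtain p w where p: "primeideal p R" "w \<in> carrier R" "p = {a \<in> carrier R. a \<otimes> w \<in> K}"
    "{a \<in> carrier R. a \<otimes> u \<in> K} \<subseteq> p"
    by (rule ass_above_colon[OF K u uK])
  have dp: "d \<notin> p"
  proof
    assume "d \<in> p"
    then obtain N :: nat where "d [^] N \<otimes> (d \<otimes> w) \<in> I" using p unfolding K_def by auto
    moreover have "d [^] N \<otimes> (d \<otimes> w) = d [^] Suc N \<otimes> w" using d p by (simp add: m_assoc)
    ultimately have "d [^] Suc N \<otimes> w \<in> I" by simp
    then have "w \<in> K" using p(2) unfolding K_def by blast
    then have "\<one> \<in> p" using p by auto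
    then show False using primeideal_one[OF p(1)] by simp
  qed
  \<comment> \<open>As \<open>p\<close> is finitely generated, one power of \<open>d\<close> carries
    all of \<open>p\<close> times \<open>w\<close> into \<open>I\<close>. Replacing \<open>w\<close>
    by that multiple exhibits \<open>p\<close> as an associated prime of \<open>I\<close>
    itself.\<close>
  obtain A where A: "A \<subseteq> carrier R" "finite A" "p = Idl A"
    using finetely_gen[OF primeideal_ideal[OF p(1)]] by blast
  have Ap: "A \<subseteq> p" using A genideal_self by auto
  have "\<exists>N::nat. d [^] N \<otimes> x \<in> I" if "x \<in> (\<lambda>a. a \<otimes> w) ` A" for x
    using that Ap p(3) unfolding K_def by auto
  then obtain N :: nat where N: "\<forall>x\<in>(\<lambda>a. a \<otimes> w) ` A. d [^] N \<otimes> x \<in> I"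
    using finite_common_power[OF I d, of "(\<lambda>a. a \<otimes> w) ` A"] A p(2) by blast
  define w' where "w' = d [^] N \<otimes> w"
  have w': "w' \<in> carrier R" unfolding w'_def using d p by auto
  have eq: "a \<otimes> w' = d [^] N \<otimes> (a \<otimes> w)" if "a \<in> carrier R" for a
    unfolding w'_def using that d p by (simp add: m_lcomm)
  have "p = {a \<in> carrier R. a \<otimes> w' \<in> I}"
  proof
    show "p \<subseteq> {a \<in> carrier R. a \<otimes> w' \<in> I}"
      unfolding A(3)
    proof (rule genideal_minimal[OF colon_ideal[OF I w']])
      show "A \<subseteq> {a \<in> carrier R. a \<otimes> w' \<in> I}" using N A(1) eq by auto
    qed
    show "{a \<in> carrier R. a \<otimes> w' \<in> I} \<subseteq> p"
    proof
      fix a assume a: "a \<in> {a \<in> carrier R. a \<otimes> w' \<in> I}"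
      then have "d [^] N \<otimes> (a \<otimes> w) \<in> I" using eq by auto
      then have "a \<otimes> w \<in> K" unfolding K_def using a p(2) by blast
      then show "a \<in> p" using a p(3) by auto
    qed
  qed
  then have "p \<in> ass I" unfolding ass_def using p(1) w' by blast
  then have "u \<in> contr p I" using local dp by auto
  then obtain s where s: "s \<in> carrier R" "s \<notin> p" "s \<otimes> u \<in> I" by (auto simp: contr_def)
  have "d [^] (0::nat) \<otimes> (s \<otimes> u) \<in> I" using s u by simp
  then have "s \<otimes> u \<in> K" unfolding K_def using s u by blast
  then show False using p(4) s by auto
qed

lemma power_mult_mem_ideal_power:
  assumes I: "ideal I R" and d: "d \<in> carrier R" and fs: "set fs \<subseteq> I"
    and gen: "\<And>x. x \<in> I \<Longrightarrow> d \<otimes> x \<in> Idl (set fs)"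
    and reg: "\<And>p. p \<in> ass I \<Longrightarrow> d \<notin> p \<Longrightarrow> local_regular p fs"
    and a: "a \<in> carrier R" "\<And>p. p \<in> ass I \<Longrightarrow> a \<in> contr p (ideal_power R I m)"
  shows "k \<le> m \<Longrightarrow> \<exists>N::nat. d [^] N \<otimes> a \<in> ideal_power R I k"
proof (induction k)
  case 0
  show ?case using a d by (auto simp: ideal_power_0)
next
  case (Suc k)
  then obtain N :: nat where N: "d [^] N \<otimes> a \<in> ideal_power R I k" by auto
  define F where "F = Idl (set fs)"
  have fc: "set fs \<subseteq> carrier R" using fs ideal_carrier[OF I] by auto
  have F: "ideal F R" unfolding F_def using fc by (rule genideal_ideal)
  have FI: "F \<subseteq> I" unfolding F_def using fs by (intro genideal_minimal[OF I])
  note PI = ideal_power_ideal[OF I] and PF = ideal_power_ideal[OF F]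
  have toF: "d [^] j \<otimes> x \<in> ideal_power R F j" if "x \<in> ideal_power R I j" for j x
    using prod_pow_mem_ideal_power[OF I that d _ F] gen unfolding F_def by blast
  define z where "z = d [^] k \<otimes> (d [^] N \<otimes> a)"
  have "z \<in> ideal_power R F k" unfolding z_def by (rule toF[OF N])
  then obtain U where U: "form_value fs k U z"
    using form_value_exists[OF fc] unfolding F_def by blast
  have Uc: "finite U" "U \<subseteq> carrier R" using form_value_carrier[OF U fc] by auto
  have "U \<subseteq> contr p I" if p: "p \<in> ass I" "d \<notin> p" for p
  proof -
    have pp: "primeideal p R" using p unfolding ass_def by auto
    \<comment> \<open>At \<open>p\<close> the element \<open>d\<close> is a unit, so the powers of
      \<open>I\<close> and of \<open>F\<close> agree locally. Hence \<open>z\<close>, written as a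
      form of degree \<open>k\<close>, has order \<open>k + 1\<close> there, as quasi-regularity
      requires.\<close>
    have "ideal_power R I (Suc k) \<subseteq> contr p (ideal_power R F (Suc k))"
    proof
      fix x assume x: "x \<in> ideal_power R I (Suc k)"
      show "x \<in> contr p (ideal_power R F (Suc k))"
        using toF[OF x] subsetD[OF ideal_carrier[OF PI] x] primeideal_pow[OF pp d p(2), of "Suc k"] d
        by (intro contrI[of _ "d [^] Suc k"]) (auto simp del: nat_pow_Suc)
    qed
    then have "contr p (ideal_power R I (Suc k)) \<subseteq> contr p (ideal_power R F (Suc k))"
      by (rule contr_subset_contr[OF pp PF])
    moreover have "a \<in> contr p (ideal_power R I (Suc k))"
      using a(2)[OF p(1)] contr_mono[OF ideal_power_antimono[OF I Suc.prems]] by auto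
    ultimately have "a \<in> contr p (ideal_power R F (Suc k))" by auto
    then have "z \<in> contr p (ideal_power R F (Suc k))"
      unfolding z_def using d by (intro ideal_lmult[OF contr_ideal[OF pp PF]]) auto
    then have "U \<subseteq> contr p F"
      using local_regular_quasi_regular[OF pp reg[OF p] fc U] unfolding F_def by simp
    then show ?thesis using contr_mono[OF FI] by blast
  qed
  then have "\<exists>M::nat. d [^] M \<otimes> u \<in> I" if "u \<in> U" for u
    using power_mult_mem_if_local[OF I d, of u] that Uc by blast
  then obtain M :: nat where M: "\<forall>u\<in>U. d [^] M \<otimes> u \<in> I"
    using finite_common_power[OF I d Uc] by blast
  have "d [^] M \<otimes> z \<in> ideal_power R I (Suc k)"
    using form_value_coeff_mem[OF U I fs] M d by auto
  moreover have "d [^] M \<otimes> z = d [^] (M + k + N) \<otimes> a"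
    unfolding z_def using d a by (simp add: m_assoc nat_pow_mult[symmetric])
  ultimately show ?case by metis
qed

text \<open>The finite generators must be members of \<open>D\<close>, because powers multiplying
  into \<open>L\<close> are known only for those. They come from a maximal ideal among those
  generated by finite subsets of \<open>D\<close>.\<close>

lemma exists_finite_generating_subset:
  assumes "D \<subseteq> carrier R"
  obtains D0 where "finite D0" "D0 \<subseteq> D" "Idl D0 = Idl D"
proof -
  define \<J> where "\<J> = {Idl D' | D'. finite D' \<and> D' \<subseteq> D}"
  have "Idl {} \<in> \<J>" unfolding \<J>_def by blast
  then have "\<exists>M\<in>\<J>. \<forall>K\<in>\<J>. M \<subseteq> K \<longrightarrow> K = M"
    using assms by (intro exists_maximal_ideal) (auto simp: \<J>_def intro!: genideal_ideal)
  then obtain M where "M \<in> \<J>" and max: "\<forall>K\<in>\<J>. M \<subseteq> K \<longrightarrow> K = M" ..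
  then obtain D0 where D0: "finite D0" "D0 \<subseteq> D" "M = Idl D0" unfolding \<J>_def by auto
  have "D \<subseteq> M"
  proof
    fix x assume x: "x \<in> D"
    have c: "insert x D0 \<subseteq> carrier R" using x D0 assms by auto
    have "Idl (insert x D0) \<in> \<J>" unfolding \<J>_def using x D0 by blast
    moreover have "M \<subseteq> Idl (insert x D0)" unfolding D0(3) using c by (intro subset_Idl_subset) auto
    ultimately have "Idl (insert x D0) = M" using max by auto
    then show "x \<in> M" using genideal_self[OF c] by auto
  qed
  then have "Idl D \<subseteq> Idl D0"
    unfolding D0(3) using D0 assms by (intro genideal_minimal genideal_ideal) auto
  moreover have "Idl D0 \<subseteq> Idl D" using D0 assms by (intro subset_Idl_subset) auto
  ultimately show thesis using that[of D0] D0(1,2) by blast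
qed

text \<open>Finitely many of the generators suffice; if a power of each lies in the colon ideal of
  \<open>a\<close>, then so does a power of the ideal they generate.\<close>

lemma mem_saturation:
  assumes L: "ideal L R" and a: "a \<in> carrier R" and D: "D \<subseteq> carrier R"
    and pow: "\<And>d. d \<in> D \<Longrightarrow> \<exists>N::nat. d [^] N \<otimes> a \<in> L"
  shows "a \<in> saturation R L (Idl D)"
proof -
  obtain D0 where D0: "finite D0" "D0 \<subseteq> D" "Idl D0 = Idl D"
    using exists_finite_generating_subset[OF D] .
  define J where "J = {r \<in> carrier R. r \<otimes> a \<in> L}"
  have J: "ideal J R" unfolding J_def by (rule colon_ideal[OF L a])
  have "\<exists>N::nat. x [^] N \<in> J" if "x \<in> D0" for x
  proof -
    have "x \<in> carrier R" "x \<in> D" using that D0 D by auto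
    then show ?thesis using pow[of x] unfolding J_def by auto
  qed
  then obtain M where M: "ideal_power R (Idl D) M \<subseteq> J"
    using ideal_power_subset_of_powers[OF D0(1) subset_trans[OF D0(2) D] J] D0(3) by auto
  note iD = genideal_ideal[OF D]
  \<comment> \<open>\<open>M\<close> may be zero, whereas the exponents in \<open>saturation\<close>
    start at one.\<close>
  have "ideal_power R (Idl D) (Suc M) \<subseteq> J"
    using M ideal_power_antimono[OF iD, of M "Suc M"] by auto
  then have "\<forall>h\<in>ideal_power R (Idl D) (Suc M). a \<otimes> h \<in> L"
    unfolding J_def using a by (auto simp: m_comm)
  then show ?thesis
    unfolding saturation_def ideal_quotient_def using a by (auto intro!: bexI[of _ "Suc M"])
qed

end

section \<open>Localization\<close>

locale denominators = cring R for R (structure) +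
  fixes W :: "'a set"
  assumes W_carrier: "W \<subseteq> carrier R"
    and one_W: "\<one> \<in> W"
    and mult_W: "s \<in> W \<Longrightarrow> t \<in> W \<Longrightarrow> s \<otimes> t \<in> W"
begin

abbreviation frac :: "'a \<Rightarrow> 'a \<Rightarrow> ('a \<times> 'a) set" where
  "frac \<equiv> loc_frac R W"

abbreviation Loc :: "('a \<times> 'a) set ring" where
  "Loc \<equiv> localization R W"

lemma W_closed: "s \<in> W \<Longrightarrow> s \<in> carrier R"
  using W_carrier by auto

lemma loc_rel_iff:
  "((a, s), (b, t)) \<in> loc_rel R W \<longleftrightarrow> a \<in> carrier R \<and> s \<in> W \<and> b \<in> carrier R \<and> t \<in> W \<and>
     (\<exists>u\<in>W. u \<otimes> (a \<otimes> t) = u \<otimes> (b \<otimes> s))"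
proof -
  have "u \<otimes> (a \<otimes> t \<ominus> b \<otimes> s) = \<zero> \<longleftrightarrow> u \<otimes> (a \<otimes> t) = u \<otimes> (b \<otimes> s)"
    if "a \<in> carrier R" "s \<in> W" "b \<in> carrier R" "t \<in> W" "u \<in> W" for u
  proof -
    have c: "u \<in> carrier R" "s \<in> carrier R" "t \<in> carrier R" using that W_closed by auto
    have "u \<otimes> (a \<otimes> t \<ominus> b \<otimes> s) = u \<otimes> (a \<otimes> t) \<ominus> u \<otimes> (b \<otimes> s)" using c that(1,3) by algebra
    then show ?thesis using c that by simp
  qed
  then show ?thesis unfolding loc_rel_def by auto
qed

lemma equiv_loc_rel: "equiv (carrier R \<times> W) (loc_rel R W)"
proof (rule equivI)
  show "loc_rel R W \<subseteq> (carrier R \<times> W) \<times> (carrier R \<times> W)"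
    unfolding loc_rel_def by auto
  show "refl_on (carrier R \<times> W) (loc_rel R W)"
    unfolding refl_on_def using one_W by (auto simp: loc_rel_iff)
  show "sym (loc_rel R W)"
    unfolding sym_def by (auto simp: loc_rel_iff) (metis)
  show "trans (loc_rel R W)"
  proof (rule transI)
    fix x y z assume "(x, y) \<in> loc_rel R W" "(y, z) \<in> loc_rel R W"
    then obtain a s b t c r where e: "x = (a, s)" "y = (b, t)" "z = (c, r)" and
      h: "((a, s), (b, t)) \<in> loc_rel R W" "((b, t), (c, r)) \<in> loc_rel R W"
      by (metis prod.exhaust)
    then obtain u v where uv: "u \<in> W" "v \<in> W" "u \<otimes> (a \<otimes> t) = u \<otimes> (b \<otimes> s)" "v \<otimes> (b \<otimes> r) = v \<otimes> (c \<otimes> t)"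
      by (auto simp: loc_rel_iff)
    have W: "a \<in> carrier R" "b \<in> carrier R" "c \<in> carrier R" "s \<in> W" "t \<in> W" "r \<in> W"
      using h by (auto simp: loc_rel_iff)
    have cc: "u \<in> carrier R" "v \<in> carrier R" "s \<in> carrier R" "t \<in> carrier R" "r \<in> carrier R"
      using uv W W_closed by auto
    \<comment> \<open>Besides \<open>u\<close> and \<open>v\<close>, the witness for transitivity
      contains \<open>t\<close>, the denominator of the middle fraction, which the comparison leaves
      as a factor.\<close>
    have "(u \<otimes> v \<otimes> t) \<otimes> (a \<otimes> r) = v \<otimes> r \<otimes> (u \<otimes> (a \<otimes> t))" using cc W(1-3) by algebra
    also have "\<dots> = u \<otimes> s \<otimes> (v \<otimes> (b \<otimes> r))" unfolding uv(3) using cc W(1-3) by algebra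
    also have "\<dots> = (u \<otimes> v \<otimes> t) \<otimes> (c \<otimes> s)" unfolding uv(4) using cc W(1-3) by algebra
    finally show "(x, z) \<in> loc_rel R W"
      using W uv mult_W unfolding e loc_rel_iff by (auto intro!: bexI[of _ "u \<otimes> v \<otimes> t"])
  qed
qed

lemma frac_eq_iff:
  assumes "a \<in> carrier R" "s \<in> W" "b \<in> carrier R" "t \<in> W"
  shows "frac a s = frac b t \<longleftrightarrow> (\<exists>u\<in>W. u \<otimes> (a \<otimes> t) = u \<otimes> (b \<otimes> s))"
  using eq_equiv_class_iff[OF equiv_loc_rel, of "(a, s)" "(b, t)"] assms
  unfolding loc_frac_def by (simp add: loc_rel_iff)

lemma frac_eqI:
  assumes "a \<in> carrier R" "s \<in> W" "b \<in> carrier R" "t \<in> W" "a \<otimes> t = b \<otimes> s"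
  shows "frac a s = frac b t"
  using assms one_W by (subst frac_eq_iff) auto

lemma mem_frac_iff:
  assumes "a \<in> carrier R" "s \<in> W"
  shows "(b, t) \<in> frac a s \<longleftrightarrow> b \<in> carrier R \<and> t \<in> W \<and> frac a s = frac b t"
proof -
  have "(b, t) \<in> frac a s \<longleftrightarrow> ((a, s), (b, t)) \<in> loc_rel R W" unfolding loc_frac_def by simp
  also have "\<dots> \<longleftrightarrow> b \<in> carrier R \<and> t \<in> W \<and> frac a s = frac b t"
    using assms frac_eq_iff[OF assms, of b t] by (auto simp: loc_rel_iff)
  finally show ?thesis .
qed

lemma carrier_Loc: "carrier Loc = {frac a s | a s. a \<in> carrier R \<and> s \<in> W}"
  unfolding localization_def loc_frac_def quotient_def by auto

lemma frac_closed [simp]: "a \<in> carrier R \<Longrightarrow> s \<in> W \<Longrightarrow> frac a s \<in> carrier Loc"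
  unfolding carrier_Loc by blast

lemma Loc_cases:
  assumes "x \<in> carrier Loc"
  obtains a s where "a \<in> carrier R" "s \<in> W" "x = frac a s"
  using assms unfolding carrier_Loc by blast

lemma one_Loc: "\<one>\<^bsub>Loc\<^esub> = frac \<one> \<one>"
  and zero_Loc: "\<zero>\<^bsub>Loc\<^esub> = frac \<zero> \<one>"
  unfolding localization_def by simp_all

text \<open>The product in \<open>Loc\<close> is a union over all pairs of representatives.
  Independence of the representatives makes this a union of one and the same class. The sum is
  treated in the same way.\<close>

lemma mult_frac:
  assumes "a \<in> carrier R" "s \<in> W" "b \<in> carrier R" "t \<in> W"
  shows "frac a s \<otimes>\<^bsub>Loc\<^esub> frac b t = frac (a \<otimes> b) (s \<otimes> t)"
proof -
  have "frac (a' \<otimes> b') (s' \<otimes> t') = frac (a \<otimes> b) (s \<otimes> t)"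
    if h: "(a', s') \<in> frac a s" "(b', t') \<in> frac b t" for a' s' b' t'
  proof -
    have W: "a' \<in> carrier R" "s' \<in> W" "b' \<in> carrier R" "t' \<in> W" "frac a s = frac a' s'" "frac b t = frac b' t'"
      using h assms by (auto simp: mem_frac_iff)
    then obtain u v where uv: "u \<in> W" "v \<in> W" "u \<otimes> (a \<otimes> s') = u \<otimes> (a' \<otimes> s)" "v \<otimes> (b \<otimes> t') = v \<otimes> (b' \<otimes> t)"
      using assms by (auto simp: frac_eq_iff)
    have cc: "u \<in> carrier R" "v \<in> carrier R" "s \<in> carrier R" "t \<in> carrier R" "s' \<in> carrier R" "t' \<in> carrier R"
      using uv W assms W_closed by auto
    have "(u \<otimes> v) \<otimes> (a' \<otimes> b' \<otimes> (s \<otimes> t)) = (u \<otimes> (a' \<otimes> s)) \<otimes> (v \<otimes> (b' \<otimes> t))"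
      using cc W(1,3) by algebra
    also have "\<dots> = (u \<otimes> v) \<otimes> (a \<otimes> b \<otimes> (s' \<otimes> t'))"
      unfolding uv(3,4)[symmetric] using cc assms(1,3) by algebra
    finally show ?thesis
      using W assms uv mult_W by (subst frac_eq_iff) auto
  qed
  moreover have "(a, s) \<in> frac a s" "(b, t) \<in> frac b t" using assms by (auto simp: mem_frac_iff)
  ultimately have "{frac (a' \<otimes> b') (s' \<otimes> t') | a' s' b' t'. (a', s') \<in> frac a s \<and> (b', t') \<in> frac b t}
      = {frac (a \<otimes> b) (s \<otimes> t)}" by blast
  then show ?thesis unfolding localization_def by simp
qed

lemma add_frac:
  assumes "a \<in> carrier R" "s \<in> W" "b \<in> carrier R" "t \<in> W"
  shows "frac a s \<oplus>\<^bsub>Loc\<^esub> frac b t = frac (a \<otimes> t \<oplus> b \<otimes> s) (s \<otimes> t)"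
proof -
  have "frac (a' \<otimes> t' \<oplus> b' \<otimes> s') (s' \<otimes> t') = frac (a \<otimes> t \<oplus> b \<otimes> s) (s \<otimes> t)"
    if h: "(a', s') \<in> frac a s" "(b', t') \<in> frac b t" for a' s' b' t'
  proof -
    have W: "a' \<in> carrier R" "s' \<in> W" "b' \<in> carrier R" "t' \<in> W" "frac a s = frac a' s'" "frac b t = frac b' t'"
      using h assms by (auto simp: mem_frac_iff)
    then obtain u v where uv: "u \<in> W" "v \<in> W" "u \<otimes> (a \<otimes> s') = u \<otimes> (a' \<otimes> s)" "v \<otimes> (b \<otimes> t') = v \<otimes> (b' \<otimes> t)"
      using assms by (auto simp: frac_eq_iff)
    have cc: "u \<in> carrier R" "v \<in> carrier R" "s \<in> carrier R" "t \<in> carrier R" "s' \<in> carrier R" "t' \<in> carrier R"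
      using uv W assms W_closed by auto
    have "(u \<otimes> v) \<otimes> ((a' \<otimes> t' \<oplus> b' \<otimes> s') \<otimes> (s \<otimes> t)) =
       v \<otimes> t \<otimes> t' \<otimes> (u \<otimes> (a' \<otimes> s)) \<oplus> u \<otimes> s \<otimes> s' \<otimes> (v \<otimes> (b' \<otimes> t))"
      using cc W(1,3) by algebra
    also have "\<dots> = (u \<otimes> v) \<otimes> ((a \<otimes> t \<oplus> b \<otimes> s) \<otimes> (s' \<otimes> t'))"
      unfolding uv(3,4)[symmetric] using cc assms(1,3) by algebra
    finally show ?thesis
      using W assms uv mult_W cc by (subst frac_eq_iff) auto
  qed
  moreover have "(a, s) \<in> frac a s" "(b, t) \<in> frac b t" using assms by (auto simp: mem_frac_iff)
  ultimately have "{frac (a' \<otimes> t' \<oplus> b' \<otimes> s') (s' \<otimes> t') | a' s' b' t'. (a', s') \<in> frac a s \<and> (b', t') \<in> frac b t}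
      = {frac (a \<otimes> t \<oplus> b \<otimes> s) (s \<otimes> t)}" by blast
  then show ?thesis unfolding localization_def by simp
qed

lemma abelian_group_Loc: "abelian_group Loc"
proof (rule abelian_groupI)
  fix x y z assume "x \<in> carrier Loc" "y \<in> carrier Loc" "z \<in> carrier Loc"
  then obtain a s b t c r where h: "a \<in> carrier R" "s \<in> W" "b \<in> carrier R" "t \<in> W" "c \<in> carrier R" "r \<in> W"
    and e: "x = frac a s" "y = frac b t" "z = frac c r"
    by (metis Loc_cases)
  have cc: "s \<in> carrier R" "t \<in> carrier R" "r \<in> carrier R" using h W_closed by auto
  show "x \<oplus>\<^bsub>Loc\<^esub> y \<oplus>\<^bsub>Loc\<^esub> z = x \<oplus>\<^bsub>Loc\<^esub> (y \<oplus>\<^bsub>Loc\<^esub> z)"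
  proof -
    have "((a \<otimes> t \<oplus> b \<otimes> s) \<otimes> r \<oplus> c \<otimes> (s \<otimes> t)) \<otimes> (s \<otimes> (t \<otimes> r)) = (a \<otimes> (t \<otimes> r) \<oplus> (b \<otimes> r \<oplus> c \<otimes> t) \<otimes> s) \<otimes> (s \<otimes> t \<otimes> r)"
      using cc h(1,3,5) by algebra
    then show ?thesis
      unfolding e using h mult_W cc by (simp add: add_frac) (intro frac_eqI, auto)
  qed
next
  fix x y assume "x \<in> carrier Loc" "y \<in> carrier Loc"
  then obtain a s b t where h: "a \<in> carrier R" "s \<in> W" "b \<in> carrier R" "t \<in> W" 
    and e: "x = frac a s" "y = frac b t"
    by (metis Loc_cases)
  have cc: "s \<in> carrier R" "t \<in> carrier R" using h W_closed by auto
  show "x \<oplus>\<^bsub>Loc\<^esub> y \<in> carrier Loc"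
    unfolding e using h cc mult_W by (simp add: add_frac)
  show "x \<oplus>\<^bsub>Loc\<^esub> y = y \<oplus>\<^bsub>Loc\<^esub> x"
    unfolding e using h cc by (simp add: add_frac m_comm a_comm)
next
  show "\<zero>\<^bsub>Loc\<^esub> \<in> carrier Loc" using one_W by (simp add: zero_Loc)
next
  fix x assume "x \<in> carrier Loc"
  then obtain a s where h: "a \<in> carrier R" "s \<in> W" and e: "x = frac a s"
    by (metis Loc_cases)
  have cc: "s \<in> carrier R" using h W_closed by auto
  show "\<zero>\<^bsub>Loc\<^esub> \<oplus>\<^bsub>Loc\<^esub> x = x" unfolding e zero_Loc using h cc one_W by (simp add: add_frac)
  have "frac (\<ominus> a) s \<oplus>\<^bsub>Loc\<^esub> frac a s = frac \<zero> \<one>"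
  proof -
    have "(\<ominus> a \<otimes> s \<oplus> a \<otimes> s) \<otimes> \<one> = \<zero> \<otimes> (s \<otimes> s)" using h(1) cc by algebra
    then show ?thesis using h cc one_W mult_W by (simp add: add_frac) (intro frac_eqI, auto)
  qed
  then show "\<exists>y\<in>carrier Loc. y \<oplus>\<^bsub>Loc\<^esub> x = \<zero>\<^bsub>Loc\<^esub>"
    unfolding e zero_Loc using h by (intro bexI[of _ "frac (\<ominus> a) s"]) auto
qed

lemma cring_Loc: "cring Loc"
proof (rule cringI[OF abelian_group_Loc])
  show "comm_monoid Loc"
  proof (rule comm_monoidI)
    show "\<one>\<^bsub>Loc\<^esub> \<in> carrier Loc" using one_W by (simp add: one_Loc)
    fix x y z assume "x \<in> carrier Loc" "y \<in> carrier Loc" "z \<in> carrier Loc"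
    then obtain a s b t c r where h: "a \<in> carrier R" "s \<in> W" "b \<in> carrier R" "t \<in> W" "c \<in> carrier R" "r \<in> W"
      and e: "x = frac a s" "y = frac b t" "z = frac c r"
      by (metis Loc_cases)
    then show "x \<otimes>\<^bsub>Loc\<^esub> y \<otimes>\<^bsub>Loc\<^esub> z = x \<otimes>\<^bsub>Loc\<^esub> (y \<otimes>\<^bsub>Loc\<^esub> z)"
      using mult_W W_closed by (simp add: mult_frac m_assoc)
  next
    fix x y assume "x \<in> carrier Loc" "y \<in> carrier Loc"
    then obtain a s b t where h: "a \<in> carrier R" "s \<in> W" "b \<in> carrier R" "t \<in> W" 
      and e: "x = frac a s" "y = frac b t"
      by (metis Loc_cases)
    then show "x \<otimes>\<^bsub>Loc\<^esub> y \<in> carrier Loc" "x \<otimes>\<^bsub>Loc\<^esub> y = y \<otimes>\<^bsub>Loc\<^esub> x"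
      using mult_W W_closed by (simp_all add: mult_frac m_comm)
  next
    fix x assume "x \<in> carrier Loc"
    then obtain a s where h: "a \<in> carrier R" "s \<in> W" and e: "x = frac a s"
      by (metis Loc_cases)
    then show "\<one>\<^bsub>Loc\<^esub> \<otimes>\<^bsub>Loc\<^esub> x = x"
      unfolding one_Loc using one_W W_closed by (simp add: mult_frac)
  qed
next
  fix x y z assume "x \<in> carrier Loc" "y \<in> carrier Loc" "z \<in> carrier Loc"
  then obtain a s b t c r where h: "a \<in> carrier R" "s \<in> W" "b \<in> carrier R" "t \<in> W" "c \<in> carrier R" "r \<in> W"
    and e: "x = frac a s" "y = frac b t" "z = frac c r"
    by (metis Loc_cases)
  have cc: "s \<in> carrier R" "t \<in> carrier R" "r \<in> carrier R" using h W_closed by auto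
  have "((a \<otimes> t \<oplus> b \<otimes> s) \<otimes> c) \<otimes> (s \<otimes> r \<otimes> (t \<otimes> r)) = (a \<otimes> c \<otimes> (t \<otimes> r) \<oplus> b \<otimes> c \<otimes> (s \<otimes> r)) \<otimes> (s \<otimes> t \<otimes> r)"
    using cc h(1,3,5) by algebra
  then show "(x \<oplus>\<^bsub>Loc\<^esub> y) \<otimes>\<^bsub>Loc\<^esub> z = x \<otimes>\<^bsub>Loc\<^esub> z \<oplus>\<^bsub>Loc\<^esub> y \<otimes>\<^bsub>Loc\<^esub> z"
    unfolding e using h mult_W cc by (simp add: add_frac mult_frac) (intro frac_eqI, auto)
qed

sublocale Loc: cring Loc by (rule cring_Loc)

lemma frac_mult_unit:
  assumes "a \<in> carrier R" "s \<in> W" "t \<in> W"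
  shows "frac \<one> t \<otimes>\<^bsub>Loc\<^esub> frac a s = frac a (t \<otimes> s)"
  using assms W_closed by (simp add: mult_frac)

lemma extended_ideal_eq:
  assumes J: "ideal J R"
  shows "Idl\<^bsub>Loc\<^esub> ((\<lambda>a. frac a \<one>) ` J) = {frac a s | a s. a \<in> J \<and> s \<in> W}" (is "?I = ?E")
proof
  note Jc = ideal_carrier[OF J]
  have sub: "(\<lambda>a. frac a \<one>) ` J \<subseteq> carrier Loc" using Jc one_W by auto
  have i: "ideal ?E Loc"
  proof (rule Loc.ideal_if_closed)
    have E: "\<exists>a s. a \<in> J \<and> s \<in> W \<and> a \<in> carrier R \<and> s \<in> carrier R \<and> x = frac a s" if "x \<in> ?E" for x
      using that Jc W_closed by blast
    show "?E \<subseteq> carrier Loc" using Jc by auto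
    show "\<zero>\<^bsub>Loc\<^esub> \<in> ?E" unfolding zero_Loc using ideal_zero_mem[OF J] one_W by blast
    show "x \<otimes>\<^bsub>Loc\<^esub> e \<in> ?E" if e: "x \<in> carrier Loc" "e \<in> ?E" for x e
    proof -
      obtain a s where a: "a \<in> J" "s \<in> W" "a \<in> carrier R" "e = frac a s" using E[OF e(2)] by auto
      obtain b t where b: "b \<in> carrier R" "t \<in> W" "x = frac b t" using e(1) by (rule Loc_cases)
      have "x \<otimes>\<^bsub>Loc\<^esub> e = frac (b \<otimes> a) (t \<otimes> s)" using a b by (simp add: mult_frac)
      then show ?thesis using ideal_lmult[OF J b(1) a(1)] mult_W[OF b(2) a(2)] by blast
    qed
    show "x \<oplus>\<^bsub>Loc\<^esub> y \<in> ?E" if x: "x \<in> ?E" and y: "y \<in> ?E" for x y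
    proof -
      obtain a s where a: "a \<in> J" "s \<in> W" "a \<in> carrier R" "s \<in> carrier R" "x = frac a s" using E[OF x] by auto
      obtain b t where b: "b \<in> J" "t \<in> W" "b \<in> carrier R" "t \<in> carrier R" "y = frac b t" using E[OF y] by auto
      have "x \<oplus>\<^bsub>Loc\<^esub> y = frac (a \<otimes> t \<oplus> b \<otimes> s) (s \<otimes> t)" using a b by (simp add: add_frac)
      moreover have "a \<otimes> t \<oplus> b \<otimes> s \<in> J"
        by (rule ideal_add_mem[OF J ideal.I_r_closed[OF J a(1) b(4)] ideal.I_r_closed[OF J b(1) a(4)]])
      ultimately show ?thesis using mult_W[OF a(2) b(2)] by blast
    qed
  qed
  show "?I \<subseteq> ?E" using one_W by (intro Loc.genideal_minimal[OF i]) auto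
  show "?E \<subseteq> ?I"
  proof
    fix x assume "x \<in> ?E"
    then obtain a s where a: "a \<in> J" "s \<in> W" "x = frac a s" by blast
    have "frac \<one> s \<otimes>\<^bsub>Loc\<^esub> frac a \<one> = x"
      using a Jc W_closed one_W by (subst frac_mult_unit) auto
    moreover have "frac a \<one> \<in> ?I" using Loc.genideal_self[OF sub] a by auto
    ultimately show "x \<in> ?I"
      using Loc.ideal_lmult[OF Loc.genideal_ideal[OF sub], of "frac \<one> s"] a by force
  qed
qed

text \<open>Membership in an extended ideal is a matter of denominators alone. This is the bridge
  between the localization and \<open>contr\<close>.\<close>

lemma frac_mem_extended_iff:
  assumes J: "ideal J R" and x: "x \<in> carrier R" "t \<in> W"
  shows "frac x t \<in> Idl\<^bsub>Loc\<^esub> ((\<lambda>a. frac a \<one>) ` J) \<longleftrightarrow> (\<exists>s\<in>W. s \<otimes> x \<in> J)"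
proof
  assume "frac x t \<in> Idl\<^bsub>Loc\<^esub> ((\<lambda>a. frac a \<one>) ` J)"
  then obtain a s where a: "a \<in> J" "s \<in> W" "frac x t = frac a s" unfolding extended_ideal_eq[OF J] by blast
  have ac: "a \<in> carrier R" using a ideal_carrier[OF J] by auto
  obtain u where u: "u \<in> W" "u \<otimes> (x \<otimes> s) = u \<otimes> (a \<otimes> t)"
    using a(3) frac_eq_iff[OF x ac a(2)] by auto
  have "(u \<otimes> s) \<otimes> x = (u \<otimes> t) \<otimes> a" 
    using u a ac x W_closed by (simp add: m_ac)
  then show "\<exists>s\<in>W. s \<otimes> x \<in> J"
    using ideal_lmult[OF J _ a(1), of "u \<otimes> t"] u a x W_closed mult_W by (metis m_closed)
next
  assume "\<exists>s\<in>W. s \<otimes> x \<in> J"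
  then obtain s where s: "s \<in> W" "s \<otimes> x \<in> J" by auto
  have "frac x t = frac (s \<otimes> x) (s \<otimes> t)"
    using s x W_closed mult_W by (intro frac_eqI) (auto simp: m_ac)
  then show "frac x t \<in> Idl\<^bsub>Loc\<^esub> ((\<lambda>a. frac a \<one>) ` J)"
    unfolding extended_ideal_eq[OF J] using s mult_W[OF s(1) x(2)] by blast
qed

lemma contracted_ideal:
  assumes K: "ideal K Loc"
  shows "ideal {a \<in> carrier R. frac a \<one> \<in> K} R"
proof (rule ideal_if_closed)
  show "{a \<in> carrier R. frac a \<one> \<in> K} \<subseteq> carrier R" by auto
  show "\<zero> \<in> {a \<in> carrier R. frac a \<one> \<in> K}" using Loc.ideal_zero_mem[OF K] zero_Loc by auto
  show "x \<otimes> a \<in> {a \<in> carrier R. frac a \<one> \<in> K}"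
    if a: "x \<in> carrier R" "a \<in> {a \<in> carrier R. frac a \<one> \<in> K}" for x a
  proof -
    have "frac (x \<otimes> a) \<one> = frac x \<one> \<otimes>\<^bsub>Loc\<^esub> frac a \<one>" using a one_W by (simp add: mult_frac)
    then show ?thesis using Loc.ideal_lmult[OF K, of "frac x \<one>" "frac a \<one>"] a one_W by auto
  qed
  show "a \<oplus> b \<in> {a \<in> carrier R. frac a \<one> \<in> K}"
    if "a \<in> {a \<in> carrier R. frac a \<one> \<in> K}" "b \<in> {a \<in> carrier R. frac a \<one> \<in> K}" for a b
  proof -
    have "frac (a \<oplus> b) \<one> = frac a \<one> \<oplus>\<^bsub>Loc\<^esub> frac b \<one>" using that one_W by (simp add: add_frac)
    then show ?thesis using Loc.ideal_add_mem[OF K] that by auto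
  qed
qed

end

section \<open>Translation from the localization at a prime to contractions\<close>

context cring
begin

lemma denominators_prime: "primeideal p R \<Longrightarrow> denominators R (carrier R - p)"
  by unfold_locales (auto simp: primeideal_one primeideal_mult)

lemma loc_map_mem_loc_ideal_iff:
  assumes "primeideal p R" "ideal J R" "a \<in> carrier R"
  shows "loc_map R p a \<in> loc_ideal R p J \<longleftrightarrow> a \<in> contr p J"
proof -
  interpret denominators R "carrier R - p" by (rule denominators_prime[OF assms(1)])
  show ?thesis
    using frac_mem_extended_iff[OF assms(2,3) one_W] assms(3)
    unfolding loc_map_def loc_ideal_def loc_at_def contr_def by auto
qed

text \<open>A fraction is a unit times its numerator, so the numerators generate the same ideals of
  the localization and inherit regularity. They can be chosen in \<open>I\<close> because the
  fractions lie in the extension of \<open>I\<close>. The list is reversed to fit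
  \<open>local_regular\<close>.\<close>

lemma regular_sequence_loc_at:
  assumes p: "primeideal p R" and I: "ideal I R"
    and xs: "regular_sequence (loc_at R p) xs" "loc_ideal R p I = Idl\<^bsub>loc_at R p\<^esub> (set xs)"
  obtains ys where "length ys = length xs" "set ys \<subseteq> I" "local_regular p ys" "I \<subseteq> contr p (Idl (set ys))"
proof -
  interpret denominators R "carrier R - p" by (rule denominators_prime[OF p])
  note Ic = ideal_carrier[OF I]
  have lat: "loc_at R p = Loc" unfolding loc_at_def ..
  have lid: "loc_ideal R p J = Idl\<^bsub>Loc\<^esub> ((\<lambda>a. frac a \<one>) ` J)" for J
    unfolding loc_ideal_def loc_at_def loc_map_def ..
  have xc: "set xs \<subseteq> carrier Loc" using xs unfolding regular_sequence_def lat by auto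
  have "\<exists>q. fst q \<in> I \<and> snd q \<in> carrier R - p \<and> x = frac (fst q) (snd q)" if "x \<in> set xs" for x
  proof -
    have "x \<in> Idl\<^bsub>Loc\<^esub> ((\<lambda>a. frac a \<one>) ` I)"
      using that Loc.genideal_self[OF xc] xs(2) unfolding lid lat by auto
    then show ?thesis unfolding extended_ideal_eq[OF I] by force
  qed
  then obtain q where q: "\<And>x. x \<in> set xs \<Longrightarrow> fst (q x) \<in> I \<and> snd (q x) \<in> carrier R - p \<and> x = frac (fst (q x)) (snd (q x))"
    by metis
  define ys where "ys = map (\<lambda>x. fst (q x)) xs"
  have len: "length ys = length xs" unfolding ys_def by simp
  have ysI: "set ys \<subseteq> I" unfolding ys_def using q by auto
  \<comment> \<open>Equality is needed for every initial segment, since regularity of each element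
    is a condition modulo its predecessors.\<close>
  have gen: "Idl\<^bsub>Loc\<^esub> (set (take i xs)) = Idl\<^bsub>Loc\<^esub> ((\<lambda>a. frac a \<one>) ` (Idl (set (take i ys))))" for i
  proof -
    let ?B = "set (take i xs)" and ?A = "set (take i ys)"
    have A: "?A = (\<lambda>x. fst (q x)) ` ?B" unfolding ys_def by (simp add: take_map)
    have Ac: "?A \<subseteq> carrier R" using ysI Ic set_take_subset[of i ys] by auto
    have B: "?B \<subseteq> set xs" by (rule set_take_subset)
    have Bc: "?B \<subseteq> carrier Loc" using B xc by auto
    note iA = genideal_ideal[OF Ac] and iB = Loc.genideal_ideal[OF Bc]
    have s1: "(\<lambda>a. frac a \<one>) ` (Idl ?A) \<subseteq> carrier Loc" using ideal_carrier[OF iA] one_W by auto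
    show ?thesis
    proof
      show "Idl\<^bsub>Loc\<^esub> ?B \<subseteq> Idl\<^bsub>Loc\<^esub> ((\<lambda>a. frac a \<one>) ` (Idl ?A))"
      proof (rule Loc.genideal_minimal[OF Loc.genideal_ideal[OF s1]], rule subsetI)
        fix x assume x: "x \<in> ?B"
        have "fst (q x) \<in> Idl ?A" using genideal_self[OF Ac] A x by auto
        moreover have "snd (q x) \<in> carrier R - p" "x = frac (fst (q x)) (snd (q x))" using q[of x] x B by auto
        ultimately show "x \<in> Idl\<^bsub>Loc\<^esub> ((\<lambda>a. frac a \<one>) ` (Idl ?A))"
          unfolding extended_ideal_eq[OF iA] by blast
      qed
      have "?A \<subseteq> {a \<in> carrier R. frac a \<one> \<in> Idl\<^bsub>Loc\<^esub> ?B}"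
      proof
        fix a assume "a \<in> ?A"
        then obtain x where x: "x \<in> ?B" "a = fst (q x)" using A by auto
        define s where "s = snd (q x)"
        have ac: "a \<in> carrier R" "s \<in> carrier R - p" "s \<in> carrier R" "x = frac a s"
          using q[of x] x B Ic unfolding s_def by auto
        have "frac s \<one> \<otimes>\<^bsub>Loc\<^esub> x = frac (s \<otimes> a) (\<one> \<otimes> s)"
          unfolding ac(4) using ac(1-3) one_W by (intro mult_frac) auto
        also have "\<dots> = frac a \<one>" using ac(1-3) one_W by (intro frac_eqI) (auto simp: m_comm)
        finally have e: "frac s \<one> \<otimes>\<^bsub>Loc\<^esub> x = frac a \<one>" .
        have "x \<in> Idl\<^bsub>Loc\<^esub> ?B" using Loc.genideal_self[OF Bc] x by auto
        then have "frac s \<one> \<otimes>\<^bsub>Loc\<^esub> x \<in> Idl\<^bsub>Loc\<^esub> ?B" 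
          using ac(3) one_W by (intro Loc.ideal_lmult[OF iB]) auto
        then show "a \<in> {a \<in> carrier R. frac a \<one> \<in> Idl\<^bsub>Loc\<^esub> ?B}" using e ac(1) by simp
      qed
      then have "Idl ?A \<subseteq> {a \<in> carrier R. frac a \<one> \<in> Idl\<^bsub>Loc\<^esub> ?B}"
        by (rule genideal_minimal[OF contracted_ideal[OF iB]])
      then show "Idl\<^bsub>Loc\<^esub> ((\<lambda>a. frac a \<one>) ` (Idl ?A)) \<subseteq> Idl\<^bsub>Loc\<^esub> ?B"
        by (intro Loc.genideal_minimal[OF iB]) auto
    qed
  qed
  have iY: "ideal (Idl (set (take i ys))) R" for i
    using ysI Ic set_take_subset[of i ys] by (intro genideal_ideal) auto
  have mem: "frac a s \<in> Idl\<^bsub>Loc\<^esub> (set (take i xs)) \<longleftrightarrow> a \<in> contr p (Idl (set (take i ys)))"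
    if "a \<in> carrier R" "s \<in> carrier R - p" for a s i
    unfolding gen using frac_mem_extended_iff[OF iY that] that(1) unfolding contr_def by auto
  \<comment> \<open>A longer initial segment adds one element at the head of the reversed list, as
    in the recursion of \<open>local_regular\<close>.\<close>
  have "local_regular p (rev (take k ys))" if "k \<le> length ys" for k
    using that
  proof (induction k)
    case (Suc k)
    have k: "k < length xs" using Suc.prems len by simp
    have "a \<in> contr p (Idl (set (take k ys)))"
      if a: "a \<in> carrier R" "ys ! k \<otimes> a \<in> contr p (Idl (set (take k ys)))" for a
    proof -
      define s where "s = snd (q (xs ! k))"
      have yk: "ys ! k \<in> carrier R" "s \<in> carrier R - p" "s \<in> carrier R" "xs ! k = frac (ys ! k) s"
        using q[OF nth_mem[OF k]] k Ic unfolding s_def ys_def by auto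
      have "xs ! k \<otimes>\<^bsub>Loc\<^esub> frac a \<one> = frac (ys ! k \<otimes> a) s"
        unfolding yk(4) using mult_frac[OF yk(1,2) a(1) one_W] yk(3) by simp
      then have "xs ! k \<otimes>\<^bsub>Loc\<^esub> frac a \<one> \<in> Idl\<^bsub>Loc\<^esub> (set (take k xs))"
        using mem[of "ys ! k \<otimes> a" s k] yk a by simp
      moreover have "frac a \<one> \<in> carrier Loc" using a(1) one_W by simp
      ultimately have "frac a \<one> \<in> Idl\<^bsub>Loc\<^esub> (set (take k xs))"
        using xs(1) k unfolding regular_sequence_def lat by blast
      then show ?thesis using mem[OF a(1) one_W] by simp
    qed
    moreover have "rev (take (Suc k) ys) = ys ! k # rev (take k ys)"
      using Suc.prems by (simp add: take_Suc_conv_app_nth)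
    ultimately show ?case using Suc by simp
  qed simp
  from this[of "length ys"] have reg: "local_regular p (rev ys)" by simp
  have "I \<subseteq> contr p (Idl (set ys))"
  proof
    fix x assume x: "x \<in> I"
    have xcc: "x \<in> carrier R" using x Ic by auto
    have "frac x \<one> \<in> loc_ideal R p I" unfolding lid extended_ideal_eq[OF I] using x one_W by blast
    then have "frac x \<one> \<in> Idl\<^bsub>Loc\<^esub> (set (take (length xs) xs))" unfolding xs(2) lat by simp
    then show "x \<in> contr p (Idl (set ys))" using mem[OF xcc one_W, of "length xs"] len by simp
  qed
  then show thesis using that[of "rev ys"] len ysI reg by simp
qed

end

section \<open>Determinants\<close>

context cring
begin

lemma finsum_bij_betw:
  assumes "bij_betw h A B" "f \<in> B \<rightarrow> carrier R"
  shows "(\<Oplus>x\<in>A. f (h x)) = (\<Oplus>y\<in>B. f y)"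
  using assms finsum_reindex[of f h A] unfolding bij_betw_def by auto

lemma finprod_bij_betw:
  assumes "bij_betw h A B" "f \<in> B \<rightarrow> carrier R"
  shows "(\<Otimes>x\<in>A. f (h x)) = (\<Otimes>y\<in>B. f y)"
  using assms finprod_reindex[of f h A] unfolding bij_betw_def by auto

lemma finsum_uminus:
  assumes "f \<in> A \<rightarrow> carrier R"
  shows "(\<Oplus>x\<in>A. \<ominus> f x) = \<ominus> (\<Oplus>x\<in>A. f x)"
  using assms
proof (induction A rule: infinite_finite_induct)
  case (insert x A)
  then show ?case by (auto simp: Pi_def minus_add)
qed (auto simp: finsum_infinite)

lemma finprod_extract:
  assumes "finite A" "a \<in> A" "\<And>i. i \<in> A \<Longrightarrow> f i \<in> carrier R"
  shows "(\<Otimes>i\<in>A. f i) = f a \<otimes> (\<Otimes>i\<in>A - {a}. f i)"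
proof -
  have "(\<Otimes>i\<in>insert a (A - {a}). f i) = f a \<otimes> (\<Otimes>i\<in>A - {a}. f i)"
    using assms by (intro finprod_insert) auto
  then show ?thesis using assms(2) by (simp add: insert_absorb)
qed

lemma add_pow_sign:
  assumes "a \<in> carrier R"
  shows "add_pow R (sign \<rho>) a = (if evenperm \<rho> then a else \<ominus> a)"
  using assms add.int_pow_1[of a] add.int_pow_neg[of a 1] by (simp add: sign_def)

section \<open>Determinants by the Leibniz formula\<close>

lemma ring_det_cong:
  assumes "\<And>i j. i < k \<Longrightarrow> j < k \<Longrightarrow> A i j = B i j" "\<And>i j. i < k \<Longrightarrow> j < k \<Longrightarrow> B i j \<in> carrier R"
  shows "ring_det R k A = ring_det R k B"
proof -
  have c: "\<rho> i < k" if "\<rho> permutes {..<k}" "i < k" for \<rho> i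
    using permutes_in_image[OF that(1), of i] that(2) by simp
  have "(\<Otimes>i\<in>{..<k}. A i (\<rho> i)) = (\<Otimes>i\<in>{..<k}. B i (\<rho> i))" if "\<rho> permutes {..<k}" for \<rho>
    using assms c[OF that] by (intro finprod_cong') auto
  moreover have "(\<Otimes>i\<in>{..<k}. B i (\<rho> i)) \<in> carrier R" if "\<rho> permutes {..<k}" for \<rho>
    using assms c[OF that] by (intro finprod_closed) auto
  ultimately show ?thesis
    unfolding ring_det_def by (intro add.finprod_cong') (auto simp: add_pow_sign)
qed

context
  fixes k :: nat and A :: "nat \<Rightarrow> nat \<Rightarrow> 'a"
  assumes A: "\<And>i j. i < k \<Longrightarrow> j < k \<Longrightarrow> A i j \<in> carrier R"
begin

lemma perm_lt: "\<rho> permutes {..<k} \<Longrightarrow> i < k \<Longrightarrow> \<rho> i < k"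
  using permutes_in_image[of \<rho> "{..<k}" i] by simp

lemma leibniz_prod_closed: "\<rho> permutes {..<k} \<Longrightarrow> (\<Otimes>i\<in>{..<k}. A i (\<rho> i)) \<in> carrier R"
  using A perm_lt by (intro finprod_closed) auto

lemma leibniz_term_closed: "\<rho> permutes {..<k} \<Longrightarrow> add_pow R (sign \<rho>) (\<Otimes>i\<in>{..<k}. A i (\<rho> i)) \<in> carrier R"
  using leibniz_prod_closed by (simp add: add_pow_sign)

lemma ring_det_closed: "ring_det R k A \<in> carrier R"
  unfolding ring_det_def using leibniz_term_closed by (intro finsum_closed) auto

text \<open>The Leibniz sum is reindexed by inverse permutations, which keep their sign. Facts about
  rows thereby apply to columns of a presentation matrix.\<close>

lemma ring_det_transpose: "ring_det R k (\<lambda>i j. A j i) = ring_det R k A"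
proof -
  have p: "(\<Otimes>i\<in>{..<k}. A (\<rho> i) i) = (\<Otimes>i\<in>{..<k}. A i (inv_into UNIV \<rho> i))" if \<rho>: "\<rho> permutes {..<k}" for \<rho>
  proof -
    have "(\<Otimes>i\<in>{..<k}. A (\<rho> i) (inv_into UNIV \<rho> (\<rho> i))) = (\<Otimes>i\<in>{..<k}. A i (inv_into UNIV \<rho> i))"
      using A perm_lt[OF permutes_inv[OF \<rho>]] by (intro finprod_bij_betw[OF permutes_imp_bij[OF \<rho>]]) auto
    then show ?thesis using permutes_inverses[OF \<rho>] by simp
  qed
  have "ring_det R k (\<lambda>i j. A j i) =
     (\<Oplus>\<rho>\<in>{\<rho>. \<rho> permutes {..<k}}. add_pow R (sign (inv_into UNIV \<rho>)) (\<Otimes>i\<in>{..<k}. A i (inv_into UNIV \<rho> i)))"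
    unfolding ring_det_def
  proof (rule add.finprod_cong'[OF refl])
    show "(\<lambda>\<rho>. add_pow R (sign (inv_into UNIV \<rho>)) (\<Otimes>i\<in>{..<k}. A i (inv_into UNIV \<rho> i))) \<in> {\<rho>. \<rho> permutes {..<k}} \<rightarrow> carrier R"
      using leibniz_term_closed permutes_inv by auto
    fix \<rho> assume "\<rho> \<in> {\<rho>. \<rho> permutes {..<k}}"
    then have \<rho>: "\<rho> permutes {..<k}" by simp
    have "sign (inv_into UNIV \<rho>) = sign \<rho>"
      using \<rho> by (intro sign_inverse) (auto simp: permutation_permutes)
    then show "add_pow R (sign \<rho>) (\<Otimes>i\<in>{..<k}. A (\<rho> i) i) = add_pow R (sign (inv_into UNIV \<rho>)) (\<Otimes>i\<in>{..<k}. A i (inv_into UNIV \<rho> i))"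
      using p[OF \<rho>] by simp
  qed
  also have "\<dots> = ring_det R k A"
    unfolding ring_det_def
  proof (rule finsum_bij_betw)
    show "bij_betw (inv_into UNIV) {\<rho>. \<rho> permutes {..<k}} {\<rho>. \<rho> permutes {..<k}}"
      by (rule bij_betwI[of _ _ _ "inv_into UNIV"]) (auto simp: permutes_inv permutes_inv_inv)
  qed (use leibniz_term_closed in auto)
  finally show ?thesis .
qed

text \<open>Composition with \<open>\<pi>\<close> permutes the Leibniz terms and changes their signs
  uniformly. A result up to sign is enough for membership in ideals.\<close>

lemma ring_det_permute_rows:
  assumes \<pi>: "\<pi> permutes {..<k}"
  shows "ring_det R k (\<lambda>i. A (\<pi> i)) \<in> {ring_det R k A, \<ominus> ring_det R k A}"
proof -
  have p: "(\<Otimes>i\<in>{..<k}. A (\<pi> i) ((\<rho> \<circ> \<pi>) i)) = (\<Otimes>i\<in>{..<k}. A i (\<rho> i))" if \<rho>: "\<rho> permutes {..<k}" for \<rho>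
    using A perm_lt[OF \<rho>] unfolding comp_def by (intro finprod_bij_betw[OF permutes_imp_bij[OF \<pi>]]) auto
  have lt: "(\<Otimes>i\<in>{..<k}. A (\<pi> i) (\<rho> i)) \<in> carrier R" if \<rho>: "\<rho> permutes {..<k}" for \<rho>
    using A perm_lt[OF \<rho>] perm_lt[OF \<pi>] by (intro finprod_closed) auto
  have bij: "bij_betw (\<lambda>\<rho>. \<rho> \<circ> \<pi>) {\<rho>. \<rho> permutes {..<k}} {\<rho>. \<rho> permutes {..<k}}"
    by (rule bij_betwI[of _ _ _ "\<lambda>\<rho>. \<rho> \<circ> inv_into UNIV \<pi>"])
      (use \<pi> in \<open>auto simp: permutes_compose permutes_inv comp_assoc permutes_inv_o\<close>)
  have "ring_det R k (\<lambda>i. A (\<pi> i)) =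
    (\<Oplus>\<rho>\<in>{\<rho>. \<rho> permutes {..<k}}. add_pow R (sign (\<rho> \<circ> \<pi>)) (\<Otimes>i\<in>{..<k}. A (\<pi> i) ((\<rho> \<circ> \<pi>) i)))"
    unfolding ring_det_def using lt by (intro finsum_bij_betw[OF bij, symmetric]) (auto simp: add_pow_sign)
  also have "\<dots> = (\<Oplus>\<rho>\<in>{\<rho>. \<rho> permutes {..<k}}. if evenperm \<pi> then add_pow R (sign \<rho>) (\<Otimes>i\<in>{..<k}. A i (\<rho> i))
       else \<ominus> add_pow R (sign \<rho>) (\<Otimes>i\<in>{..<k}. A i (\<rho> i)))"
  proof (rule add.finprod_cong'[OF refl])
    fix \<rho> assume "\<rho> \<in> {\<rho>. \<rho> permutes {..<k}}"
    then have \<rho>: "\<rho> permutes {..<k}" by simp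
    have "permutation \<rho>" "permutation \<pi>" using \<rho> \<pi> by (auto simp: permutation_permutes)
    then have "evenperm (\<rho> \<circ> \<pi>) \<longleftrightarrow> evenperm \<rho> = evenperm \<pi>" by (rule evenperm_comp)
    then show "add_pow R (sign (\<rho> \<circ> \<pi>)) (\<Otimes>i\<in>{..<k}. A (\<pi> i) ((\<rho> \<circ> \<pi>) i)) =
       (if evenperm \<pi> then add_pow R (sign \<rho>) (\<Otimes>i\<in>{..<k}. A i (\<rho> i)) else \<ominus> add_pow R (sign \<rho>) (\<Otimes>i\<in>{..<k}. A i (\<rho> i)))"
      unfolding p[OF \<rho>] using leibniz_prod_closed[OF \<rho>] by (simp add: add_pow_sign)
  qed (use leibniz_term_closed in auto)
  also have "\<dots> \<in> {ring_det R k A, \<ominus> ring_det R k A}"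
    unfolding ring_det_def using leibniz_term_closed by (cases "evenperm \<pi>") (auto intro!: finsum_uminus)
  finally show ?thesis .
qed

text \<open>Composition with the transposition of \<open>a\<close> and \<open>b\<close> matches even
  permutations with odd ones having the same product, so the terms cancel in pairs. The pairing also
  covers rings in which two is a zero divisor, where a mere change of sign would not show that the
  determinant vanishes.\<close>

lemma ring_det_equal_rows:
  assumes ab: "a < k" "b < k" "a \<noteq> b" and eq: "\<And>j. j < k \<Longrightarrow> A a j = A b j"
  shows "ring_det R k A = \<zero>"
proof -
  define \<tau> where "\<tau> = transpose a b"
  define P where "P \<rho> = (\<Otimes>i\<in>{..<k}. A i (\<rho> i))" for \<rho>
  define E where "E = {\<rho>. \<rho> permutes {..<k} \<and> evenperm \<rho>}"
  define D where "D = {\<rho>. \<rho> permutes {..<k} \<and> \<not> evenperm \<rho>}"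
  have \<tau>: "\<tau> permutes {..<k}" unfolding \<tau>_def using ab by (intro permutes_swap_id) auto
  have fin: "finite E" "finite D" "E \<inter> D = {}" "{\<rho>. \<rho> permutes {..<k}} = E \<union> D"
    unfolding E_def D_def using finite_permutations[of "{..<k}"] by (auto intro: finite_subset[rotated])
  have ED: "\<rho> permutes {..<k}" if "\<rho> \<in> E \<or> \<rho> \<in> D" for \<rho>
    using that unfolding E_def D_def by auto
  have Pc: "P \<rho> \<in> carrier R" if "\<rho> permutes {..<k}" for \<rho>
    unfolding P_def using leibniz_prod_closed that .
  have swap: "P (\<rho> \<circ> \<tau>) = P \<rho>" if \<rho>: "\<rho> permutes {..<k}" for \<rho>
  proof -
    have "P (\<rho> \<circ> \<tau>) = (\<Otimes>i\<in>{..<k}. A (\<tau> i) (\<rho> (\<tau> i)))"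
      unfolding P_def comp_def
    proof (rule finprod_cong'[OF refl])
      fix i assume i: "i \<in> {..<k}"
      have s: "\<rho> (\<tau> i) < k" using i perm_lt[OF \<rho>] perm_lt[OF \<tau>] by auto
      show "A i (\<rho> (\<tau> i)) = A (\<tau> i) (\<rho> (\<tau> i))"
        using eq[OF s] unfolding \<tau>_def by (auto simp: transpose_def)
    qed (use A perm_lt[OF \<rho>] perm_lt[OF \<tau>] in auto)
    also have "\<dots> = P \<rho>"
      unfolding P_def using A perm_lt[OF \<rho>] by (intro finprod_bij_betw[OF permutes_imp_bij[OF \<tau>]]) auto
    finally show ?thesis .
  qed
  have ev: "evenperm (\<rho> \<circ> \<tau>) \<longleftrightarrow> \<not> evenperm \<rho>" if "\<rho> permutes {..<k}" for \<rho>
  proof -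
    have "permutation \<rho>" "permutation \<tau>" using that \<tau> by (auto simp: permutation_permutes)
    moreover have "\<not> evenperm \<tau>" unfolding \<tau>_def using ab by (simp add: evenperm_swap)
    ultimately show ?thesis by (simp add: evenperm_comp)
  qed
  have bij: "bij_betw (\<lambda>\<rho>. \<rho> \<circ> \<tau>) E D"
  proof (rule bij_betwI[of _ _ _ "\<lambda>\<rho>. \<rho> \<circ> \<tau>"])
    show "(\<lambda>\<rho>. \<rho> \<circ> \<tau>) \<in> E \<rightarrow> D" "(\<lambda>\<rho>. \<rho> \<circ> \<tau>) \<in> D \<rightarrow> E"
      using ev permutes_compose[OF \<tau>] unfolding E_def D_def by blast+
    have "\<rho> \<circ> \<tau> \<circ> \<tau> = \<rho>" for \<rho> :: "nat \<Rightarrow> nat"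
      unfolding \<tau>_def by (simp add: fun_eq_iff)
    then show "\<rho> \<circ> \<tau> \<circ> \<tau> = \<rho>" "\<rho> \<circ> \<tau> \<circ> \<tau> = \<rho>" for \<rho> :: "nat \<Rightarrow> nat" by auto
  qed
  have "ring_det R k A = (\<Oplus>\<rho>\<in>E. add_pow R (sign \<rho>) (P \<rho>)) \<oplus> (\<Oplus>\<rho>\<in>D. add_pow R (sign \<rho>) (P \<rho>))"
    unfolding ring_det_def P_def[symmetric] fin(4)
    by (intro finsum_Un_disjoint fin(1-3)) (use Pc ED in \<open>auto simp: add_pow_sign\<close>)
  also have "(\<Oplus>\<rho>\<in>E. add_pow R (sign \<rho>) (P \<rho>)) = (\<Oplus>\<rho>\<in>E. P \<rho>)"
    using Pc by (intro add.finprod_cong') (auto simp: add_pow_sign E_def)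
  also have "(\<Oplus>\<rho>\<in>D. add_pow R (sign \<rho>) (P \<rho>)) = (\<Oplus>\<rho>\<in>D. \<ominus> P \<rho>)"
    using Pc by (intro add.finprod_cong') (auto simp: add_pow_sign D_def)
  also have "\<dots> = (\<Oplus>\<rho>\<in>E. \<ominus> P (\<rho> \<circ> \<tau>))"
    using Pc by (intro finsum_bij_betw[OF bij, symmetric]) (auto simp: D_def)
  also have "\<dots> = (\<Oplus>\<rho>\<in>E. \<ominus> P \<rho>)"
    using Pc swap by (intro add.finprod_cong') (auto simp: E_def)
  also have "\<dots> = \<ominus> (\<Oplus>\<rho>\<in>E. P \<rho>)"
    using Pc by (intro finsum_uminus) (auto simp: E_def)
  also have "(\<Oplus>\<rho>\<in>E. P \<rho>) \<oplus> \<ominus> (\<Oplus>\<rho>\<in>E. P \<rho>) = \<zero>"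
    using Pc by (intro r_neg finsum_closed) (auto simp: E_def)
  finally show ?thesis .
qed

lemma ring_det_diagonal:
  assumes "\<And>i j. i < k \<Longrightarrow> j < k \<Longrightarrow> i \<noteq> j \<Longrightarrow> A i j = \<zero>"
  shows "ring_det R k A = (\<Otimes>i\<in>{..<k}. A i i)"
proof -
  have zero: "(\<Otimes>i\<in>{..<k}. A i (\<rho> i)) = \<zero>" if \<rho>: "\<rho> permutes {..<k}" "\<rho> \<noteq> id" for \<rho>
  proof -
    obtain a where a: "\<rho> a \<noteq> a" using \<rho>(2) by (auto simp: fun_eq_iff)
    then have ak: "a < k" using permutes_not_in[OF \<rho>(1), of a] by auto
    have "(\<Otimes>i\<in>{..<k}. A i (\<rho> i)) = A a (\<rho> a) \<otimes> (\<Otimes>i\<in>{..<k} - {a}. A i (\<rho> i))"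
      using ak A perm_lt[OF \<rho>(1)] by (intro finprod_extract) auto
    also have "A a (\<rho> a) = \<zero>" using a ak perm_lt[OF \<rho>(1)] assms by auto
    finally show ?thesis using A perm_lt[OF \<rho>(1)] by (auto intro!: l_null finprod_closed)
  qed
  have "ring_det R k A = (\<Oplus>\<rho>\<in>{\<rho>. \<rho> permutes {..<k}}. if \<rho> = id then (\<Otimes>i\<in>{..<k}. A i (\<rho> i)) else \<zero>)"
    unfolding ring_det_def
    using leibniz_prod_closed leibniz_prod_closed[OF permutes_id] zero
    by (intro add.finprod_cong') (auto simp: add_pow_sign)
  also have "\<dots> = (\<Otimes>i\<in>{..<k}. A i (id i))"
    using leibniz_prod_closed finite_permutations[of "{..<k}"]
    by (intro add.finprod_singleton_swap[of id _ "\<lambda>\<rho>. \<Otimes>i\<in>{..<k}. A i (\<rho> i)"]) (auto simp: permutes_id)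
  finally show ?thesis by simp
qed

text \<open>Linearity in row \<open>a\<close>, with cofactors that do not depend on that row. They
  are indexed by permutations instead of columns, which avoids submatrices and their signs.\<close>

lemma ring_det_row_expansion:
  assumes a: "a < k"
  shows "\<exists>cof. (\<forall>\<rho>. \<rho> permutes {..<k} \<longrightarrow> cof \<rho> \<in> carrier R) \<and>
    (\<forall>u. (\<forall>j<k. u j \<in> carrier R) \<longrightarrow>
      ring_det R k (A(a := u)) = (\<Oplus>\<rho>\<in>{\<rho>. \<rho> permutes {..<k}}. u (\<rho> a) \<otimes> cof \<rho>))"
proof -
  define Q where "Q \<rho> = (\<Otimes>i\<in>{..<k} - {a}. A i (\<rho> i))" for \<rho>
  have Qc: "Q \<rho> \<in> carrier R" if "\<rho> permutes {..<k}" for \<rho>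
    unfolding Q_def using A perm_lt[OF that] by (intro finprod_closed) auto
  have "ring_det R k (A(a := u)) = (\<Oplus>\<rho>\<in>{\<rho>. \<rho> permutes {..<k}}. u (\<rho> a) \<otimes> add_pow R (sign \<rho>) (Q \<rho>))"
    if u: "\<forall>j<k. u j \<in> carrier R" for u
    unfolding ring_det_def
  proof (rule add.finprod_cong'[OF refl])
    show "(\<lambda>\<rho>. u (\<rho> a) \<otimes> add_pow R (sign \<rho>) (Q \<rho>)) \<in> {\<rho>. \<rho> permutes {..<k}} \<rightarrow> carrier R"
      using u Qc perm_lt a by (auto simp: add_pow_sign)
    fix \<rho> assume "\<rho> \<in> {\<rho>. \<rho> permutes {..<k}}"
    then have \<rho>: "\<rho> permutes {..<k}" by simp
    have uc: "u (\<rho> a) \<in> carrier R" using u perm_lt[OF \<rho>] a by auto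
    have "(\<Otimes>i\<in>{..<k}. (A(a := u)) i (\<rho> i)) = (A(a := u)) a (\<rho> a) \<otimes> (\<Otimes>i\<in>{..<k} - {a}. (A(a := u)) i (\<rho> i))"
      using a u A perm_lt[OF \<rho>] by (intro finprod_extract) auto
    also have "(\<Otimes>i\<in>{..<k} - {a}. (A(a := u)) i (\<rho> i)) = Q \<rho>"
      unfolding Q_def using A perm_lt[OF \<rho>] by (intro finprod_cong') auto
    finally show "add_pow R (sign \<rho>) (\<Otimes>i\<in>{..<k}. (A(a := u)) i (\<rho> i)) = u (\<rho> a) \<otimes> add_pow R (sign \<rho>) (Q \<rho>)"
      using uc Qc[OF \<rho>] by (simp add: add_pow_sign r_minus)
  qed
  then show ?thesis
    using Qc by (intro exI[of _ "\<lambda>\<rho>. add_pow R (sign \<rho>) (Q \<rho>)"]) (auto simp: add_pow_sign)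
qed

lemma ring_det_row_mem:
  assumes a: "a < k" and L: "ideal L R" and u: "\<And>j. j < k \<Longrightarrow> u j \<in> L"
  shows "ring_det R k (A(a := u)) \<in> L"
proof -
  obtain cof where cof: "\<And>\<rho>. \<rho> permutes {..<k} \<Longrightarrow> cof \<rho> \<in> carrier R"
    "\<And>u. (\<forall>j<k. u j \<in> carrier R) \<Longrightarrow>
      ring_det R k (A(a := u)) = (\<Oplus>\<rho>\<in>{\<rho>. \<rho> permutes {..<k}}. u (\<rho> a) \<otimes> cof \<rho>)"
    using ring_det_row_expansion[OF a] by blast
  have "\<forall>j<k. u j \<in> carrier R" using u ideal_carrier[OF L] by auto
  then show ?thesis
    using cof(2)[of u] u cof(1) perm_lt a ideal.I_r_closed[OF L]
    by (auto intro!: ideal_finsum_mem[OF L])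
qed

lemma ring_det_row_sum:
  assumes a: "a < k" and T: "finite T" and h: "\<And>l. l \<in> T \<Longrightarrow> h l \<in> carrier R"
    and V: "\<And>l j. l \<in> T \<Longrightarrow> j < k \<Longrightarrow> V l j \<in> carrier R"
  shows "ring_det R k (A(a := (\<lambda>j. \<Oplus>l\<in>T. h l \<otimes> V l j))) = (\<Oplus>l\<in>T. h l \<otimes> ring_det R k (A(a := V l)))"
proof -
  let ?P = "{\<rho>. \<rho> permutes {..<k}}"
  obtain cof where cof: "\<And>\<rho>. \<rho> permutes {..<k} \<Longrightarrow> cof \<rho> \<in> carrier R"
    and det: "\<And>u. (\<forall>j<k. u j \<in> carrier R) \<Longrightarrow> ring_det R k (A(a := u)) = (\<Oplus>\<rho>\<in>?P. u (\<rho> a) \<otimes> cof \<rho>)"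
    using ring_det_row_expansion[OF a] by blast
  have fP: "finite ?P" by (rule finite_permutations) simp
  have lt: "\<rho> a < k" if "\<rho> permutes {..<k}" for \<rho> using perm_lt[OF that a] .
  have detV: "ring_det R k (A(a := V l)) = (\<Oplus>\<rho>\<in>?P. V l (\<rho> a) \<otimes> cof \<rho>)" if "l \<in> T" for l
    using det V that by auto
  have sc: "(\<lambda>l. h l \<otimes> V l j) \<in> T' \<rightarrow> carrier R" if "T' \<subseteq> T" "j < k" for T' j
    using h V that by auto
  have "(\<Oplus>\<rho>\<in>?P. (\<Oplus>l\<in>T'. h l \<otimes> V l (\<rho> a)) \<otimes> cof \<rho>) = (\<Oplus>l\<in>T'. h l \<otimes> (\<Oplus>\<rho>\<in>?P. V l (\<rho> a) \<otimes> cof \<rho>))"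
    if "finite T'" "T' \<subseteq> T" for T'
    using that
  proof (induction T' rule: finite_induct)
    case empty
    have "(\<Oplus>\<rho>\<in>?P. \<zero> \<otimes> cof \<rho>) = (\<Oplus>\<rho>\<in>?P. \<zero>)"
      using cof by (intro add.finprod_cong') auto
    then show ?case by simp
  next
    case (insert t T')
    have t: "h t \<in> carrier R" "\<And>j. j < k \<Longrightarrow> V t j \<in> carrier R" using insert.prems h V by auto
    have c1: "(\<lambda>\<rho>. V l (\<rho> a) \<otimes> cof \<rho>) \<in> ?P \<rightarrow> carrier R" if "l \<in> T" for l
      using V[OF that] lt cof by auto
    have S: "(\<Oplus>l\<in>T'. h l \<otimes> V l (\<rho> a)) \<in> carrier R" if "\<rho> permutes {..<k}" for \<rho>
      using sc[of T' "\<rho> a"] lt[OF that] insert.prems by (intro finsum_closed) auto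
    have "(\<Oplus>\<rho>\<in>?P. (\<Oplus>l\<in>insert t T'. h l \<otimes> V l (\<rho> a)) \<otimes> cof \<rho>) =
       (\<Oplus>\<rho>\<in>?P. h t \<otimes> (V t (\<rho> a) \<otimes> cof \<rho>) \<oplus> (\<Oplus>l\<in>T'. h l \<otimes> V l (\<rho> a)) \<otimes> cof \<rho>)"
    proof (rule add.finprod_cong'[OF refl])
      show "(\<lambda>\<rho>. h t \<otimes> (V t (\<rho> a) \<otimes> cof \<rho>) \<oplus> (\<Oplus>l\<in>T'. h l \<otimes> V l (\<rho> a)) \<otimes> cof \<rho>) \<in> ?P \<rightarrow> carrier R"
        using t lt cof S by auto
      fix \<rho> assume "\<rho> \<in> ?P"
      then have \<rho>: "\<rho> permutes {..<k}" by simp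
      have "(\<Oplus>l\<in>insert t T'. h l \<otimes> V l (\<rho> a)) = h t \<otimes> V t (\<rho> a) \<oplus> (\<Oplus>l\<in>T'. h l \<otimes> V l (\<rho> a))"
        using insert.hyps t lt[OF \<rho>] sc[of T' "\<rho> a"] insert.prems by (intro finsum_insert) auto
      then show "(\<Oplus>l\<in>insert t T'. h l \<otimes> V l (\<rho> a)) \<otimes> cof \<rho> =
         h t \<otimes> (V t (\<rho> a) \<otimes> cof \<rho>) \<oplus> (\<Oplus>l\<in>T'. h l \<otimes> V l (\<rho> a)) \<otimes> cof \<rho>"
        using t lt[OF \<rho>] cof[OF \<rho>] S[OF \<rho>] by (simp add: l_distr m_assoc)
    qed
    also have "\<dots> = (\<Oplus>\<rho>\<in>?P. h t \<otimes> (V t (\<rho> a) \<otimes> cof \<rho>)) \<oplus> (\<Oplus>\<rho>\<in>?P. (\<Oplus>l\<in>T'. h l \<otimes> V l (\<rho> a)) \<otimes> cof \<rho>)"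
      using t lt cof S by (intro finsum_addf) auto
    also have "(\<Oplus>\<rho>\<in>?P. h t \<otimes> (V t (\<rho> a) \<otimes> cof \<rho>)) = h t \<otimes> (\<Oplus>\<rho>\<in>?P. V t (\<rho> a) \<otimes> cof \<rho>)"
      using t c1[of t] fP insert.prems by (intro finsum_rdistr[symmetric]) auto
    also have "(\<Oplus>\<rho>\<in>?P. (\<Oplus>l\<in>T'. h l \<otimes> V l (\<rho> a)) \<otimes> cof \<rho>) = (\<Oplus>l\<in>T'. h l \<otimes> (\<Oplus>\<rho>\<in>?P. V l (\<rho> a) \<otimes> cof \<rho>))"
      using insert by auto
    also have "h t \<otimes> (\<Oplus>\<rho>\<in>?P. V t (\<rho> a) \<otimes> cof \<rho>) \<oplus> \<dots> = (\<Oplus>l\<in>insert t T'. h l \<otimes> (\<Oplus>\<rho>\<in>?P. V l (\<rho> a) \<otimes> cof \<rho>))"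
      using insert.hyps insert.prems t h finsum_closed[OF c1] by (intro finsum_insert[symmetric]) auto
    finally show ?case .
  qed
  from this[OF T subset_refl] have "(\<Oplus>\<rho>\<in>?P. (\<Oplus>l\<in>T. h l \<otimes> V l (\<rho> a)) \<otimes> cof \<rho>) =
      (\<Oplus>l\<in>T. h l \<otimes> ring_det R k (A(a := V l)))"
    using detV h V lt cof
    by (auto intro!: add.finprod_cong' m_closed finsum_closed)
  moreover have "\<forall>j<k. (\<Oplus>l\<in>T. h l \<otimes> V l j) \<in> carrier R" using sc by (auto intro!: finsum_closed)
  ultimately show ?thesis using det[of "\<lambda>j. \<Oplus>l\<in>T. h l \<otimes> V l j"] by simp
qed

text \<open>Cramer's rule: replace row \<open>a\<close> by the combination of all rows with coefficients \<open>h\<close>.\<close>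

lemma ring_det_mult_mem:
  assumes a: "a < k" and L: "ideal L R" and h: "\<And>i. i < k \<Longrightarrow> h i \<in> carrier R"
    and rel: "\<And>j. j < k \<Longrightarrow> (\<Oplus>i\<in>{..<k}. h i \<otimes> A i j) \<in> L"
  shows "h a \<otimes> ring_det R k A \<in> L"
proof -
  have zero: "ring_det R k (A(a := A i)) = \<zero>" if "i < k" "i \<noteq> a" for i
    by (rule cring.ring_det_equal_rows[OF is_cring _ a that(1)]) (use that A in auto)
  have "ring_det R k (A(a := (\<lambda>j. \<Oplus>i\<in>{..<k}. h i \<otimes> A i j))) \<in> L"
    by (rule ring_det_row_mem[OF a L]) (rule rel)
  also have "ring_det R k (A(a := (\<lambda>j. \<Oplus>i\<in>{..<k}. h i \<otimes> A i j))) = (\<Oplus>i\<in>{..<k}. h i \<otimes> ring_det R k (A(a := A i)))"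
    using a h A by (intro ring_det_row_sum) auto
  also have "\<dots> = (\<Oplus>i\<in>{..<k}. if i = a then h i \<otimes> ring_det R k A else \<zero>)"
    using zero h ring_det_closed by (intro add.finprod_cong') auto
  also have "\<dots> = h a \<otimes> ring_det R k A"
    using a h ring_det_closed by (intro add.finprod_singleton_swap) auto
  finally show ?thesis .
qed

end

text \<open>A weak Cauchy-Binet formula: by multilinearity the determinant of the product of
  \<open>w\<close> and \<open>B\<close> is a combination of determinants whose rows are selected
  from \<open>B\<close>.\<close>

lemma ring_det_mult_rows_mem:
  fixes q :: nat
  assumes M: "ideal M R" and w: "\<And>a l. a < k \<Longrightarrow> l < q \<Longrightarrow> w a l \<in> carrier R"
    and B: "\<And>l j. l < q \<Longrightarrow> j < k \<Longrightarrow> B l j \<in> carrier R"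
    and minors: "\<And>\<phi>. (\<forall>i<k. \<phi> i < q) \<Longrightarrow> ring_det R k (\<lambda>i. B (\<phi> i)) \<in> M"
  shows "ring_det R k (\<lambda>a j. \<Oplus>l\<in>{..<q}. w a l \<otimes> B l j) \<in> M"
proof -
  define C where "C = (\<lambda>a j. \<Oplus>l\<in>{..<q}. w a l \<otimes> B l j)"
  have Cc: "C a j \<in> carrier R" if "a < k" "j < k" for a j
    unfolding C_def using w B that by (intro finsum_closed) auto
  \<comment> \<open>Interpolation between the two matrices: the first \<open>n\<close> rows belong
    to the product, the others are selected from \<open>B\<close>. The step expands row
    \<open>n\<close> and alters the selection only there.\<close>
  have "ring_det R k (\<lambda>i. if i < n then C i else B (\<phi> i)) \<in> M" if "n \<le> k" "\<forall>i<k. \<phi> i < q" for n \<phi>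
    using that
  proof (induction n arbitrary: \<phi>)
    case 0
    then show ?case using minors by simp
  next
    case (Suc n)
    define D where "D = (\<lambda>i. if i < n then C i else B (\<phi> i))"
    have Dc: "D i j \<in> carrier R" if "i < k" "j < k" for i j
      unfolding D_def using Cc B that Suc.prems by auto
    have nk: "n < k" using Suc.prems by simp
    have e: "(\<lambda>i. if i < Suc n then C i else B (\<phi> i)) = D(n := (\<lambda>j. \<Oplus>l\<in>{..<q}. w n l \<otimes> B l j))"
      unfolding D_def C_def by (auto simp: fun_eq_iff less_Suc_eq)
    have "ring_det R k (\<lambda>i. if i < Suc n then C i else B (\<phi> i)) = (\<Oplus>l\<in>{..<q}. w n l \<otimes> ring_det R k (D(n := B l)))"
      unfolding e by (rule ring_det_row_sum[OF Dc nk]) (use w[OF nk] B in auto)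
    also have "\<dots> \<in> M"
    proof (rule ideal_finsum_mem[OF M])
      fix l assume l: "l \<in> {..<q}"
      have "D(n := B l) = (\<lambda>i. if i < n then C i else B ((\<phi>(n := l)) i))"
        unfolding D_def by (auto simp: fun_eq_iff)
      then have "ring_det R k (D(n := B l)) \<in> M"
        using Suc.IH[of "\<phi>(n := l)"] Suc.prems l by simp
      then show "w n l \<otimes> ring_det R k (D(n := B l)) \<in> M"
        using w[OF nk] l by (intro ideal_lmult[OF M]) auto
    qed
    finally show ?case .
  qed
  note * = this
  show ?thesis
  \<comment> \<open>Only when \<open>q = 0\<close> and \<open>k > 0\<close> is there no selection of
    rows to start from; then the rows of the product are empty sums and the determinant is
    zero.\<close>
  proof (cases "q = 0 \<and> k > 0")
    case True
    have "ring_det R k (C(0 := (\<lambda>j. \<Oplus>l\<in>{..<q}. w 0 l \<otimes> B l j))) = (\<Oplus>l\<in>{..<q}. w 0 l \<otimes> ring_det R k (C(0 := B l)))"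
      using True Cc by (intro ring_det_row_sum) auto
    moreover have "C(0 := (\<lambda>j. \<Oplus>l\<in>{..<q}. w 0 l \<otimes> B l j)) = C" unfolding C_def by auto
    ultimately show ?thesis using True ideal_zero_mem[OF M] unfolding C_def by simp
  next
    case False
    then have "\<forall>i<k. (0::nat) < q" by auto
    \<comment> \<open>For \<open>n = k\<close> no row of \<open>B\<close> remains, so the selection
      \<open>\<lambda>_. 0\<close> is a dummy.\<close>
    then have "ring_det R k (\<lambda>i. if i < k then C i else B 0) \<in> M" using *[of k "\<lambda>_. 0"] by simp
    moreover have "ring_det R k (\<lambda>i. if i < k then C i else B 0) = ring_det R k C"
      using Cc by (intro ring_det_cong) auto
    ultimately show ?thesis unfolding C_def by simp
  qed
qed

text \<open>A selection with a repetition gives zero, and an injective one is a strictly increasing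
  selection followed by a permutation, which affects only the sign. This reduces arbitrary
  selections to the increasing ones in \<open>minors_ideal\<close>.\<close>

lemma ring_det_row_selection_mem:
  fixes q :: nat
  assumes M: "ideal M R" and B: "\<And>l j. l < q \<Longrightarrow> j < k \<Longrightarrow> B l j \<in> carrier R"
    and \<phi>: "\<forall>i<k. \<phi> i < q"
    and minors: "\<And>s. strict_mono_on {..<k} s \<Longrightarrow> s ` {..<k} \<subseteq> {..<q} \<Longrightarrow> ring_det R k (\<lambda>i. B (s i)) \<in> M"
  shows "ring_det R k (\<lambda>i. B (\<phi> i)) \<in> M"
proof (cases "inj_on \<phi> {..<k}")
  case False
  then obtain a b where ab: "a < k" "b < k" "a \<noteq> b" "\<phi> a = \<phi> b" unfolding inj_on_def by auto
  have "ring_det R k (\<lambda>i. B (\<phi> i)) = \<zero>"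
    by (rule ring_det_equal_rows[OF _ ab(1-3)]) (use B \<phi> ab in auto)
  then show ?thesis using ideal_zero_mem[OF M] by simp
next
  case True
  define T where "T = \<phi> ` {..<k}"
  have T: "finite T" "card T = k" "T \<subseteq> {..<q}" unfolding T_def using True \<phi> by (auto simp: card_image)
  obtain s where s: "bij_betw s {..<k} T" "strict_mono_on {..<k} s"
    using ex_bij_betw_strict_mono_card[OF T(1)] T(2) by metis
  define \<pi> where "\<pi> i = (if i < k then the_inv_into {..<k} s (\<phi> i) else i)" for i
  have "bij_betw \<phi> {..<k} T" unfolding T_def using True by (simp add: bij_betw_def)
  then have "bij_betw (the_inv_into {..<k} s \<circ> \<phi>) {..<k} {..<k}"
    using bij_betw_the_inv_into[OF s(1)] by (rule bij_betw_trans)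
  then have "bij_betw \<pi> {..<k} {..<k}"
    by (rule iffD1[OF bij_betw_cong, rotated]) (auto simp: \<pi>_def)
  then have \<pi>: "\<pi> permutes {..<k}"
    by (rule bij_imp_permutes) (auto simp: \<pi>_def)
  have s\<pi>: "s (\<pi> i) = \<phi> i" if "i < k" for i
    using that f_the_inv_into_f_bij_betw[OF s(1), of "\<phi> i"] unfolding \<pi>_def T_def by auto
  have sk: "s ` {..<k} \<subseteq> {..<q}" using s(1) T(3) by (auto simp: bij_betw_def)
  have Bs: "B (s i) j \<in> carrier R" if "i < k" "j < k" for i j
    using B[of "s i" j] that sk by auto
  have "ring_det R k (\<lambda>i. B (\<phi> i)) = ring_det R k (\<lambda>i. B (s (\<pi> i)))"
    using s\<pi> B \<phi> by (intro ring_det_cong) auto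
  moreover have "ring_det R k (\<lambda>i. B (s (\<pi> i))) \<in> {ring_det R k (\<lambda>i. B (s i)), \<ominus> ring_det R k (\<lambda>i. B (s i))}"
    using ring_det_permute_rows[of k "\<lambda>i. B (s i)", OF Bs \<pi>] by simp
  ultimately show ?thesis
    using minors[OF s(2) sk] ideal_uminus_mem[OF M] by auto
qed

end

section \<open>Fitting ideals\<close>

context cring
begin

lemma finsum_ideal_module:
  assumes I: "ideal I R" and "finite A" "\<And>i. i \<in> A \<Longrightarrow> f i \<in> I"
  shows "finsum (ideal_module R I) f A = finsum R f A"
proof -
  have I_carrier: "x \<in> carrier R" if "x \<in> I" for x using that ideal_carrier[OF I] by auto
  have "abelian_monoid (ideal_module R I)"
    by (rule abelian_monoidI)
      (auto simp: ideal_module_def I_carrier a_ac ideal_add_mem[OF I] ideal_zero_mem[OF I])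
  then interpret M: abelian_monoid "ideal_module R I" .
  show ?thesis
    using assms(2,3)
  proof (induction A rule: finite_induct)
    case empty
    have "finsum (ideal_module R I) f {} = \<zero>\<^bsub>ideal_module R I\<^esub>" by (rule M.finsum_empty)
    then show ?case by (simp add: ideal_module_def[of R I, THEN arg_cong[of _ _ ring.zero]])
  next
    case (insert x A)
    have "finsum (ideal_module R I) f (insert x A) = f x \<oplus>\<^bsub>ideal_module R I\<^esub> finsum (ideal_module R I) f A"
      using insert.hyps insert.prems by (intro M.finsum_insert) (auto simp: ideal_module_def)
    moreover have "finsum R f (insert x A) = f x \<oplus> finsum R f A"
      using insert.hyps insert.prems I_carrier by (intro finsum_insert) auto
    ultimately show ?case using insert by (simp add: ideal_module_def)
  qed
qed

lemma free_presentation_ideal_iff: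
  assumes I: "ideal I R"
  shows "free_presentation R (ideal_module R I) \<mu> q A g \<longleftrightarrow>
     (\<forall>i<\<mu>. \<forall>j<q. A i j \<in> carrier R) \<and> (\<forall>i<\<mu>. g i \<in> I) \<and>
     (\<forall>x\<in>I. \<exists>v\<in>{..<\<mu>} \<rightarrow> carrier R. x = (\<Oplus>i\<in>{..<\<mu>}. v i \<otimes> g i)) \<and>
     (\<forall>v\<in>{..<\<mu>} \<rightarrow> carrier R. (\<Oplus>i\<in>{..<\<mu>}. v i \<otimes> g i) = \<zero> \<longleftrightarrow>
        (\<exists>w\<in>{..<q} \<rightarrow> carrier R. \<forall>i<\<mu>. v i = (\<Oplus>j\<in>{..<q}. A i j \<otimes> w j)))"
proof -
  have s: "carrier (ideal_module R I) = I" "\<zero>\<^bsub>ideal_module R I\<^esub> = \<zero>"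
    "\<And>a x. a \<odot>\<^bsub>ideal_module R I\<^esub> x = a \<otimes> x"
    by (simp_all add: ideal_module_def)
  have "finsum (ideal_module R I) (\<lambda>i. v i \<otimes> g i) {..<\<mu>} = (\<Oplus>i\<in>{..<\<mu>}. v i \<otimes> g i)"
    if "\<forall>i<\<mu>. g i \<in> I" "v \<in> {..<\<mu>} \<rightarrow> carrier R" for v
    using that by (intro finsum_ideal_module[OF I] ideal_lmult[OF I]) auto
  then show ?thesis
    unfolding free_presentation_def s by (intro conj_cong ball_cong bex_cong refl) auto
qed

lemma mem_Idl_image:
  assumes "finite T" "\<And>i. i \<in> T \<Longrightarrow> g i \<in> carrier R" "x \<in> Idl (g ` T)"
  shows "\<exists>v\<in>T \<rightarrow> carrier R. x = (\<Oplus>i\<in>T. v i \<otimes> g i)"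
  using assms
proof (induction T arbitrary: x rule: finite_induct)
  case empty
  then show ?case by (simp add: Idl_empty)
next
  case (insert t T)
  have c: "g ` T \<subseteq> carrier R" "g t \<in> carrier R" using insert.prems by auto
  obtain w r where wr: "w \<in> Idl (g ` T)" "r \<in> carrier R" "x = w \<oplus> r \<otimes> g t"
    using insert.prems(2) mem_Idl_insert[OF c] by auto
  obtain v where v: "v \<in> T \<rightarrow> carrier R" "w = (\<Oplus>i\<in>T. v i \<otimes> g i)"
    using insert.IH[OF _ wr(1)] insert.prems(1) by auto
  have vg: "(\<lambda>i. v i \<otimes> g i) \<in> T \<rightarrow> carrier R" using v c by auto
  have "(\<Oplus>i\<in>insert t T. (v(t := r)) i \<otimes> g i) = (v(t := r)) t \<otimes> g t \<oplus> (\<Oplus>i\<in>T. (v(t := r)) i \<otimes> g i)"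
    using insert.hyps c wr(2) v(1) by (intro finsum_insert) (auto simp: Pi_def)
  also have "(\<Oplus>i\<in>T. (v(t := r)) i \<otimes> g i) = w"
    unfolding v(2) using insert.hyps vg by (intro add.finprod_cong') (auto simp: Pi_def)
  finally have "x = (\<Oplus>i\<in>insert t T. (v(t := r)) i \<otimes> g i)"
    using wr c vg unfolding v(2) by (simp add: a_comm finsum_closed)
  moreover have "v(t := r) \<in> insert t T \<rightarrow> carrier R" using v wr by auto
  ultimately show ?case by blast
qed

text \<open>Vectors are functions on all of \<open>nat\<close>, so one type serves every rank.
  Combinations grow by one summand at a time and need no index set.\<close>

inductive_set vspan :: "(nat \<Rightarrow> 'a) set \<Rightarrow> (nat \<Rightarrow> 'a) set" for W where
  zero: "(\<lambda>_. \<zero>) \<in> vspan W"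
| step: "v \<in> vspan W \<Longrightarrow> w \<in> W \<Longrightarrow> r \<in> carrier R \<Longrightarrow> (\<lambda>i. v i \<oplus> r \<otimes> w i) \<in> vspan W"

lemma vspan_mono: "v \<in> vspan W \<Longrightarrow> W \<subseteq> W' \<Longrightarrow> v \<in> vspan W'"
  by (induction rule: vspan.induct) (auto intro: vspan.intros)

lemma vspan_carrier: "v \<in> vspan W \<Longrightarrow> (\<And>w i. w \<in> W \<Longrightarrow> w i \<in> carrier R) \<Longrightarrow> v i \<in> carrier R"
  by (induction rule: vspan.induct) auto

lemma vspan_add:
  assumes "u \<in> vspan W" "v \<in> vspan W" and W: "\<And>w i. w \<in> W \<Longrightarrow> w i \<in> carrier R"
  shows "(\<lambda>i. u i \<oplus> v i) \<in> vspan W"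
  using assms(2)
proof induction
  case zero
  have "(\<lambda>i. u i \<oplus> \<zero>) = u" using vspan_carrier[OF assms(1)] W by auto
  then show ?case using assms(1) by simp
next
  case (step v w r)
  have "(\<lambda>i. u i \<oplus> (v i \<oplus> r \<otimes> w i)) = (\<lambda>i. (u i \<oplus> v i) \<oplus> r \<otimes> w i)"
    using vspan_carrier[OF assms(1)] vspan_carrier[OF step.hyps(1)] W step.hyps(2,3)
    by (auto simp: a_assoc)
  then show ?case using vspan.step[OF step.IH step.hyps(2,3)] by simp
qed

lemma vspan_coefficients:
  fixes q :: nat
  assumes "v \<in> vspan (V ` {..<q})" and V: "\<And>j i. j < q \<Longrightarrow> V j i \<in> carrier R"
  shows "\<exists>c\<in>{..<q} \<rightarrow> carrier R. \<forall>i. v i = (\<Oplus>j\<in>{..<q}. V j i \<otimes> c j)"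
  using assms(1)
proof induction
  case zero
  have "(\<Oplus>j\<in>{..<q}. V j i \<otimes> \<zero>) = \<zero>" for i
    using V by (intro add.finprod_one_eqI) auto
  then show ?case by (intro bexI[of _ "\<lambda>_. \<zero>"]) auto
next
  case (step v w r)
  obtain c where c: "c \<in> {..<q} \<rightarrow> carrier R" "\<forall>i. v i = (\<Oplus>j\<in>{..<q}. V j i \<otimes> c j)" using step.IH by blast
  obtain j0 where j0: "j0 < q" "w = V j0" using step.hyps by auto
  have "v i \<oplus> r \<otimes> w i = (\<Oplus>j\<in>{..<q}. V j i \<otimes> (c(j0 := c j0 \<oplus> r)) j)" for i
  proof -
    have "(\<Oplus>j\<in>{..<q}. V j i \<otimes> (c(j0 := c j0 \<oplus> r)) j) =
       (\<Oplus>j\<in>{..<q}. V j i \<otimes> c j \<oplus> (if j = j0 then V j i \<otimes> r else \<zero>))"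
      using V[of _ i] c(1) step.hyps(3) by (intro add.finprod_cong') (auto simp: r_distr Pi_def)
    also have "\<dots> = (\<Oplus>j\<in>{..<q}. V j i \<otimes> c j) \<oplus> (\<Oplus>j\<in>{..<q}. if j = j0 then V j i \<otimes> r else \<zero>)"
      using V[of _ i] c(1) step.hyps(3) by (intro finsum_addf) auto
    also have "(\<Oplus>j\<in>{..<q}. if j = j0 then V j i \<otimes> r else \<zero>) = V j0 i \<otimes> r"
      using V[of _ i] j0(1) step.hyps(3) by (intro add.finprod_singleton_swap) auto
    finally show ?thesis using c(2) j0 V[OF j0(1)] step.hyps(3) by (simp add: m_comm)
  qed
  moreover have "c(j0 := c j0 \<oplus> r) \<in> {..<q} \<rightarrow> carrier R"
    using c(1) j0(1) step.hyps(3) by (auto simp: Pi_def)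
  ultimately show ?case by blast
qed

lemma finprod_not_mem_prime:
  assumes p: "primeideal p R" and "finite A" "\<And>i. i \<in> A \<Longrightarrow> f i \<in> carrier R - p"
  shows "(\<Otimes>i\<in>A. f i) \<in> carrier R - p"
  using assms(2,3)
proof (induction A rule: finite_induct)
  case empty
  then show ?case using primeideal_one[OF p] by simp
next
  case (insert x A)
  have "(\<Otimes>i\<in>insert x A. f i) = f x \<otimes> (\<Otimes>i\<in>A. f i)"
    using insert by (intro finprod_insert) auto
  then show ?case using insert primeideal_mult[OF p, of "f x" "\<Otimes>i\<in>A. f i"] by auto
qed

lemma prime_height_ge:
  "prime_chain R n P \<Longrightarrow> P n = p \<Longrightarrow> enat n \<le> prime_height R p"
  unfolding prime_height_def by (rule Sup_upper) blast

lemma prime_height_chain: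
  assumes p: "primeideal p R" and "enat c \<le> prime_height R p"
  obtains n P where "c \<le> n" "prime_chain R n P" "P n = p"
proof (rule ccontr)
  assume neg: "\<not> thesis"
  note found = that
  have lt: "n < c" if "prime_chain R n P" "P n = p" for n P
  proof (rule ccontr)
    assume "\<not> n < c"
    then have thesis using that by (intro found[of n P]) auto
    then show False using neg by simp
  qed
  \<comment> \<open>The trivial chain makes \<open>c\<close> positive, so that \<open>c - 1\<close>
    in the bound below is a true predecessor.\<close>
  have "prime_chain R 0 (\<lambda>_. p)" unfolding prime_chain_def using p by auto
  then have "0 < c" using lt by blast
  have "prime_height R p \<le> enat (c - 1)"
    unfolding prime_height_def using lt by (intro Sup_least) fastforce
  then have "enat c \<le> enat (c - 1)" using assms(2) order_trans by blast
  then show False using \<open>0 < c\<close> by simp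
qed

lemma prime_chain_extend:
  assumes "prime_chain R n P" "P n = q" "primeideal p R" "q \<subset> p"
  shows "prime_chain R (Suc n) (P(Suc n := p))"
  using assms unfolding prime_chain_def by (auto simp: le_Suc_eq less_Suc_eq)

end

section \<open>Free presentations and Fitting ideals of an ideal\<close>

context noetherian_cring
begin

text \<open>Induction on the rank. The last coordinates form a finitely generated ideal; lifts of
  its generators, together with generators of the submodule where the last coordinate vanishes,
  generate everything.\<close>

lemma submodule_finitely_generated:
  assumes "\<And>v i. v \<in> N \<Longrightarrow> v i \<in> carrier R" "\<And>v i. v \<in> N \<Longrightarrow> \<mu> \<le> i \<Longrightarrow> v i = \<zero>"
    and "\<And>u v. u \<in> N \<Longrightarrow> v \<in> N \<Longrightarrow> (\<lambda>i. u i \<oplus> v i) \<in> N"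
    and "\<And>r v. r \<in> carrier R \<Longrightarrow> v \<in> N \<Longrightarrow> (\<lambda>i. r \<otimes> v i) \<in> N"
    and "(\<lambda>_. \<zero>) \<in> N"
  shows "\<exists>W. finite W \<and> W \<subseteq> N \<and> N \<subseteq> vspan W"
  using assms
proof (induction \<mu> arbitrary: N)
  case 0
  then have "N \<subseteq> {\<lambda>_. \<zero>}" by auto
  then show ?case using vspan.zero by (intro exI[of _ "{}"]) auto
next
  case (Suc \<mu>)
  note Nc = Suc.prems(1) and N0 = Suc.prems(2) and Nadd = Suc.prems(3) and Nmult = Suc.prems(4) and Nz = Suc.prems(5)
  define J where "J = (\<lambda>v. v \<mu>) ` N"
  have J: "ideal J R"
  proof (rule ideal_if_closed)
    show "J \<subseteq> carrier R" "\<zero> \<in> J" unfolding J_def using Nc Nz by auto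
    show "x \<otimes> a \<in> J" if "x \<in> carrier R" "a \<in> J" for x a
      using that Nmult unfolding J_def by force
    show "a \<oplus> b \<in> J" if "a \<in> J" "b \<in> J" for a b
      using that Nadd unfolding J_def by force
  qed
  obtain B where B: "B \<subseteq> carrier R" "finite B" "J = Idl B" using finetely_gen[OF J] by blast
  have "B \<subseteq> J" using B genideal_self by auto
  then have "\<exists>V. \<forall>b\<in>B. V b \<in> N \<and> V b \<mu> = b"
    by (intro bchoice) (auto simp: J_def)
  then obtain V where V: "\<And>b. b \<in> B \<Longrightarrow> V b \<in> N" "\<And>b. b \<in> B \<Longrightarrow> V b \<mu> = b" by blast
  have lift: "\<exists>u\<in>vspan (V ` B'). u \<in> N \<and> u \<mu> = x" if "finite B'" "B' \<subseteq> B" "x \<in> Idl B'" for B' x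
    using that
  proof (induction B' arbitrary: x rule: finite_induct)
    case empty
    then show ?case using vspan.zero Nz by (auto simp: Idl_empty)
  next
    case (insert b B')
    have c: "B' \<subseteq> carrier R" "b \<in> carrier R" "b \<in> B" using insert.prems B by auto
    obtain w r where wr: "w \<in> Idl B'" "r \<in> carrier R" "x = w \<oplus> r \<otimes> b"
      using insert.prems mem_Idl_insert[OF c(1,2)] by auto
    obtain u where u: "u \<in> vspan (V ` B')" "u \<in> N" "u \<mu> = w" using insert.IH[OF _ wr(1)] insert.prems by auto
    have "u \<in> vspan (V ` insert b B')" using vspan_mono[OF u(1)] by auto
    then have "(\<lambda>i. u i \<oplus> r \<otimes> V b i) \<in> vspan (V ` insert b B')"
      using wr(2) by (intro vspan.step) auto
    moreover have "(\<lambda>i. u i \<oplus> r \<otimes> V b i) \<in> N" using Nadd[OF u(2) Nmult[OF wr(2) V(1)[OF c(3)]]] .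
    moreover have "u \<mu> \<oplus> r \<otimes> V b \<mu> = x" using u V(2)[OF c(3)] wr by simp
    ultimately show ?case by blast
  qed
  define N' where "N' = {v \<in> N. v \<mu> = \<zero>}"
  have "\<exists>W. finite W \<and> W \<subseteq> N' \<and> N' \<subseteq> vspan W"
  proof (rule Suc.IH)
    show "v i \<in> carrier R" if "v \<in> N'" for v i using that Nc unfolding N'_def by auto
    show "v i = \<zero>" if "v \<in> N'" "\<mu> \<le> i" for v i
      using that N0[of v i] unfolding N'_def by (cases "i = \<mu>") auto
    show "(\<lambda>i. u i \<oplus> v i) \<in> N'" if "u \<in> N'" "v \<in> N'" for u v using that Nadd unfolding N'_def by auto
    show "(\<lambda>i. r \<otimes> v i) \<in> N'" if "r \<in> carrier R" "v \<in> N'" for r v using that Nmult unfolding N'_def by auto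
    show "(\<lambda>_. \<zero>) \<in> N'" using Nz unfolding N'_def by auto
  qed
  then obtain W where W: "finite W" "W \<subseteq> N'" "N' \<subseteq> vspan W" by blast
  let ?W = "W \<union> V ` B"
  have WN: "?W \<subseteq> N" using W V(1) unfolding N'_def by auto
  have Wc: "w i \<in> carrier R" if "w \<in> ?W" for w i using that WN Nc by auto
  have "N \<subseteq> vspan ?W"
  proof
    fix v assume v: "v \<in> N"
    have "v \<mu> \<in> Idl B" using v B(3) unfolding J_def by auto
    then obtain u where u: "u \<in> vspan (V ` B)" "u \<in> N" "u \<mu> = v \<mu>" using lift[OF B(2)] by auto
    \<comment> \<open>Subtracting a combination of the lifts with the same last coordinate leads
      into the submodule of smaller rank.\<close>
    define d where "d = (\<lambda>i. v i \<oplus> (\<ominus> \<one>) \<otimes> u i)"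
    have "d \<in> N" unfolding d_def using Nadd[OF v Nmult[OF _ u(2), of "\<ominus> \<one>"]] by simp
    moreover have "d \<mu> = \<zero>" unfolding d_def u(3) using Nc[OF v] by (simp add: l_minus r_neg)
    ultimately have "d \<in> vspan W" using W unfolding N'_def by auto
    then have "(\<lambda>i. d i \<oplus> u i) \<in> vspan ?W"
      using u(1) Wc by (intro vspan_add) (auto intro: vspan_mono)
    moreover have "(\<lambda>i. d i \<oplus> u i) = v"
      unfolding d_def using Nc[OF v] Nc[OF u(2)] by (auto simp: l_minus a_assoc l_neg)
    ultimately show "v \<in> vspan ?W" by simp
  qed
  then show ?case using W(1) B(2) WN by (intro exI[of _ ?W]) auto
qed

text \<open>The relations among finitely many generators, extended by zero beyond
  \<open>\<mu>\<close>, form a submodule of a free module of finite rank. Its finitely many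
  generators are the columns of the presentation matrix.\<close>

lemma exists_free_presentation:
  assumes I: "ideal I R"
  shows "\<exists>\<mu> q A g. free_presentation R (ideal_module R I) \<mu> q A g"
proof -
  note Ic = ideal_carrier[OF I]
  obtain B where B: "B \<subseteq> carrier R" "finite B" "I = Idl B" using finetely_gen[OF I] by blast
  obtain g where g: "bij_betw g {0..<card B} B" using ex_bij_betw_nat_finite[OF B(2)] by blast
  define \<mu> where "\<mu> = card B"
  have gB: "g ` {..<\<mu>} = B" using g unfolding \<mu>_def by (auto simp: bij_betw_def atLeast0LessThan)
  have gI: "g i \<in> I" if "i < \<mu>" for i using gB that B genideal_self by auto
  have gc: "g i \<in> carrier R" if "i < \<mu>" for i using gI that Ic by auto
  define N where "N = {v. (\<forall>i. v i \<in> carrier R) \<and> (\<forall>i\<ge>\<mu>. v i = \<zero>) \<and> (\<Oplus>i\<in>{..<\<mu>}. v i \<otimes> g i) = \<zero>}"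
  have Nadd: "(\<lambda>i. u i \<oplus> v i) \<in> N" if uv: "u \<in> N" "v \<in> N" for u v
  proof -
    have c: "\<And>i. u i \<in> carrier R" "\<And>i. v i \<in> carrier R" using uv unfolding N_def by auto
    have "(\<Oplus>i\<in>{..<\<mu>}. (u i \<oplus> v i) \<otimes> g i) = (\<Oplus>i\<in>{..<\<mu>}. u i \<otimes> g i \<oplus> v i \<otimes> g i)"
      using c gc by (intro add.finprod_cong') (auto simp: l_distr)
    also have "\<dots> = (\<Oplus>i\<in>{..<\<mu>}. u i \<otimes> g i) \<oplus> (\<Oplus>i\<in>{..<\<mu>}. v i \<otimes> g i)"
      using c gc by (intro finsum_addf) auto
    finally show ?thesis using uv c unfolding N_def by auto
  qed
  have Nmult: "(\<lambda>i. r \<otimes> v i) \<in> N" if rv: "r \<in> carrier R" "v \<in> N" for r v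
  proof -
    have c: "\<And>i. v i \<in> carrier R" using rv unfolding N_def by auto
    have "(\<Oplus>i\<in>{..<\<mu>}. (r \<otimes> v i) \<otimes> g i) = (\<Oplus>i\<in>{..<\<mu>}. r \<otimes> (v i \<otimes> g i))"
      using c gc rv(1) by (intro add.finprod_cong') (auto simp: m_assoc)
    also have "\<dots> = r \<otimes> (\<Oplus>i\<in>{..<\<mu>}. v i \<otimes> g i)"
      using c gc rv(1) by (intro finsum_rdistr[symmetric]) auto
    finally show ?thesis using rv c unfolding N_def by auto
  qed
  have "(\<Oplus>i\<in>{..<\<mu>}. \<zero> \<otimes> g i) = \<zero>"
    using gc by (intro add.finprod_one_eqI) auto
  then have Nz: "(\<lambda>_. \<zero>) \<in> N" unfolding N_def by auto
  have "\<exists>W. finite W \<and> W \<subseteq> N \<and> N \<subseteq> vspan W"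
    by (rule submodule_finitely_generated[of N \<mu>]) (use Nadd Nmult Nz in \<open>auto simp: N_def\<close>)
  then obtain W where W: "finite W" "W \<subseteq> N" "N \<subseteq> vspan W" by blast
  obtain V where V: "bij_betw V {0..<card W} W" using ex_bij_betw_nat_finite[OF W(1)] by blast
  define q where "q = card W"
  have VW: "V ` {..<q} = W" using V unfolding q_def by (auto simp: bij_betw_def atLeast0LessThan)
  have VN: "V j \<in> N" if "j < q" for j using VW W that by auto
  have Vc: "V j i \<in> carrier R" if "j < q" for j i using VN[OF that] unfolding N_def by auto
  have comb: "(\<lambda>i. \<Oplus>j\<in>{..<n}. V j i \<otimes> w j) \<in> N" if "n \<le> q" "w \<in> {..<q} \<rightarrow> carrier R" for n w
    using that
  proof (induction n)
    case 0
    then show ?case using Nz by simp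
  next
    case (Suc n)
    have "(\<lambda>i. w n \<otimes> V n i) \<in> N" using Suc.prems by (intro Nmult VN) auto
    then have "(\<lambda>i. w n \<otimes> V n i \<oplus> (\<Oplus>j\<in>{..<n}. V j i \<otimes> w j)) \<in> N" using Suc by (intro Nadd) auto
    moreover have "(\<Oplus>j\<in>{..<Suc n}. V j i \<otimes> w j) = w n \<otimes> V n i \<oplus> (\<Oplus>j\<in>{..<n}. V j i \<otimes> w j)" for i
    proof -
      have "(\<Oplus>j\<in>insert n {..<n}. V j i \<otimes> w j) = V n i \<otimes> w n \<oplus> (\<Oplus>j\<in>{..<n}. V j i \<otimes> w j)"
        using Suc.prems Vc by (intro finsum_insert) (auto simp: Pi_def)
      moreover have "w n \<in> carrier R" using Suc.prems by auto
      ultimately show ?thesis using Suc.prems Vc[of n i] m_comm[of "V n i" "w n"] by (auto simp: lessThan_Suc)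
    qed
    ultimately show ?case by simp
  qed
  have "free_presentation R (ideal_module R I) \<mu> q (\<lambda>i j. V j i) g"
    unfolding free_presentation_ideal_iff[OF I]
  proof (intro conjI allI impI ballI)
    show "V j i \<in> carrier R" if "j < q" for i j using Vc that .
    show "g i \<in> I" if "i < \<mu>" for i using gI that .
    show "\<exists>v\<in>{..<\<mu>} \<rightarrow> carrier R. x = (\<Oplus>i\<in>{..<\<mu>}. v i \<otimes> g i)" if "x \<in> I" for x
      using that gc B(3) gB by (intro mem_Idl_image) auto
    fix v assume v: "v \<in> {..<\<mu>} \<rightarrow> carrier R"
    show "(\<Oplus>i\<in>{..<\<mu>}. v i \<otimes> g i) = \<zero> \<longleftrightarrow>
      (\<exists>w\<in>{..<q} \<rightarrow> carrier R. \<forall>i<\<mu>. v i = (\<Oplus>j\<in>{..<q}. V j i \<otimes> w j))"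
    proof
      assume z: "(\<Oplus>i\<in>{..<\<mu>}. v i \<otimes> g i) = \<zero>"
      \<comment> \<open>\<open>v\<close> is constrained only below \<open>\<mu>\<close>; cutting it
        off makes it a member of \<open>N\<close>.\<close>
      define v' where "v' i = (if i < \<mu> then v i else \<zero>)" for i
      have "(\<Oplus>i\<in>{..<\<mu>}. v' i \<otimes> g i) = (\<Oplus>i\<in>{..<\<mu>}. v i \<otimes> g i)"
        unfolding v'_def using v gc by (intro add.finprod_cong') auto
      then have "v' \<in> N" unfolding N_def v'_def using z v by auto
      then have v': "v' \<in> vspan (V ` {..<q})" using W VW by auto
      obtain c where c: "c\<in>{..<q} \<rightarrow> carrier R" "\<forall>i. v' i = (\<Oplus>j\<in>{..<q}. V j i \<otimes> c j)"
        using vspan_coefficients[OF v' Vc] by blast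
      have "\<forall>i<\<mu>. v i = (\<Oplus>j\<in>{..<q}. V j i \<otimes> c j)"
        using c(2) unfolding v'_def by metis
      then show "\<exists>w\<in>{..<q} \<rightarrow> carrier R. \<forall>i<\<mu>. v i = (\<Oplus>j\<in>{..<q}. V j i \<otimes> w j)" using c(1) by blast
    next
      assume "\<exists>w\<in>{..<q} \<rightarrow> carrier R. \<forall>i<\<mu>. v i = (\<Oplus>j\<in>{..<q}. V j i \<otimes> w j)"
      then obtain w where w: "w\<in>{..<q} \<rightarrow> carrier R" "\<forall>i<\<mu>. v i = (\<Oplus>j\<in>{..<q}. V j i \<otimes> w j)" by blast
      have "(\<Oplus>i\<in>{..<\<mu>}. (\<Oplus>j\<in>{..<q}. V j i \<otimes> w j) \<otimes> g i) = \<zero>"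
        using comb[OF order_refl w(1)] unfolding N_def by simp
      moreover have "(\<Oplus>i\<in>{..<\<mu>}. v i \<otimes> g i) = (\<Oplus>i\<in>{..<\<mu>}. (\<Oplus>j\<in>{..<q}. V j i \<otimes> w j) \<otimes> g i)"
        using w v gc by (intro add.finprod_cong') (auto simp: Pi_def)
      ultimately show "(\<Oplus>i\<in>{..<\<mu>}. v i \<otimes> g i) = \<zero>" by simp
    qed
  qed
  then show ?thesis by blast
qed

text \<open>Existence guarantees that the triple picked by \<open>SOME\<close> really is a
  presentation. Both facts about the Fitting ideal below are read off from this one.\<close>

lemma fitting_ideal_cases:
  assumes I: "ideal I R"
  obtains \<mu> q A g where "free_presentation R (ideal_module R I) \<mu> q A g"
    "fitting_ideal R (ideal_module R I) c = (if \<mu> \<le> c then carrier R else minors_ideal R \<mu> q A (\<mu> - c))"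
proof -
  define T where "T = (SOME (\<mu>, q, A). \<exists>g. free_presentation R (ideal_module R I) \<mu> q A g)"
  have "\<exists>x. case x of (\<mu>, q, A) \<Rightarrow> \<exists>g. free_presentation R (ideal_module R I) \<mu> q A g"
    using exists_free_presentation[OF I] by (simp add: split_paired_Ex)
  then have T: "case T of (\<mu>, q, A) \<Rightarrow> \<exists>g. free_presentation R (ideal_module R I) \<mu> q A g"
    unfolding T_def by (rule someI_ex)
  obtain \<mu> q A where e: "T = (\<mu>, q, A)" by (cases T) auto
  then obtain g where "free_presentation R (ideal_module R I) \<mu> q A g" using T by auto
  moreover have "fitting_ideal R (ideal_module R I) c = (if \<mu> \<le> c then carrier R else minors_ideal R \<mu> q A (\<mu> - c))"
    unfolding fitting_ideal_def T_def[symmetric] e by simp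
  ultimately show thesis using that by blast
qed

lemma fitting_ideal_generators:
  assumes I: "ideal I R"
  obtains D where "D \<subseteq> carrier R" "fitting_ideal R (ideal_module R I) c = Idl D"
    "\<forall>d\<in>D. \<exists>fs. distinct fs \<and> set fs \<subseteq> I \<and> length fs \<le> c \<and> (\<forall>x\<in>I. d \<otimes> x \<in> Idl (set fs))"
proof -
  note Ic = ideal_carrier[OF I]
  obtain \<mu> q A g where pres: "free_presentation R (ideal_module R I) \<mu> q A g"
    and fit: "fitting_ideal R (ideal_module R I) c = (if \<mu> \<le> c then carrier R else minors_ideal R \<mu> q A (\<mu> - c))"
    by (rule fitting_ideal_cases[OF I])
  have A: "A i j \<in> carrier R" if "i < \<mu>" "j < q" for i j
    using pres that unfolding free_presentation_ideal_iff[OF I] by blast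
  have gI: "g i \<in> I" if "i < \<mu>" for i
    using pres that unfolding free_presentation_ideal_iff[OF I] by blast
  have gen: "\<exists>v\<in>{..<\<mu>} \<rightarrow> carrier R. x = (\<Oplus>i\<in>{..<\<mu>}. v i \<otimes> g i)" if "x \<in> I" for x
    using pres that unfolding free_presentation_ideal_iff[OF I] by blast
  have rel: "(\<Oplus>i\<in>{..<\<mu>}. v i \<otimes> g i) = \<zero>"
    if "v \<in> {..<\<mu>} \<rightarrow> carrier R" "w \<in> {..<q} \<rightarrow> carrier R" "\<forall>i<\<mu>. v i = (\<Oplus>j\<in>{..<q}. A i j \<otimes> w j)" for v w
    using pres that unfolding free_presentation_ideal_iff[OF I] by blast
  have gc: "g i \<in> carrier R" if "i < \<mu>" for i using gI that Ic by auto
  have enum: "\<exists>fs. distinct fs \<and> set fs \<subseteq> I \<and> length fs \<le> c \<and> (\<forall>x\<in>I. d \<otimes> x \<in> Idl (set fs))"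
    if d: "d \<in> carrier R" and T: "T \<subseteq> {..<\<mu>}" "card T \<le> c" and L: "\<And>i. i < \<mu> \<Longrightarrow> g i \<otimes> d \<in> Idl (g ` T)" for d T
  proof -
    have fT: "finite T" using T finite_subset by auto
    \<comment> \<open>Different indices may carry the same generator, so the list can be shorter
      than \<open>T\<close>.\<close>
    obtain fs where fs: "set fs = g ` T" "distinct fs"
      using finite_distinct_list[of "g ` T"] fT by auto
    have sub: "g ` T \<subseteq> I" using gI T by auto
    have iL: "ideal (Idl (g ` T)) R" using sub Ic by (intro genideal_ideal) auto
    have "length fs = card (g ` T)" using fs distinct_card by metis
    then have len: "length fs \<le> c" using card_image_le[OF fT, of g] T by simp
    note col = colon_ideal[OF iL d]
    have "d \<otimes> x \<in> Idl (g ` T)" if "x \<in> I" for x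
    proof -
      obtain v where v: "v\<in>{..<\<mu>} \<rightarrow> carrier R" "x = (\<Oplus>i\<in>{..<\<mu>}. v i \<otimes> g i)" using gen[OF \<open>x \<in> I\<close>] by blast
      have "x \<in> {r \<in> carrier R. r \<otimes> d \<in> Idl (g ` T)}"
        unfolding v(2)
      proof (rule ideal_finsum_mem[OF col])
        fix i assume i: "i \<in> {..<\<mu>}"
        show "v i \<otimes> g i \<in> {r \<in> carrier R. r \<otimes> d \<in> Idl (g ` T)}"
          by (rule ideal_lmult[OF col]) (use v i gc L in auto)
      qed
      then show ?thesis using m_comm[OF _ d] by auto
    qed
    then show ?thesis using fs sub len by metis
  qed
  show thesis
  proof (cases "\<mu> \<le> c")
    case True
    show thesis
    \<comment> \<open>With at most \<open>c\<close> generators the Fitting ideal is the whole ring;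
      its generator \<open>\<one>\<close> corresponds to the list of all the
      \<open>g i\<close>.\<close>
    proof (rule that[of "{\<one>}"])
      show "fitting_ideal R (ideal_module R I) c = Idl {\<one>}" using fit True genideal_one by simp
      have "g ` {..<\<mu>} \<subseteq> carrier R" using gc by auto
      then have "g i \<otimes> \<one> \<in> Idl (g ` {..<\<mu>})" if "i < \<mu>" for i
        using genideal_self[of "g ` {..<\<mu>}"] that gc by auto
      then show "\<forall>d\<in>{\<one>}. \<exists>fs. distinct fs \<and> set fs \<subseteq> I \<and> length fs \<le> c \<and> (\<forall>x\<in>I. d \<otimes> x \<in> Idl (set fs))"
        using True enum[of \<one> "{..<\<mu>}"] by simp
    qed simp
  next
    case False
    define k where "k = \<mu> - c"
    define D where "D = {ring_det R k (\<lambda>i j. A (r i) (s j)) | r s.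
       strict_mono_on {..<k} r \<and> r ` {..<k} \<subseteq> {..<\<mu>} \<and> strict_mono_on {..<k} s \<and> s ` {..<k} \<subseteq> {..<q}}"
    have Dc: "D \<subseteq> carrier R"
      unfolding D_def by (auto simp: image_subset_iff intro!: ring_det_closed A)
    show thesis
    proof (rule that[OF Dc])
      show "fitting_ideal R (ideal_module R I) c = Idl D"
        using fit False unfolding minors_ideal_def D_def k_def by simp
      show "\<forall>d\<in>D. \<exists>fs. distinct fs \<and> set fs \<subseteq> I \<and> length fs \<le> c \<and> (\<forall>x\<in>I. d \<otimes> x \<in> Idl (set fs))"
      proof
        fix d assume "d \<in> D"
        then obtain r s where d: "d = ring_det R k (\<lambda>i j. A (r i) (s j))"
          and r: "strict_mono_on {..<k} r" "r ` {..<k} \<subseteq> {..<\<mu>}"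
          and s: "s ` {..<k} \<subseteq> {..<q}"
          unfolding D_def by auto
        have inj: "inj_on r {..<k}" using r(1) by (rule strict_mono_on_imp_inj_on)
        \<comment> \<open>The rows outside the minor; their number is \<open>\<mu> - k\<close>,
          which equals \<open>c\<close> since \<open>c < \<mu>\<close>.\<close>
        define T where "T = {..<\<mu>} - r ` {..<k}"
        have T: "T \<subseteq> {..<\<mu>}" "finite T" unfolding T_def by auto
        have "card T = \<mu> - k"
          unfolding T_def using r(2) inj by (subst card_Diff_subset) (auto simp: card_image)
        then have cT: "card T \<le> c" unfolding k_def using False by simp
        have gT: "g ` T \<subseteq> carrier R" using T gc by auto
        note L = genideal_ideal[OF gT]
        have Ars: "A (r i) (s j) \<in> carrier R" if "i < k" "j < k" for i j
          using r(2) s A[of "r i" "s j"] that by auto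
        have grc: "g (r i) \<in> carrier R" if "i < k" for i using r(2) that gc[of "r i"] by auto
        have dc: "d \<in> carrier R" unfolding d using Ars by (rule ring_det_closed)
        have col: "(\<Oplus>i\<in>{..<k}. g (r i) \<otimes> A (r i) (s j)) \<in> Idl (g ` T)" if j: "j < k" for j
        proof -
          have sj: "s j < q" using s j by auto
          have ac: "(\<lambda>i. A i (s j) \<otimes> g i) \<in> U \<rightarrow> carrier R" if "U \<subseteq> {..<\<mu>}" for U
            using that A[OF _ sj] gc by auto
          have "(\<Oplus>i\<in>{..<\<mu>}. A i (s j) \<otimes> g i) = \<zero>"
          \<comment> \<open>Column \<open>s j\<close> is the image of a unit vector and hence a
            relation among the generators.\<close>
          proof (rule rel[of _ "\<lambda>l. if l = s j then \<one> else \<zero>"])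
            show "\<forall>i<\<mu>. A i (s j) = (\<Oplus>l\<in>{..<q}. A i l \<otimes> (if l = s j then \<one> else \<zero>))"
            proof (intro allI impI)
              fix i assume i: "i < \<mu>"
              have "(\<Oplus>l\<in>{..<q}. A i l \<otimes> (if l = s j then \<one> else \<zero>)) = (\<Oplus>l\<in>{..<q}. if l = s j then A i l else \<zero>)"
                using A[OF i] by (intro add.finprod_cong') auto
              also have "\<dots> = A i (s j)"
                using A[OF i] sj by (intro add.finprod_singleton_swap) auto
              finally show "A i (s j) = (\<Oplus>l\<in>{..<q}. A i l \<otimes> (if l = s j then \<one> else \<zero>))" by simp
            qed
          qed (use A[OF _ sj] in auto)
          moreover have "{..<\<mu>} = r ` {..<k} \<union> T" unfolding T_def using r(2) by auto
          moreover have "(\<Oplus>i\<in>r ` {..<k} \<union> T. A i (s j) \<otimes> g i) =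
              (\<Oplus>i\<in>r ` {..<k}. A i (s j) \<otimes> g i) \<oplus> (\<Oplus>i\<in>T. A i (s j) \<otimes> g i)"
            using ac[OF r(2)] ac[OF T(1)] T(2) by (intro finsum_Un_disjoint) (auto simp: T_def)
          moreover have "(\<Oplus>i\<in>r ` {..<k}. A i (s j) \<otimes> g i) = (\<Oplus>i\<in>{..<k}. A (r i) (s j) \<otimes> g (r i))"
            using ac[OF r(2)] inj by (intro finsum_reindex) auto
          moreover have "(\<Oplus>i\<in>{..<k}. A (r i) (s j) \<otimes> g (r i)) = (\<Oplus>i\<in>{..<k}. g (r i) \<otimes> A (r i) (s j))"
            using Ars[OF _ j] grc by (intro add.finprod_cong') (auto simp: m_comm)
          ultimately have sum0: "(\<Oplus>i\<in>{..<k}. g (r i) \<otimes> A (r i) (s j)) \<oplus> (\<Oplus>i\<in>T. A i (s j) \<otimes> g i) = \<zero>"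
            by simp
          have TL: "(\<Oplus>i\<in>T. A i (s j) \<otimes> g i) \<in> Idl (g ` T)"
          proof (rule ideal_finsum_mem[OF L])
            fix i assume "i \<in> T"
            then show "A i (s j) \<otimes> g i \<in> Idl (g ` T)"
              using genideal_self[OF gT] A[OF _ sj] T by (intro ideal_lmult[OF L]) auto
          qed
          have "(\<Oplus>i\<in>{..<k}. g (r i) \<otimes> A (r i) (s j)) \<in> carrier R"
            using Ars[OF _ j] grc by (intro finsum_closed) auto
          then have "(\<Oplus>i\<in>{..<k}. g (r i) \<otimes> A (r i) (s j)) = \<ominus> (\<Oplus>i\<in>T. A i (s j) \<otimes> g i)"
            using sum0 ac[OF T(1)] by (intro minus_equality[symmetric]) (auto intro: finsum_closed simp: a_comm)
          then show ?thesis using ideal_uminus_mem[OF L TL] by simp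
        qed
        have "g i \<otimes> d \<in> Idl (g ` T)" if i: "i < \<mu>" for i
        proof (cases "i \<in> T")
          case True
          then show ?thesis using genideal_self[OF gT] ideal.I_r_closed[OF L _ dc] by auto
        next
          case False
          then obtain a where a: "a < k" "i = r a" using i unfolding T_def by auto
          show ?thesis
            unfolding d a(2) by (rule ring_det_mult_mem[OF Ars a(1) L grc col])
        qed
        then show "\<exists>fs. distinct fs \<and> set fs \<subseteq> I \<and> length fs \<le> c \<and> (\<forall>x\<in>I. d \<otimes> x \<in> Idl (set fs))"
          using enum[OF dc T(1) cT] by blast
      qed
    qed
  qed
qed

text \<open>By exchange, \<open>c\<close> of the generators \<open>g i\<close> generate
  \<open>I\<close> locally. Each of the other \<open>k\<close> generators is, up to a factor outside
  \<open>p\<close>, a combination of these; such a relation is a combination of columns of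
  \<open>A\<close>. Together they give a diagonal \<open>k \<times> k\<close> matrix with entries
  outside \<open>p\<close>, whose determinant lies in the ideal of minors by Cauchy-Binet.\<close>

lemma fitting_ideal_not_subset_prime:
  assumes I: "ideal I R" and p: "primeideal p R"
    and Y: "finite Y" "Y \<subseteq> I" "card Y \<le> c" "I \<subseteq> contr p (Idl Y)"
  shows "\<not> fitting_ideal R (ideal_module R I) c \<subseteq> p"
proof
  assume Hp: "fitting_ideal R (ideal_module R I) c \<subseteq> p"
  note Ic = ideal_carrier[OF I]
  obtain \<mu> q A g where pres: "free_presentation R (ideal_module R I) \<mu> q A g"
    and fit: "fitting_ideal R (ideal_module R I) c = (if \<mu> \<le> c then carrier R else minors_ideal R \<mu> q A (\<mu> - c))"
    by (rule fitting_ideal_cases[OF I])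
  have A: "A i j \<in> carrier R" if "i < \<mu>" "j < q" for i j
    using pres that unfolding free_presentation_ideal_iff[OF I] by blast
  have gI: "g i \<in> I" if "i < \<mu>" for i
    using pres that unfolding free_presentation_ideal_iff[OF I] by blast
  have gen: "\<exists>v\<in>{..<\<mu>} \<rightarrow> carrier R. x = (\<Oplus>i\<in>{..<\<mu>}. v i \<otimes> g i)" if "x \<in> I" for x
    using pres that unfolding free_presentation_ideal_iff[OF I] by blast
  have rel: "\<exists>w\<in>{..<q} \<rightarrow> carrier R. \<forall>i<\<mu>. v i = (\<Oplus>j\<in>{..<q}. A i j \<otimes> w j)"
    if "v \<in> {..<\<mu>} \<rightarrow> carrier R" "(\<Oplus>i\<in>{..<\<mu>}. v i \<otimes> g i) = \<zero>" for v
    using pres that unfolding free_presentation_ideal_iff[OF I] by blast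
  have gc: "g i \<in> carrier R" if "i < \<mu>" for i using gI that Ic by auto
  have "\<not> \<mu> \<le> c" using fit Hp primeideal_one[OF p] by auto
  then have c: "c < \<mu>" by simp
  define k where "k = \<mu> - c"
  have minors: "minors_ideal R \<mu> q A k \<subseteq> p" using fit Hp c unfolding k_def by simp
  let ?G = "g ` {..<\<mu>}"
  have GI: "?G \<subseteq> I" and Gc: "?G \<subseteq> carrier R" using gI gc by auto
  have "I \<subseteq> Idl ?G"
  proof
    fix x assume "x \<in> I"
    then obtain v where v: "v\<in>{..<\<mu>} \<rightarrow> carrier R" "x = (\<Oplus>i\<in>{..<\<mu>}. v i \<otimes> g i)" using gen by blast
    show "x \<in> Idl ?G"
      unfolding v(2)
    proof (rule ideal_finsum_mem[OF genideal_ideal[OF Gc]])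
      fix i assume i: "i \<in> {..<\<mu>}"
      show "v i \<otimes> g i \<in> Idl ?G"
        by (rule ideal_lmult[OF genideal_ideal[OF Gc]]) (use i v genideal_self[OF Gc] in auto)
    qed
  qed
  then have "I \<subseteq> contr p (Idl ?G)"
    using subset_contr[OF p ideal_carrier[OF genideal_ideal[OF Gc]]] by blast
  then obtain T0 where T0: "T0 \<subseteq> ?G" "finite T0" "card T0 \<le> card Y" "I \<subseteq> contr p (Idl T0)"
    using exchange_generators[OF p I GI, of Y "{}"] Y by auto
  obtain T1 where T1: "T1 \<subseteq> {..<\<mu>}" "inj_on g T1" "T0 = g ` T1"
    using T0(1) by (meson subset_image_inj)
  have "card T1 = card T0" using T1 card_image by metis
  then have "card T1 \<le> c" using T0 Y by simp
  \<comment> \<open>The index set is enlarged to exactly \<open>c\<close> elements, so that its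
    complement has the size \<open>k\<close> of the minors.\<close>
  then obtain T where T: "T1 \<subseteq> T" "T \<subseteq> {..<\<mu>}" "card T = c"
    using exists_subset_between[of T1 c "{..<\<mu>}"] c T1(1) by auto
  have fT: "finite T" using T(2) finite_subset by auto
  have gTc: "g ` T \<subseteq> carrier R" using T(2) gc by auto
  have "Idl T0 \<subseteq> Idl (g ` T)" using T1 T gTc by (intro subset_Idl_subset) auto
  then have IT: "I \<subseteq> contr p (Idl (g ` T))" using T0(4) contr_mono by blast
  define Q where "Q = {..<\<mu>} - T"
  have Q: "finite Q" "card Q = k" "Q \<inter> T = {}" "{..<\<mu>} = Q \<union> T"
    unfolding Q_def k_def using T fT by (auto simp: card_Diff_subset)
  obtain r where r: "bij_betw r {..<k} Q" "strict_mono_on {..<k} r"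
    using ex_bij_betw_strict_mono_card[OF Q(1)] Q(2) by metis
  have rQ: "r a \<in> Q" "r a < \<mu>" "r a \<notin> T" if "a < k" for a
    using r(1) that Q unfolding bij_betw_def by auto
  have inj: "r a = r b \<longleftrightarrow> a = b" if "a < k" "b < k" for a b
    using r(1) that unfolding bij_betw_def inj_on_def by auto
  have "\<exists>z. fst z \<in> carrier R - p \<and> snd z \<in> {..<q} \<rightarrow> carrier R \<and>
     (\<forall>b<k. (\<Oplus>l\<in>{..<q}. snd z l \<otimes> A (r b) l) = (if a = b then fst z else \<zero>))" if a: "a < k" for a
  proof -
    have "g (r a) \<in> contr p (Idl (g ` T))" using gI rQ(2)[OF a] IT by auto
    then obtain s where s: "s \<in> carrier R" "s \<notin> p" "s \<otimes> g (r a) \<in> Idl (g ` T)" by (auto simp: contr_def)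
    obtain y where y: "y \<in> T \<rightarrow> carrier R" "s \<otimes> g (r a) = (\<Oplus>i\<in>T. y i \<otimes> g i)"
      using mem_Idl_image[OF fT _ s(3)] T(2) gc by blast
    \<comment> \<open>The coefficient vector of the relation expressing
      \<open>s \<otimes> g (r a)\<close> by the generators indexed by \<open>T\<close>. On the
      complement of \<open>T\<close> it is nonzero at most at \<open>r a\<close>, whence the
      diagonal shape.\<close>
    define e where "e i = (if i = r a then s else if i \<in> T then \<ominus> y i else \<zero>)" for i
    have ec: "e \<in> {..<\<mu>} \<rightarrow> carrier R" unfolding e_def using s y(1) by (auto simp: Pi_def)
    have eg: "(\<lambda>i. e i \<otimes> g i) \<in> U \<rightarrow> carrier R" if "U \<subseteq> {..<\<mu>}" for U
      using that ec gc by auto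
    have Qs: "Q \<subseteq> {..<\<mu>}" unfolding Q_def by auto
    have "(\<Oplus>i\<in>Q \<union> T. e i \<otimes> g i) = (\<Oplus>i\<in>Q. e i \<otimes> g i) \<oplus> (\<Oplus>i\<in>T. e i \<otimes> g i)"
      using eg[OF Qs] eg[OF T(2)] Q fT by (intro finsum_Un_disjoint) auto
    also have "(\<Oplus>i\<in>Q. e i \<otimes> g i) = (\<Oplus>i\<in>Q. if i = r a then s \<otimes> g i else \<zero>)"
      unfolding e_def using s gc Qs Q(3) by (intro add.finprod_cong') auto
    also have "\<dots> = s \<otimes> g (r a)"
      using s gc Qs Q(1) rQ(1)[OF a] by (intro add.finprod_singleton_swap) auto
    also have "(\<Oplus>i\<in>T. e i \<otimes> g i) = (\<Oplus>i\<in>T. \<ominus> (y i \<otimes> g i))"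
      unfolding e_def using y gc T(2) rQ(3)[OF a] by (intro add.finprod_cong') (auto simp: l_minus Pi_def)
    also have "\<dots> = \<ominus> (\<Oplus>i\<in>T. y i \<otimes> g i)"
      using y gc T(2) by (intro finsum_uminus) auto
    also have "s \<otimes> g (r a) \<oplus> \<ominus> (\<Oplus>i\<in>T. y i \<otimes> g i) = \<zero>"
      unfolding y(2)[symmetric] using s gc rQ(2)[OF a] by (intro r_neg) auto
    finally have "(\<Oplus>i\<in>{..<\<mu>}. e i \<otimes> g i) = \<zero>" using Q(4) by simp
    then obtain w where w: "w\<in>{..<q} \<rightarrow> carrier R" "\<forall>i<\<mu>. e i = (\<Oplus>j\<in>{..<q}. A i j \<otimes> w j)"
      using rel[OF ec] by blast
    have "(\<Oplus>l\<in>{..<q}. w l \<otimes> A (r b) l) = (if a = b then s else \<zero>)" if b: "b < k" for b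
    proof -
      have "(\<Oplus>l\<in>{..<q}. w l \<otimes> A (r b) l) = (\<Oplus>l\<in>{..<q}. A (r b) l \<otimes> w l)"
        using w(1) A[OF rQ(2)[OF b]] by (intro add.finprod_cong') (auto simp: Pi_def m_comm)
      also have "\<dots> = e (r b)" using w(2) rQ(2)[OF b] by simp
      also have "\<dots> = (if a = b then s else \<zero>)" unfolding e_def using inj[OF a b] rQ(3)[OF b] by auto
      finally show ?thesis .
    qed
    then show ?thesis using s w by (intro exI[of _ "(s, w)"]) auto
  qed
  then have "\<exists>z. \<forall>a\<in>{..<k}. fst (z a) \<in> carrier R - p \<and> snd (z a) \<in> {..<q} \<rightarrow> carrier R \<and>
     (\<forall>b<k. (\<Oplus>l\<in>{..<q}. snd (z a) l \<otimes> A (r b) l) = (if a = b then fst (z a) else \<zero>))"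
    by (intro bchoice) blast
  then obtain z where z: "\<And>a. a < k \<Longrightarrow> fst (z a) \<in> carrier R - p \<and> snd (z a) \<in> {..<q} \<rightarrow> carrier R \<and>
     (\<forall>b<k. (\<Oplus>l\<in>{..<q}. snd (z a) l \<otimes> A (r b) l) = (if a = b then fst (z a) else \<zero>))"
    by blast
  define C where "C a b = (\<Oplus>l\<in>{..<q}. snd (z a) l \<otimes> A (r b) l)" for a b
  have C: "C a b = (if a = b then fst (z a) else \<zero>)" if "a < k" "b < k" for a b
    unfolding C_def using z that by blast
  have Cc: "C a b \<in> carrier R" if "a < k" "b < k" for a b
    using C[OF that] z[OF that(1)] by auto
  have Ar: "A (r b) l \<in> carrier R" if "l < q" "b < k" for l b using A[OF rQ(2)] that by auto
  define gens where "gens = {ring_det R k (\<lambda>i j. A (r i) (s j)) | r s.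
     strict_mono_on {..<k} r \<and> r ` {..<k} \<subseteq> {..<\<mu>} \<and> strict_mono_on {..<k} s \<and> s ` {..<k} \<subseteq> {..<q}}"
  have gens: "gens \<subseteq> carrier R" unfolding gens_def by (auto simp: image_subset_iff intro!: ring_det_closed A)
  have M: "minors_ideal R \<mu> q A k = Idl gens" unfolding minors_ideal_def gens_def by simp
  note iM = genideal_ideal[OF gens]
  have "ring_det R k C \<in> Idl gens"
    unfolding C_def
  proof (rule ring_det_mult_rows_mem[OF iM])
    show "snd (z a) l \<in> carrier R" if "a < k" "l < q" for a l using z[OF that(1)] that(2) by auto
    show "A (r b) l \<in> carrier R" if "l < q" "b < k" for l b using Ar that .
    fix \<phi> :: "nat \<Rightarrow> nat" assume \<phi>: "\<forall>i<k. \<phi> i < q"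
    show "ring_det R k (\<lambda>i j. A (r j) (\<phi> i)) \<in> Idl gens"
    proof (rule ring_det_row_selection_mem[OF iM Ar \<phi>])
      fix s :: "nat \<Rightarrow> nat" assume s: "strict_mono_on {..<k} s" "s ` {..<k} \<subseteq> {..<q}"
      \<comment> \<open>The combinations are taken over columns of \<open>A\<close>, which therefore
        act as rows in the product formula; transposition returns to the minors as they occur in
        \<open>minors_ideal\<close>.\<close>
      have "ring_det R k (\<lambda>i j. A (r j) (s i)) = ring_det R k (\<lambda>i j. A (r i) (s j))"
        by (rule ring_det_transpose[of k "\<lambda>i j. A (r i) (s j)"]) (use s A rQ in auto)
      moreover have "r ` {..<k} \<subseteq> {..<\<mu>}" using rQ by auto
      ultimately have "ring_det R k (\<lambda>i j. A (r j) (s i)) \<in> gens"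
        unfolding gens_def using s r(2) by blast
      then show "ring_det R k (\<lambda>i j. A (r j) (s i)) \<in> Idl gens" using genideal_self[OF gens] by auto
    qed
  qed
  then have "ring_det R k C \<in> p" using minors M by auto
  moreover have "ring_det R k C = (\<Otimes>a\<in>{..<k}. C a a)"
    by (rule ring_det_diagonal[OF Cc]) (use C in auto)
  moreover have "(\<Otimes>a\<in>{..<k}. C a a) \<in> carrier R - p"
    using C z by (intro finprod_not_mem_prime[OF p]) auto
  ultimately show False by auto
qed

text \<open>The length of the sequence is squeezed from both sides. A regular sequence in
  \<open>p\<close> yields a chain of primes of its length ending in \<open>p\<close>. Conversely
  \<open>p\<close> is minimal over \<open>ys\<close>: a smaller prime over \<open>ys\<close>
  contains \<open>I\<close>, so it has height at least \<open>c\<close>, and \<open>p\<close> would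
  have height above \<open>c\<close>. Krull's theorem then bounds \<open>c\<close> by the
  length.\<close>

lemma associated_prime_regular_generators:
  assumes I: "ideal I R" and c: "enat c \<le> ideal_height R I"
    and p: "p \<in> ass I" "prime_height R p = enat c"
    and xs: "regular_sequence (loc_at R p) xs" "loc_ideal R p I = Idl\<^bsub>loc_at R p\<^esub> (set xs)"
  obtains ys where "length ys = c" "set ys \<subseteq> I" "local_regular p ys" "I \<subseteq> contr p (Idl (set ys))"
proof -
  obtain v where v: "primeideal p R" "v \<in> carrier R" "p = {a \<in> carrier R. a \<otimes> v \<in> I}"
    using p(1) unfolding ass_def by auto
  have Ip: "I \<subseteq> p" unfolding v(3) using ideal_carrier[OF I] v(2) ideal.I_r_closed[OF I] by auto
  obtain ys where ys: "length ys = length xs" "set ys \<subseteq> I" "local_regular p ys" "I \<subseteq> contr p (Idl (set ys))"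
    using regular_sequence_loc_at[OF v(1) I xs] .
  obtain P where "prime_chain R (length ys) P" "P (length ys) = p"
    using local_regular_prime_chain[OF v(1) ys(3) v(1) subset_refl subset_trans[OF ys(2) Ip]] by blast
  then have "length ys \<le> c" using prime_height_ge[of "length ys" P p] p(2) by simp
  moreover have "c \<le> length ys"
  proof -
    obtain n P where P: "c \<le> n" "prime_chain R n P" "P n = p"
      using prime_height_chain[OF v(1), of c] p(2) by auto
    have "n \<le> card (set ys)"
    proof (rule krull_height_theorem[OF v(1) _ _ _ P(2,3)])
      show "set ys \<subseteq> p" using ys Ip by auto
      fix Q assume Q: "primeideal Q R" "set ys \<subseteq> Q" "Q \<subseteq> p"
      have "Idl (set ys) \<subseteq> Q" using Q by (intro genideal_minimal primeideal_ideal)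
      then have "I \<subseteq> Q" using ys(4) contr_mono contr_prime_subset[OF v(1) Q(1,3)] by blast
      then have "ideal_height R I \<le> prime_height R Q"
        unfolding ideal_height_def using Q(1) by (intro INF_lower) auto
      then have "enat c \<le> prime_height R Q" using c order_trans by blast
      then obtain j P' where P': "c \<le> j" "prime_chain R j P'" "P' j = Q" by (rule prime_height_chain[OF Q(1)])
      show "Q = p"
      proof (rule ccontr)
        assume "Q \<noteq> p"
        then have "prime_chain R (Suc j) (P'(Suc j := p))"
          using P' v(1) Q(3) by (intro prime_chain_extend) auto
        then have "enat (Suc j) \<le> enat c" using prime_height_ge[of "Suc j" "P'(Suc j := p)" p] p(2) by simp
        then show False using P'(1) by simp
      qed
    qed simp
    then show ?thesis using card_length[of ys] P(1) by linarith
  qed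
  ultimately show thesis using that[of ys] ys by simp
qed

end

theorem theorem4p3:
  fixes S :: "('a, 'r) ring_scheme" and I :: "'a set" and c m :: nat
  assumes "cohen_macaulay S"
    and "ideal I S" and "I \<noteq> carrier S"
    and "ideal_height S I = enat c"
    and "unmixed S I c"
    and "generically_complete_intersection S I"
    and "m > 0"
  shows "symbolic_power S I m =
    saturation S (ideal_power S I m) (fitting_ideal S (ideal_module S I) c)"
proof -
  interpret noetherian_cring S
    using assms(1) unfolding cohen_macaulay_def noetherian_cring_def by simp
  note I = assms(2)
  define H where "H = fitting_ideal S (ideal_module S I) c"
  have ap: "associated_primes S (quot_module S I) = ass I" by (rule associated_primes_quot[OF I])
  have prime: "primeideal p S" if "p \<in> ass I" for p using that unfolding ass_def by auto
  have Ip: "I \<subseteq> p" if "p \<in> ass I" for p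
    using that ideal_carrier[OF I] ideal.I_r_closed[OF I] unfolding ass_def by auto
  have local: "\<exists>ys. length ys = c \<and> set ys \<subseteq> I \<and> local_regular p ys \<and> I \<subseteq> contr p (Idl\<^bsub>S\<^esub> (set ys))"
    if p: "p \<in> ass I" for p
  proof -
    have h: "prime_height S p = enat c" using assms(5) p unfolding unmixed_def ap by auto
    obtain xs where xs: "regular_sequence (loc_at S p) xs" "loc_ideal S p I = Idl\<^bsub>loc_at S p\<^esub> (set xs)"
      using assms(6) p unfolding generically_complete_intersection_def ap by blast
    show ?thesis
      using associated_prime_regular_generators[OF I _ p h xs] assms(4) by (metis order_refl)
  qed
  have Pm: "ideal (ideal_power S I m) S" by (rule ideal_power_ideal[OF I])
  have sym: "symbolic_power S I m = (\<Inter>p\<in>ass I. contr p (ideal_power S I m))"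
    unfolding symbolic_power_def ap
  proof (rule INF_cong[OF refl])
    fix p assume p: "p \<in> ass I"
    show "{a \<in> carrier S. loc_map S p a \<in> loc_ideal S p (ideal_power S I m)} = contr p (ideal_power S I m)"
      using loc_map_mem_loc_ideal_iff[OF prime[OF p] Pm] contr_carrier by blast
  qed
  obtain D where D: "D \<subseteq> carrier S" "H = Idl\<^bsub>S\<^esub> D"
    and Dfs: "\<forall>d\<in>D. \<exists>fs. distinct fs \<and> set fs \<subseteq> I \<and> length fs \<le> c \<and> (\<forall>x\<in>I. d \<otimes>\<^bsub>S\<^esub> x \<in> Idl\<^bsub>S\<^esub> (set fs))"
    unfolding H_def by (rule fitting_ideal_generators[OF I, where c = c])
  have Hi: "ideal H S" unfolding D(2) by (rule genideal_ideal[OF D(1)])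
  have "\<one>\<^bsub>S\<^esub> \<notin> I" using assms(3) ideal.one_imp_carrier[OF I] by auto
  \<comment> \<open>Properness of \<open>I\<close> provides an associated prime. It shows that
    elements of the symbolic power lie in \<open>carrier S\<close>, which an intersection over an
    empty family would not give.\<close>
  then obtain p0 where p0: "p0 \<in> ass I"
    using ass_above_colon[OF I one_closed] unfolding ass_def by blast
  have "symbolic_power S I m = saturation S (ideal_power S I m) H"
  proof
    show "symbolic_power S I m \<subseteq> saturation S (ideal_power S I m) H"
    proof
      fix a assume "a \<in> symbolic_power S I m"
      then have a: "a \<in> contr p (ideal_power S I m)" if "p \<in> ass I" for p using that sym by auto
      have ac: "a \<in> carrier S" using a[OF p0] contr_carrier by auto
      show "a \<in> saturation S (ideal_power S I m) H"
        unfolding D(2)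
      proof (rule mem_saturation[OF Pm ac D(1)])
        fix d assume d: "d \<in> D"
        have dc: "d \<in> carrier S" using d D by auto
        obtain fs where fs: "distinct fs" "set fs \<subseteq> I" "length fs \<le> c" "\<And>x. x \<in> I \<Longrightarrow> d \<otimes>\<^bsub>S\<^esub> x \<in> Idl\<^bsub>S\<^esub> (set fs)"
          using bspec[OF Dfs d] by blast
        have "local_regular p fs" if p: "p \<in> ass I" "d \<notin> p" for p
        proof -
          obtain ys where ys: "length ys = c" "set ys \<subseteq> I" "local_regular p ys" "I \<subseteq> contr p (Idl\<^bsub>S\<^esub> (set ys))"
            using local[OF p(1)] by blast
          \<comment> \<open>Since \<open>d\<close> is a unit at \<open>p\<close>, multiplying
            \<open>I\<close> into the ideal of \<open>fs\<close> by \<open>d\<close> means that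
            \<open>fs\<close> generates \<open>I\<close> there.\<close>
          have "I \<subseteq> contr p (Idl\<^bsub>S\<^esub> (set fs))"
            using fs(4) dc p(2) ideal_carrier[OF I] by (auto intro!: contrI[of _ d])
          then show ?thesis
            using local_regular_generators[OF prime[OF p(1)] I Ip[OF p(1)] ys(3,2,4) fs(2) _ fs(1)] fs(3) ys(1) by simp
        qed
        then show "\<exists>N::nat. d [^]\<^bsub>S\<^esub> N \<otimes>\<^bsub>S\<^esub> a \<in> ideal_power S I m"
          using power_mult_mem_ideal_power[OF I dc fs(2,4) _ ac a order_refl] by blast
      qed
    qed
    show "saturation S (ideal_power S I m) H \<subseteq> symbolic_power S I m"
    proof
      fix a assume "a \<in> saturation S (ideal_power S I m) H"
      then obtain t where t: "a \<in> carrier S" "\<forall>h\<in>ideal_power S H t. a \<otimes>\<^bsub>S\<^esub> h \<in> ideal_power S I m"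
        unfolding saturation_def ideal_quotient_def by auto
      have "a \<in> contr p (ideal_power S I m)" if p: "p \<in> ass I" for p
      proof -
        obtain ys where ys: "length ys = c" "set ys \<subseteq> I" "I \<subseteq> contr p (Idl\<^bsub>S\<^esub> (set ys))"
          using local[OF p] by blast
        have "\<not> H \<subseteq> p"
          unfolding H_def using ys card_length[of ys]
          by (intro fitting_ideal_not_subset_prime[OF I prime[OF p], of "set ys"]) auto
        then obtain h where h: "h \<in> H" "h \<notin> p" by auto
        have hc: "h \<in> carrier S" using h ideal_carrier[OF Hi] by auto
        have "a \<otimes>\<^bsub>S\<^esub> h [^]\<^bsub>S\<^esub> t \<in> ideal_power S I m"
          using t(2) pow_mem_ideal_power[OF Hi h(1)] by blast
        then show ?thesis
          using primeideal_pow[OF prime[OF p] hc h(2)] t(1) hc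
          by (intro contrI[of _ "h [^]\<^bsub>S\<^esub> t"]) (auto simp: m_comm)
      qed
      then show "a \<in> symbolic_power S I m" unfolding sym by auto
    qed
  qed
  then show ?thesis unfolding H_def .
qed

end
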